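(* Let $n\ge 2$, let $\mathcal{O}$ be a bounded convex domain in $\mathbb{R}^n$ with smooth boundary $\partial\mathcal{O}$, and fix a point $p\in\mathbb{R}^n\setminus\overline{\mathcal{O}}$. Let $\mathcal{S}_1$ and $\mathcal{S}_2$ denote the sets of points $q\in\mathbb{R}^n\setminus\overline{\mathcal{O}}$ for which the minimizer of the energy $E$ over $\mathcal{A}_{p,q}$ is unique and non-unique, respectively. Then $\mathcal{S}_2\subset\partial\mathcal{S}_1$, and in particular $\operatorname{int}(\mathcal{S}_2)=\emptyset$.
   Context: Let $I=[0,1]$ and $\mathcal{O}^c=\mathbb{R}^n\setminus\mathcal{O}$. The energy is $E(\mathbf{u})=\int_I|\mathbf{u}'(t)|^2\,dt$. For $p,q\in\mathbb{R}^n\setminus\overline{\mathcal{O}}$ the admissible set is $$\mathcal{A}_{p,q}=\{\mathbf{u}\in H^1(I,\mathbb{R}^n) : \mathbf{u}(0)=p,\ \mathbf{u}(1)=q,\ \mathbf{u}(t)\in\mathcal{O}^c\text{ for all }t\in I\},$$ where $H^1$ is the Sobolev space of vector-valued functions (identified with their continuous representatives). A minimizer is an element $\mathbf{u}\in\mathcal{A}_{p,q}$ with $E(\mathbf{u})=\inf_{\mathbf{v}\in\mathcal{A}_{p,q}}E(\mathbf{v})$. Here $\partial\mathcal{S}_1$ is the topological boundary of $\mathcal{S}_1$ and $\operatorname{int}$ denotes the topological interior. *)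

theory Defs
  imports "HOL-Analysis.Analysis"
begin

section \<open>Smooth functions and domains with smooth boundary\<close>

text \<open>
  \<open>Ck_on k f S\<close>: \<open>f\<close> is \<open>k\<close> times continuously differentiable on the \<^emph>\<open>open\<close> set \<open>S\<close>.
  In finite dimension, a map is of class \<open>C\<close>\<open>k+1\<close> iff it is differentiable and all
  its directional derivatives are of class \<open>C\<close>\<open>k\<close>.
\<close>

primrec Ck_on ::
  "nat \<Rightarrow> ('a::euclidean_space \<Rightarrow> 'b::euclidean_space) \<Rightarrow> 'a set \<Rightarrow> bool" where
  "Ck_on 0 f S \<longleftrightarrow> continuous_on S f"
| "Ck_on (Suc k) f S \<longleftrightarrow>
     (\<forall>x\<in>S. f differentiable at x) \<and>
     (\<forall>v. Ck_on k (\<lambda>x. frechet_derivative f (at x) v) S)"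

definition smooth_on :: "('a::euclidean_space \<Rightarrow> 'b::euclidean_space) \<Rightarrow> 'a set \<Rightarrow> bool" where
  "smooth_on f S \<longleftrightarrow> (\<forall>k. Ck_on k f S)"

text \<open>
  Smooth boundary, by local defining functions: near each boundary point the set is the
  sublevel set of a smooth function whose differential does not vanish.
\<close>

definition smooth_boundary :: "'a::euclidean_space set \<Rightarrow> bool" where
  "smooth_boundary \<Omega> \<longleftrightarrow>
     (\<forall>x\<in>frontier \<Omega>. \<exists>U (\<rho> :: 'a \<Rightarrow> real).
        open U \<and> x \<in> U \<and> smooth_on \<rho> U \<and>
        (\<forall>y\<in>U. frechet_derivative \<rho> (at y) \<noteq> (\<lambda>_. 0)) \<and>
        \<Omega> \<inter> U = {y\<in>U. \<rho> y < 0} \<and>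
        frontier \<Omega> \<inter> U = {y\<in>U. \<rho> y = 0})"

section \<open>The Sobolev space on the unit interval\<close>

definition L2_I :: "(real \<Rightarrow> 'a::euclidean_space) set" where
  "L2_I = {g. g \<in> borel_measurable (lebesgue_on {0..1}) \<and>
              integrable (lebesgue_on {0..1}) (\<lambda>t. (norm (g t))\<^sup>2)}"

text \<open>
  Test functions are the real \<open>C\<close>\<open>1\<close> functions with compact support in \<open>(0,1)\<close>, as in
  Brezis, Functional Analysis, Sobolev Spaces and PDE, Section 8.2; smooth
  test functions define the same weak derivatives.
\<close>

definition test_function :: "(real \<Rightarrow> real) \<Rightarrow> bool" where
  "test_function \<phi> \<longleftrightarrow>
     \<phi> C1_differentiable_on UNIV \<and> closure {t. \<phi> t \<noteq> 0} \<subseteq> {0<..<1}"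

definition has_weak_derivative_I ::
  "(real \<Rightarrow> 'a::euclidean_space) \<Rightarrow> (real \<Rightarrow> 'a) \<Rightarrow> bool" where
  "has_weak_derivative_I u g \<longleftrightarrow>
     g \<in> L2_I \<and>
     (\<forall>\<phi>. test_function \<phi> \<longrightarrow>
        (LINT t|lebesgue_on {0..1}. deriv \<phi> t *\<^sub>R u t) =
        - (LINT t|lebesgue_on {0..1}. \<phi> t *\<^sub>R g t))"

text \<open>
  Elements of the Sobolev space are represented by their continuous representative (which is
  automatically square integrable). Being extensional makes equality of HOL functions
  coincide with equality of functions on \<open>[0,1]\<close>.
\<close>

definition H1_I :: "(real \<Rightarrow> 'a::euclidean_space) set" where
  "H1_I = {u. u \<in> extensional {0..1} \<and> continuous_on {0..1} u \<and>
              (\<exists>g. has_weak_derivative_I u g)}"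

text \<open>The weak derivative is unique up to null sets, so the choice does not affect the energy.\<close>

definition weak_derivative_I :: "(real \<Rightarrow> 'a::euclidean_space) \<Rightarrow> real \<Rightarrow> 'a" where
  "weak_derivative_I u = (SOME g. has_weak_derivative_I u g)"

section \<open>The obstacle problem\<close>

definition energy :: "(real \<Rightarrow> 'a::euclidean_space) \<Rightarrow> real" where
  "energy u = (LINT t|lebesgue_on {0..1}. (norm (weak_derivative_I u t))\<^sup>2)"

definition admissible :: "'a::euclidean_space set \<Rightarrow> 'a \<Rightarrow> 'a \<Rightarrow> (real \<Rightarrow> 'a) set" where
  "admissible \<Omega> p q =
     {u \<in> H1_I. u 0 = p \<and> u 1 = q \<and> (\<forall>t\<in>{0..1}. u t \<in> - \<Omega>)}"

definition is_minimizer ::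
  "'a::euclidean_space set \<Rightarrow> 'a \<Rightarrow> 'a \<Rightarrow> (real \<Rightarrow> 'a) \<Rightarrow> bool" where
  "is_minimizer \<Omega> p q u \<longleftrightarrow>
     u \<in> admissible \<Omega> p q \<and> energy u = (INF v\<in>admissible \<Omega> p q. energy v)"

definition unique_set :: "'a::euclidean_space set \<Rightarrow> 'a \<Rightarrow> 'a set" where
  "unique_set \<Omega> p = {q \<in> - closure \<Omega>. \<exists>!u. is_minimizer \<Omega> p q u}"

definition nonunique_set :: "'a::euclidean_space set \<Rightarrow> 'a \<Rightarrow> 'a set" where
  "nonunique_set \<Omega> p =
     {q \<in> - closure \<Omega>. \<exists>u v. is_minimizer \<Omega> p q u \<and> is_minimizer \<Omega> p q v \<and> u \<noteq> v}"

end

theory Submission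
  imports Defs
begin

text \<open>
  A point \<open>q\<close> of the nonuniqueness set is the limit, as \<open>s\<close> tends to 1, of the points \<open>u s\<close> of any
  minimizer \<open>u\<close> ending at \<open>q\<close>. Each \<open>u s\<close> that lies off the closed obstacle is a uniqueness point:
  the part of \<open>u\<close> up to time \<open>s\<close> minimizes, and any other minimizer to \<open>u s\<close>, continued along \<open>u\<close>,
  is again a minimizer to \<open>q\<close>; so it suffices that two minimizers with the same end points that agree
  near time 1 agree everywhere (\<open>minimizers_do_not_branch\<close>). Hence the nonuniqueness set lies in the
  closure of the uniqueness set. As the two sets are disjoint, it lies in the frontier and has empty
  interior.

  To see that minimizers do not branch, go back to the earliest time \<open>T\<close> from which on the two curves
  agree, and suppose \<open>T > 0\<close>. Both have the same position and velocity at \<open>T\<close>. Off the obstacle both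
  are straight near \<open>T\<close>, so they agree a little longer. If they touch the obstacle at \<open>T\<close>, convexity
  helps: between two contacts with no contact in between a minimizer would be a chord of the closed
  obstacle, so contact times have no gaps. Either, then, one of the curves is a straight segment up
  to \<open>T\<close>, which is the only minimizer between its end points; or both curves stay on the boundary
  just before \<open>T\<close>. There both solve the geodesic equation of the boundary, a second order equation
  with Lipschitz right-hand side because the boundary is smooth, and a Gronwall argument finishes
  the proof.

  All the regularity that this needs comes from one comparison (\<open>minimizer_concave\<close>): if the curve
  may be pushed in direction \<open>e\<close> without entering the obstacle, then the component of the curve along
  \<open>e\<close> is concave, since otherwise lifting it to a chord would save energy. At a contact this holds
  for all \<open>e\<close> in a cone around the outer normal. Concavity gives one-sided derivatives, and a
  corner could only bend into the obstacle, which the curve, lying outside, does not allow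
  (\<open>minimizer_differentiable\<close>). On shorter and shorter time intervals the cone of admissible
  directions opens up to a half space, so the change of the velocity is normal to the boundary up to second order
  (\<open>velocity_change_nearly_normal\<close>); its normal component is forced by tangency. This is the geodesic
  equation (\<open>minimizer_acceleration_on_contact\<close>).

  The comparison is carried out on indefinite integrals of square integrable functions, which are
  exactly the elements of the Sobolev space by the lemma of du Bois-Reymond.
\<close>

section \<open>Square integrable functions on an interval\<close>

text \<open>
  Membership in \<open>L\<^sup>2\<close> is phrased with the gauge integral, for which subintervals, stretching and
  changes at the end points are easiest to handle. On a bounded interval, integrability of \<open>g\<close>
  itself supplies the measurability (\<open>L2_I_iff_L2_on\<close>).
\<close>
definition L2_on :: "(real \<Rightarrow> 'a::euclidean_space) \<Rightarrow> real \<Rightarrow> real \<Rightarrow> bool" where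
  "L2_on g a b \<longleftrightarrow> g integrable_on {a..b} \<and> (\<lambda>t. (norm (g t))\<^sup>2) integrable_on {a..b}"

lemma norm_le_one_plus_square: "(x::real) \<le> 1 + x\<^sup>2"
  using zero_le_power2[of "x - 1/2"] by (simp add: power2_eq_square algebra_simps)

lemma L2_on_absolutely_integrable:
  assumes "L2_on g a b"
  shows "g absolutely_integrable_on {a..b}"
proof (rule absolutely_integrable_integrable_bound)
  show "(\<lambda>t. 1 + (norm (g t))\<^sup>2) integrable_on {a..b}"
    using assms unfolding L2_on_def by (intro integrable_add) auto
qed (use assms norm_le_one_plus_square in \<open>auto simp: L2_on_def\<close>)

lemma L2_onI_bounded:
  fixes g :: "real \<Rightarrow> 'a::euclidean_space"
  assumes g: "g absolutely_integrable_on {a..b}" and h: "h integrable_on {a..b}"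
    and le: "\<And>t. t \<in> {a..b} \<Longrightarrow> (norm (g t))\<^sup>2 \<le> h t"
  shows "L2_on g a b"
proof -
  have m: "g \<in> borel_measurable (lebesgue_on {a..b})"
    using absolutely_integrable_imp_borel_measurable[OF g] by simp
  have "(\<lambda>t. (norm (g t))\<^sup>2) absolutely_integrable_on {a..b}"
    by (rule measurable_bounded_by_integrable_imp_absolutely_integrable[OF _ _ h])
      (use m le in auto)
  then show ?thesis
    using g by (auto simp: L2_on_def absolutely_integrable_on_def)
qed

lemma L2_on_subinterval:
  assumes "L2_on g a b" "a \<le> c" "d \<le> b"
  shows "L2_on g c d"
  using assms unfolding L2_on_def
  by (auto intro: integrable_on_subinterval)

lemma L2_on_combine:
  assumes "a \<le> c" "c \<le> b" "L2_on g a c" "L2_on g c b"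
  shows "L2_on g a b"
  using assms unfolding L2_on_def
  by (auto intro: Henstock_Kurzweil_Integration.integrable_combine)

lemma L2_on_cong_interior:
  assumes "L2_on f a b" and eq: "\<And>t. a < t \<Longrightarrow> t < b \<Longrightarrow> g t = f t"
  shows "L2_on g a b"
proof -
  have "g integrable_on {a..b}"
    by (rule integrable_spike_finite[of "{a,b}" _ _ f]) (use assms in \<open>auto simp: L2_on_def\<close>)
  moreover have "(\<lambda>t. (norm (g t))\<^sup>2) integrable_on {a..b}"
    by (rule integrable_spike_finite[of "{a,b}" _ _ "\<lambda>t. (norm (f t))\<^sup>2"])
      (use assms in \<open>auto simp: L2_on_def\<close>)
  ultimately show ?thesis by (simp add: L2_on_def)
qed

lemma integral_cong_interior:
  fixes f g :: "real \<Rightarrow> 'a::banach"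
  assumes "\<And>t. a < t \<Longrightarrow> t < b \<Longrightarrow> g t = f t"
  shows "integral {a..b} g = integral {a..b} f"
  by (rule integral_spike[of "{a,b}"]) (use assms in auto)

lemma L2_on_linear:
  assumes T: "bounded_linear T" and g: "L2_on g a b"
  shows "L2_on (\<lambda>t. T (g t)) a b"
proof -
  obtain K where K: "\<And>x. norm (T x) \<le> norm x * K"
    using bounded_linear.bounded[OF T] by auto
  have "(T \<circ> g) absolutely_integrable_on {a..b}"
    using absolutely_integrable_linear[OF L2_on_absolutely_integrable[OF g] T] .
  moreover have "(\<lambda>t. K\<^sup>2 * (norm (g t))\<^sup>2) integrable_on {a..b}"
    using g by (intro integrable_on_mult_right) (simp add: L2_on_def)
  moreover have "(norm (T x))\<^sup>2 \<le> K\<^sup>2 * (norm x)\<^sup>2" for x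
    using power_mono[OF K norm_ge_zero, of _ 2] by (simp add: power_mult_distrib mult.commute)
  ultimately show ?thesis
    by (intro L2_onI_bounded) (auto simp: o_def)
qed

lemma L2_on_const: "L2_on (\<lambda>t. c) a b"
  by (simp add: L2_on_def integrable_const_ivl)

lemma L2_on_add:
  assumes "L2_on f a b" "L2_on g a b"
  shows "L2_on (\<lambda>t. f t + g t) a b"
proof (rule L2_onI_bounded)
  show "(\<lambda>t. f t + g t) absolutely_integrable_on {a..b}"
    using assms by (intro set_integral_add L2_on_absolutely_integrable)
  show "(\<lambda>t. 2 * (norm (f t))\<^sup>2 + 2 * (norm (g t))\<^sup>2) integrable_on {a..b}"
    using assms unfolding L2_on_def by (intro integrable_add) auto
  fix t
  have "(norm (f t + g t))\<^sup>2 \<le> (norm (f t) + norm (g t))\<^sup>2"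
    by (intro power_mono norm_triangle_ineq) auto
  also have "\<dots> \<le> 2 * (norm (f t))\<^sup>2 + 2 * (norm (g t))\<^sup>2"
    using zero_le_power2[of "norm (f t) - norm (g t)"] by (simp add: power2_eq_square algebra_simps)
  finally show "(norm (f t + g t))\<^sup>2 \<le> 2 * (norm (f t))\<^sup>2 + 2 * (norm (g t))\<^sup>2" .
qed

lemma L2_on_diff: "L2_on f a b \<Longrightarrow> L2_on g a b \<Longrightarrow> L2_on (\<lambda>t. f t - g t) a b"
  using L2_on_add[of f a b "\<lambda>t. - g t"] L2_on_linear[OF bounded_linear_minus[OF bounded_linear_ident], of g a b]
  by simp

lemma has_integral_stretch_Icc:
  fixes f :: "real \<Rightarrow> 'a::real_normed_vector"
  assumes "(f has_integral i) {a..b}" "m > 0"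
  shows "((\<lambda>t. f (m * t)) has_integral (i /\<^sub>R m)) {a/m..b/m}"
  using has_integral_affinity'[of f i a b m 0] assms by (simp add: divide_inverse mult.commute)

lemma L2_on_stretch:
  assumes "L2_on g a b" "m > 0"
  shows "L2_on (\<lambda>t. g (m * t)) (a/m) (b/m)"
  using assms has_integral_stretch_Icc[of g _ a b m] has_integral_stretch_Icc[of "\<lambda>t. (norm (g t))\<^sup>2" _ a b m]
  unfolding L2_on_def integrable_on_def by blast

lemma L2_I_iff_L2_on: "g \<in> L2_I \<longleftrightarrow> L2_on g 0 1"
proof
  assume g: "g \<in> L2_I"
  then have m: "g \<in> borel_measurable (lebesgue_on {0..1})" 
    and s: "(\<lambda>t. (norm (g t))\<^sup>2) integrable_on {0..1}"
    by (auto simp: L2_I_def intro: integrable_on_lebesgue_on)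
  have "g absolutely_integrable_on {0..1}"
  proof (rule measurable_bounded_by_integrable_imp_absolutely_integrable[OF m])
    show "(\<lambda>t. 1 + (norm (g t))\<^sup>2) integrable_on {0..1}"
      using s by (intro integrable_add) auto
  qed (use norm_le_one_plus_square in auto)
  then show "L2_on g 0 1"
    using s by (auto simp: L2_on_def absolutely_integrable_on_def)
next
  assume g: "L2_on g 0 1"
  have "g \<in> borel_measurable (lebesgue_on {0..1})"
    using absolutely_integrable_imp_borel_measurable[OF L2_on_absolutely_integrable[OF g]] by simp
  moreover have "(\<lambda>t. (norm (g t))\<^sup>2) absolutely_integrable_on {0..1}"
    using g by (intro nonnegative_absolutely_integrable_1) (auto simp: L2_on_def)
  ultimately show "g \<in> L2_I"
    by (auto simp: L2_I_def intro: absolutely_integrable_imp_integrable)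
qed

text \<open>
  Henstock's lemma bounds the sum of the deviations \<open>|content k * f x - integral k f|\<close> over a fine
  tagged division; here the integrals vanish, and what remains is a Riemann sum of \<open>|f|\<close>. This gives
  almost everywhere uniqueness of derivatives without Lebesgue's differentiation theorem.
\<close>
lemma has_integral_norm_zero_if_integrals_zero:
  fixes f :: "real \<Rightarrow> 'a::euclidean_space"
  assumes f: "f integrable_on {a..b}"
    and zero: "\<And>c d. a \<le> c \<Longrightarrow> c \<le> d \<Longrightarrow> d \<le> b \<Longrightarrow> integral {c..d} f = 0"
  shows "((\<lambda>t. norm (f t)) has_integral 0) {a..b}"
proof -
  have "((\<lambda>t. norm (f t)) has_integral 0) (cbox a b)"
    unfolding has_integral
  proof (intro allI impI)
    fix e :: real assume "e > 0"
    obtain \<gamma> where \<gamma>: "gauge \<gamma>"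
      "\<And>p. \<lbrakk>p tagged_partial_division_of (cbox a b); \<gamma> fine p\<rbrakk> \<Longrightarrow>
             sum (\<lambda>(x,k). norm(measure lborel k *\<^sub>R f x - integral k f)) p < e"
      by (rule Henstock_lemma[of f a b e]) (use f \<open>e > 0\<close> in auto)
    have "norm ((\<Sum>(x, k)\<in>p. measure lborel k *\<^sub>R norm (f x)) - 0) < e"
      if p: "p tagged_division_of (cbox a b)" "\<gamma> fine p" for p
    proof -
      have "(\<Sum>(x, k)\<in>p. measure lborel k *\<^sub>R norm (f x)) = (\<Sum>(x,k)\<in>p. norm(measure lborel k *\<^sub>R f x - integral k f))"
      proof (rule sum.cong, simp, clarify)
        fix x k assume xk: "(x,k) \<in> p"
        obtain c d where k: "k = cbox c d" using p(1) xk by (meson tagged_division_ofD(4))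
        have sub: "k \<subseteq> cbox a b" "x \<in> k"
          using p(1) xk by (auto dest: tagged_division_ofD(2,3))
        have "integral k f = 0"
        proof -
          have "c \<le> d" using sub k by auto
          then show ?thesis using sub k zero[of c d] by auto
        qed
        then show "measure lborel k *\<^sub>R norm (f x) = norm (measure lborel k *\<^sub>R f x - integral k f)"
          by simp
      qed
      moreover have "(\<Sum>(x, k)\<in>p. measure lborel k *\<^sub>R norm (f x)) \<ge> 0"
        by (intro sum_nonneg) auto
      ultimately show ?thesis
        using \<gamma>(2)[OF tagged_division_of_def[THEN iffD1, THEN conjunct1, OF p(1)] p(2)] by simp
    qed
    then show "\<exists>\<gamma>. gauge \<gamma> \<and> (\<forall>\<D>. \<D> tagged_division_of cbox a b \<and> \<gamma> fine \<D> \<longrightarrow>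
              norm ((\<Sum>(x, k)\<in>\<D>. measure lborel k *\<^sub>R norm (f x)) - 0) < e)"
      using \<gamma>(1) by blast
  qed
  then show ?thesis by simp
qed

lemma integral_zero_imp_AE_zero:
  fixes f :: "real \<Rightarrow> real"
  assumes f: "(f has_integral 0) {a..b}" and nonneg: "\<And>t. t \<in> {a..b} \<Longrightarrow> 0 \<le> f t"
  obtains N where "negligible N" "\<And>t. t \<in> {a..b} - N \<Longrightarrow> f t = 0"
proof -
  have "f absolutely_integrable_on {a..b}"
    using f nonneg by (intro nonnegative_absolutely_integrable_1) (auto simp: integrable_on_def)
  then have i: "integrable (lebesgue_on {a..b}) f"
    by (simp add: absolutely_integrable_imp_integrable)
  then have "integral\<^sup>L (lebesgue_on {a..b}) f = 0"
    using f by (simp add: lebesgue_integral_eq_integral integral_unique)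
  moreover have "AE t in lebesgue_on {a..b}. 0 \<le> f t"
    using nonneg by (intro AE_I2) auto
  ultimately have "AE t in lebesgue_on {a..b}. f t = 0"
    using integral_nonneg_eq_0_iff_AE[OF i] by simp
  then have "AE t in lebesgue. t \<in> {a..b} \<longrightarrow> f t = 0"
    by (simp add: AE_restrict_space_iff)
  then obtain N where N: "{t \<in> space lebesgue. \<not> (t \<in> {a..b} \<longrightarrow> f t = 0)} \<subseteq> N"
      "N \<in> null_sets lebesgue"
    unfolding eventually_ae_filter by blast
  then have "negligible N" by (simp add: negligible_iff_null_sets)
  moreover have "f t = 0" if "t \<in> {a..b} - N" for t
    using that N(1) by auto
  ultimately show ?thesis by (rule that)
qed

section \<open>Weak derivatives and indefinite integrals\<close>
lemma integrable_continuous_scaleR: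
  fixes g :: "real \<Rightarrow> 'a::euclidean_space"
  assumes c: "continuous_on {a..b} \<phi>" and g: "g absolutely_integrable_on {a..b}"
  shows "(\<lambda>t. \<phi> t *\<^sub>R g t) absolutely_integrable_on {a..b}"
proof (rule absolutely_integrable_bounded_measurable_product
    [where h = "\<lambda>(x::real) y::'a. x *\<^sub>R y", OF _ _ _ _ g])
  show "bilinear (\<lambda>(x::real) y::'a. x *\<^sub>R y)"
    by (simp add: bilinear_conv_bounded_bilinear bounded_bilinear_scaleR)
  show "\<phi> \<in> borel_measurable (lebesgue_on {a..b})"
    using c by (simp add: continuous_imp_measurable_on_sets_lebesgue)
  show "bounded (\<phi> ` {a..b})"
    using c by (intro compact_imp_bounded compact_continuous_image) auto
qed auto

text \<open>
  The product rule is not available pointwise, as \<open>u\<close> need not be differentiable at a given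
  point. Over an interval \<open>[a,b]\<close> the increment of \<open>\<phi> u\<close> is
  \<open>(\<phi> b - \<phi> a) u b + \<phi> a (u b - u a)\<close>, so replacing \<open>u\<close> by \<open>u b\<close> and \<open>\<phi>\<close> by \<open>\<phi> a\<close> in the
  integrand costs only the oscillation of \<open>u\<close> and \<open>\<phi>\<close> on \<open>[a,b]\<close> times \<open>\<integral> |\<phi>'| + |g|\<close>. Uniform
  continuity makes the sum of these errors over a fine subdivision arbitrarily small.
\<close>
lemma integral_by_parts_indefinite:
  fixes g u :: "real \<Rightarrow> 'a::euclidean_space"
  assumes g: "g absolutely_integrable_on {0..1}"
    and u: "\<And>t. t \<in> {0..1} \<Longrightarrow> u t = c + integral {0..t} g"
    and \<phi>: "\<And>t. t \<in> {0..1} \<Longrightarrow> (\<phi> has_vector_derivative \<phi>' t) (at t)"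
    and \<phi>': "continuous_on {0..1} \<phi>'"
  shows "integral {0..1} (\<lambda>t. \<phi>' t *\<^sub>R u t) + integral {0..1} (\<lambda>t. \<phi> t *\<^sub>R g t)
           = \<phi> 1 *\<^sub>R u 1 - \<phi> 0 *\<^sub>R u 0"
proof -
  have gi: "g integrable_on {0..1}" and ng: "(\<lambda>t. norm (g t)) integrable_on {0..1}"
    using g by (auto simp: absolutely_integrable_on_def)
  have cont_u: "continuous_on {0..1} u"
  proof (rule continuous_on_eq)
    show "continuous_on {0..1} (\<lambda>t. c + integral {0..t} g)"
      by (intro continuous_intros indefinite_integral_continuous_1[OF gi])
  qed (simp add: u)
  have cont_\<phi>: "continuous_on {0..1} \<phi>"
    using \<phi> by (intro continuous_at_imp_continuous_on ballI) (meson has_vector_derivative_continuous)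
  have \<phi>g: "(\<lambda>t. \<phi> t *\<^sub>R g t) integrable_on {0..1}"
    using integrable_continuous_scaleR[OF cont_\<phi> g] by (simp add: absolutely_integrable_on_def)
  have \<phi>'u: "(\<lambda>t. \<phi>' t *\<^sub>R u t) integrable_on {0..1}"
    by (intro integrable_continuous_interval continuous_intros \<phi>' cont_u)
  define m where "m t = \<bar>\<phi>' t\<bar> + norm (g t)" for t
  have mi: "m integrable_on {0..1}"
    unfolding m_def by (intro integrable_add ng integrable_continuous_interval continuous_intros \<phi>')
  define f where "f t = \<phi>' t *\<^sub>R u t + \<phi> t *\<^sub>R g t" for t
  have fi: "f integrable_on {0..1}"
    unfolding f_def by (intro integrable_add \<phi>g \<phi>'u)
  define D where "D t = integral {0..t} f - (\<phi> t *\<^sub>R u t - \<phi> 0 *\<^sub>R u 0)" for t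
  have step: "norm (D b - D a) \<le> e * integral {a..b} m"
    if ab: "0 \<le> a" "a \<le> b" "b \<le> 1" and e: "e \<ge> 0"
      and osc: "\<And>t. t \<in> {a..b} \<Longrightarrow> norm (u t - u b) \<le> e \<and> \<bar>\<phi> t - \<phi> a\<bar> \<le> e" for a b e
  proof -
    have sub: "{a..b} \<subseteq> {0..1}" using ab by auto
    note int_ab = integrable_on_subinterval[OF _ sub]
    have "(\<phi>' has_integral \<phi> b - \<phi> a) {a..b}"
      using ab sub by (intro fundamental_theorem_of_calculus) 
        (auto intro!: has_vector_derivative_at_within \<phi>)
    then have i1: "((\<lambda>t. \<phi>' t *\<^sub>R u b) has_integral (\<phi> b - \<phi> a) *\<^sub>R u b) {a..b}"
      by (rule has_integral_scaleR_left)
    have ci: "integral {0..a} h + integral {a..b} h = integral {0..b} h" 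
      if "h integrable_on {0..1}" for h :: "real \<Rightarrow> 'a"
      using ab that by (intro Henstock_Kurzweil_Integration.integral_combine)
        (auto intro: integrable_on_subinterval)
    have "(g has_integral u b - u a) {a..b}"
      using ci[OF gi] int_ab[OF gi] u[of a] u[of b] ab by (simp add: has_integral_iff algebra_simps)
    then have i2: "((\<lambda>t. \<phi> a *\<^sub>R g t) has_integral \<phi> a *\<^sub>R (u b - u a)) {a..b}"
      by (intro has_integral_cmul)
    have i3: "(f has_integral integral {0..b} f - integral {0..a} f) {a..b}"
      using ci[OF fi] int_ab[OF fi] by (simp add: has_integral_iff algebra_simps)
    have "((\<lambda>t. f t - (\<phi>' t *\<^sub>R u b + \<phi> a *\<^sub>R g t)) has_integral (D b - D a)) {a..b}"
      using has_integral_diff[OF i3 has_integral_add[OF i1 i2]] 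
      by (simp add: D_def algebra_simps)
    then have i4: "((\<lambda>t. \<phi>' t *\<^sub>R (u t - u b) + (\<phi> t - \<phi> a) *\<^sub>R g t) has_integral (D b - D a)) {a..b}"
      by (rule has_integral_eq[rotated]) (auto simp: f_def algebra_simps)
    have "norm (integral {a..b} (\<lambda>t. \<phi>' t *\<^sub>R (u t - u b) + (\<phi> t - \<phi> a) *\<^sub>R g t))
        \<le> integral {a..b} (\<lambda>t. e * m t)"
    proof (rule Henstock_Kurzweil_Integration.integral_norm_bound_integral)
      show "(\<lambda>t. e * m t) integrable_on {a..b}"
        by (intro integrable_on_mult_right int_ab mi)
      fix t assume t: "t \<in> {a..b}"
      have "norm (\<phi>' t *\<^sub>R (u t - u b) + (\<phi> t - \<phi> a) *\<^sub>R g t)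
          \<le> \<bar>\<phi>' t\<bar> * norm (u t - u b) + \<bar>\<phi> t - \<phi> a\<bar> * norm (g t)"
        using norm_triangle_ineq[of "\<phi>' t *\<^sub>R (u t - u b)" "(\<phi> t - \<phi> a) *\<^sub>R g t"] by simp
      also have "\<dots> \<le> \<bar>\<phi>' t\<bar> * e + e * norm (g t)"
        using osc[OF t] by (intro add_mono mult_left_mono mult_right_mono) auto
      finally show "norm (\<phi>' t *\<^sub>R (u t - u b) + (\<phi> t - \<phi> a) *\<^sub>R g t) \<le> e * m t"
        by (simp add: m_def algebra_simps)
    qed (use i4 in \<open>auto simp: integrable_on_def\<close>)
    then show ?thesis
      using integral_unique[OF i4] by simp
  qed
  have bound: "norm (D 1) \<le> e * integral {0..1} m" if "e > 0" for e
  proof -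
    have uc: "uniformly_continuous_on {0..1} u" "uniformly_continuous_on {0..1} \<phi>"
      using cont_u cont_\<phi> by (auto intro: compact_uniformly_continuous)
    obtain d1 where d1: "d1 > 0" 
      "\<And>s t. s \<in> {0..1} \<Longrightarrow> t \<in> {0..1} \<Longrightarrow> dist t s < d1 \<Longrightarrow> dist (u t) (u s) < e"
      using uc(1) \<open>e > 0\<close> unfolding uniformly_continuous_on_def by blast
    obtain d2 where d2: "d2 > 0" 
      "\<And>s t. s \<in> {0..1} \<Longrightarrow> t \<in> {0..1} \<Longrightarrow> dist t s < d2 \<Longrightarrow> dist (\<phi> t) (\<phi> s) < e"
      using uc(2) \<open>e > 0\<close> unfolding uniformly_continuous_on_def by blast
    define d where "d = min d1 d2"
    have "d > 0" using d1 d2 by (simp add: d_def)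
    obtain n where n: "real n > 1 / d" using reals_Archimedean2 by blast
    then have n0: "real n > 0" using \<open>d > 0\<close> by (smt (verit) divide_pos_pos)
    have small: "1 / real n < d"
      using n n0 \<open>d > 0\<close> by (simp add: field_simps)
    have "norm (D (real k / real n)) \<le> e * integral {0..real k / real n} m" if "k \<le> n" for k
      using that
    proof (induction k)
      case 0
      then show ?case by (simp add: D_def)
    next
      case (Suc k)
      define a b where "a = real k / real n" and "b = real (Suc k) / real n"
      have ba: "b - a = 1 / real n" by (simp add: a_def b_def diff_divide_distrib[symmetric])
      have ab: "0 \<le> a" "a \<le> b" "b \<le> 1" using Suc.prems n0 ba
        by (auto simp: a_def b_def field_simps)
      have "norm (D b - D a) \<le> e * integral {a..b} m"
      proof (rule step)
        fix t assume t: "t \<in> {a..b}"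
        then have "dist t b < d" "dist t a < d" using ba small by (auto simp: dist_real_def)
        then have "dist (u t) (u b) < e" "dist (\<phi> t) (\<phi> a) < e"
          using d1(2)[of b t] d2(2)[of a t] t ab by (auto simp: d_def)
        then show "norm (u t - u b) \<le> e \<and> \<bar>\<phi> t - \<phi> a\<bar> \<le> e"
          by (auto simp: dist_norm)
      qed (use ab \<open>e > 0\<close> in auto)
      moreover have "norm (D a) \<le> e * integral {0..a} m"
        using Suc by (simp add: a_def)
      moreover have "integral {0..a} m + integral {a..b} m = integral {0..b} m"
        using ab by (intro Henstock_Kurzweil_Integration.integral_combine)
          (auto intro: integrable_on_subinterval[OF mi])
      ultimately have "norm (D b) \<le> e * integral {0..b} m"
        using norm_triangle_sub[of "D b" "D a"] by (smt (verit) distrib_left)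
      then show ?case by (simp add: b_def)
    qed
    from this[of n] n0 show ?thesis by simp
  qed
  have "norm (D 1) \<le> e" if "e > 0" for e
  proof -
    have M: "integral {0..1} m \<ge> 0"
      using mi by (intro integral_nonneg) (auto simp: m_def)
    have "norm (D 1) \<le> e / (integral {0..1} m + 1) * integral {0..1} m"
      by (rule bound) (use that M in simp)
    also have "\<dots> \<le> e" using that M by (simp add: field_simps)
    finally show ?thesis .
  qed
  then have "D 1 = 0"
    using dense_ge[of 0 "norm (D 1)"] by simp
  moreover have "integral {0..1} f = integral {0..1} (\<lambda>t. \<phi>' t *\<^sub>R u t) + integral {0..1} (\<lambda>t. \<phi> t *\<^sub>R g t)"
    unfolding f_def by (rule Henstock_Kurzweil_Integration.integral_add[OF \<phi>'u \<phi>g])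
  ultimately show ?thesis by (simp add: D_def)
qed

lemma test_functionD:
  assumes "test_function \<phi>"
  shows "(\<phi> has_vector_derivative deriv \<phi> t) (at t)" "continuous_on S (deriv \<phi>)" "\<phi> 0 = 0" "\<phi> 1 = 0"
proof -
  obtain D where D: "\<And>x. (\<phi> has_vector_derivative (D x)) (at x)" "continuous_on UNIV D"
    using assms unfolding test_function_def C1_differentiable_on_def by auto
  have "deriv \<phi> = D"
    using D(1) by (auto intro!: ext DERIV_imp_deriv simp: has_real_derivative_iff_has_vector_derivative)
  then show "(\<phi> has_vector_derivative deriv \<phi> t) (at t)" "continuous_on S (deriv \<phi>)"
    using D continuous_on_subset[OF D(2), of S] by auto
  have "closure {t. \<phi> t \<noteq> 0} \<subseteq> {0<..<1}" using assms by (simp add: test_function_def)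
  then have "0 \<notin> {t. \<phi> t \<noteq> 0}" "1 \<notin> {t. \<phi> t \<noteq> 0}"
    using closure_subset[of "{t. \<phi> t \<noteq> 0}"] by (auto simp: subset_iff)
  then show "\<phi> 0 = 0" "\<phi> 1 = 0" by auto
qed

text \<open>
  The working description of a Sobolev function. The equation is oriented so that it can be used as
  a rewrite rule; with \<open>u t\<close> alone on the left it would rewrite \<open>u 0\<close> forever.
\<close>
definition primitive_I :: "(real \<Rightarrow> 'a::euclidean_space) \<Rightarrow> (real \<Rightarrow> 'a) \<Rightarrow> bool" where
  "primitive_I u g \<longleftrightarrow> L2_on g 0 1 \<and> (\<forall>t\<in>{0..1}. integral {0..t} g = u t - u 0)"

lemma primitive_I_continuous: 
  assumes "primitive_I u g"
  shows "continuous_on {0..1} u"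
proof (rule continuous_on_eq)
  show "continuous_on {0..1} (\<lambda>t. u 0 + integral {0..t} g)"
    using assms by (intro continuous_intros indefinite_integral_continuous_1)
      (auto simp: primitive_I_def L2_on_def)
qed (use assms in \<open>auto simp: primitive_I_def\<close>)

lemma weak_derivative_integrals:
  fixes u g :: "real \<Rightarrow> 'a::euclidean_space"
  assumes "test_function \<phi>" "continuous_on {0..1} u" "L2_on g 0 1"
  shows "(LINT t|lebesgue_on {0..1}. deriv \<phi> t *\<^sub>R u t) = integral {0..1} (\<lambda>t. deriv \<phi> t *\<^sub>R u t)"
    and "(LINT t|lebesgue_on {0..1}. \<phi> t *\<^sub>R g t) = integral {0..1} (\<lambda>t. \<phi> t *\<^sub>R g t)"
proof -
  note t = test_functionD[OF assms(1)]
  have "(\<lambda>t. deriv \<phi> t *\<^sub>R u t) absolutely_integrable_on {0..1}"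
    using assms t by (intro absolutely_integrable_continuous_real continuous_intros) auto
  then show "(LINT t|lebesgue_on {0..1}. deriv \<phi> t *\<^sub>R u t) = integral {0..1} (\<lambda>t. deriv \<phi> t *\<^sub>R u t)"
    by (intro lebesgue_integral_eq_integral absolutely_integrable_imp_integrable) auto
  have "continuous_on {0..1} \<phi>"
    using t(1) by (intro continuous_at_imp_continuous_on ballI) (meson has_vector_derivative_continuous)
  then have "(\<lambda>t. \<phi> t *\<^sub>R g t) absolutely_integrable_on {0..1}"
    by (rule integrable_continuous_scaleR[OF _ L2_on_absolutely_integrable[OF assms(3)]])
  then show "(LINT t|lebesgue_on {0..1}. \<phi> t *\<^sub>R g t) = integral {0..1} (\<lambda>t. \<phi> t *\<^sub>R g t)"
    by (intro lebesgue_integral_eq_integral absolutely_integrable_imp_integrable) auto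
qed

lemma primitive_I_imp_weak:
  assumes "primitive_I u g"
  shows "has_weak_derivative_I u g"
  unfolding has_weak_derivative_I_def
proof (intro conjI allI impI)
  show "g \<in> L2_I" using assms by (simp add: L2_I_iff_L2_on primitive_I_def)
  fix \<phi> assume tf: "test_function \<phi>"
  have g: "L2_on g 0 1" using assms by (simp add: primitive_I_def)
  note t = test_functionD[OF tf]
  have "integral {0..1} (\<lambda>t. deriv \<phi> t *\<^sub>R u t) + integral {0..1} (\<lambda>t. \<phi> t *\<^sub>R g t)
           = \<phi> 1 *\<^sub>R u 1 - \<phi> 0 *\<^sub>R u 0"
    by (rule integral_by_parts_indefinite[OF L2_on_absolutely_integrable[OF g], where c = "u 0"])
      (use assms t in \<open>auto simp: primitive_I_def\<close>)
  then show "(LINT t|lebesgue_on {0..1}. deriv \<phi> t *\<^sub>R u t) = - (LINT t|lebesgue_on {0..1}. \<phi> t *\<^sub>R g t)"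
    using weak_derivative_integrals[OF tf primitive_I_continuous[OF assms] g] t
    by (simp add: eq_neg_iff_add_eq_0)
qed

text \<open>
  Let \<open>k\<close> be a continuous bump on \<open>[a,b]\<close> and \<open>c\<close> the mean of \<open>w\<close> with weight \<open>k\<close>. Then
  \<open>k (w - c)\<close> has mean zero, so its antiderivative is a test function, and testing \<open>w\<close> with it gives
  \<open>\<integral> k (w - c)\<^sup>2 = 0\<close>.
\<close>
lemma real_du_Bois_Reymond_interior:
  fixes w :: "real \<Rightarrow> real"
  assumes w: "continuous_on {0..1} w"
    and orth: "\<And>\<phi>. test_function \<phi> \<Longrightarrow> integral {0..1} (\<lambda>t. deriv \<phi> t * w t) = 0"
    and ab: "0 < a" "a < b" "b < 1"
  shows "\<exists>c. \<forall>t\<in>{a<..<b}. w t = c"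
proof -
  \<comment> \<open>a continuous extension of \<open>w\<close> to the line\<close>
  define W where "W t = w (max 0 (min 1 t))" for t
  have cW: "continuous_on UNIV W"
    unfolding W_def
  proof (rule continuous_on_compose2[OF w])
    show "continuous_on UNIV (\<lambda>x::real. max 0 (min 1 x))"
      by (intro continuous_intros)
  qed auto
  have WW: "W t = w t" if "t \<in> {0..1}" for t using that by (simp add: W_def)
  define k :: "real \<Rightarrow> real" where "k t = max 0 ((t - a) * (b - t))" for t
  have ck: "continuous_on UNIV k"
    unfolding k_def by (intro continuous_intros)
  have k0: "k t = 0" if "t \<notin> {a..b}" for t
  proof -
    have "(t - a) * (b - t) \<le> 0" using that ab by (auto simp: mult_le_0_iff)
    then show ?thesis by (simp add: k_def)
  qed
  have kpos: "k t > 0" if "t \<in> {a<..<b}" for t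
    using that by (simp add: k_def)
  have kge: "k t \<ge> 0" for t by (simp add: k_def)
  have io: "h integrable_on {x..y}" if "continuous_on UNIV h" for h :: "real \<Rightarrow> real" and x y
    using that by (meson continuous_on_subset integrable_continuous_interval subset_UNIV)
  have K: "integral {a..b} k > 0"
  proof -
    have "integral {a..b} k \<noteq> 0"
    proof
      assume "integral {a..b} k = 0"
      then have "(k has_integral 0) (cbox a b)" using io[OF ck] by (simp add: has_integral_iff)
      then have "k ((a+b)/2) = 0"
        using has_integral_0_cbox_imp_0[of a b k "(a+b)/2"] continuous_on_subset[OF ck] kge ab
        by auto
      then show False using kpos[of "(a+b)/2"] ab by auto
    qed
    moreover have "integral {a..b} k \<ge> 0" by (intro integral_nonneg io ck kge)
    ultimately show ?thesis by simp
  qed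
  define c where "c = integral {a..b} (\<lambda>t. k t * W t) / integral {a..b} k"
  define \<psi> where "\<psi> t = k t * (W t - c)" for t
  have c\<psi>: "continuous_on UNIV \<psi>"
    unfolding \<psi>_def by (intro continuous_intros ck cW)
  have ckW: "continuous_on UNIV (\<lambda>t. k t * W t)" by (intro continuous_intros ck cW)
  have mean: "integral {a..b} \<psi> = 0"
  proof -
    have "integral {a..b} \<psi> = integral {a..b} (\<lambda>t. k t * W t - c * k t)"
      by (rule integral_cong) (simp add: \<psi>_def algebra_simps)
    also have "\<dots> = integral {a..b} (\<lambda>t. k t * W t) - c * integral {a..b} k"
      by (subst Henstock_Kurzweil_Integration.integral_diff)
        (auto intro!: io ckW ck integrable_on_mult_right)
    finally show ?thesis using K by (simp add: c_def)
  qed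
  obtain F where F: "\<And>x::real. (F has_vector_derivative \<psi> x) (at x)"
    using einterval_antiderivative[of "-\<infinity>" \<infinity> \<psi>] c\<psi> by (auto simp: continuous_on_eq_continuous_at)
  define \<phi> where "\<phi> t = F t - F a" for t
  have D\<phi>: "(\<phi> has_vector_derivative \<psi> x) (at x)" for x
    unfolding \<phi>_def by (auto intro!: derivative_eq_intros F)
  have deriv\<phi>: "deriv \<phi> = \<psi>"
    using D\<phi> by (auto intro!: ext DERIV_imp_deriv simp: has_real_derivative_iff_has_vector_derivative)
  have ftc: "(\<psi> has_integral F y - F x) {x..y}" if "x \<le> y" for x y
    using that by (intro fundamental_theorem_of_calculus) (auto intro: has_vector_derivative_at_within F)
  have \<psi>0: "\<psi> t = 0" if "t \<notin> {a<..<b}" for t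
    using k0[of t] that by (cases "t = a \<or> t = b") (auto simp: \<psi>_def k_def)
  have \<phi>0: "\<phi> t = 0" if "t \<notin> {a..b}" for t
  proof -
    have z: "integral {x..y} \<psi> = 0" if "\<And>s. s \<in> {x..y} \<Longrightarrow> s \<notin> {a<..<b}" for x y
      using integral_cong[of "{x..y}" \<psi> "\<lambda>_. 0"] \<psi>0[OF that] by simp
    consider "t < a" | "t > b" using \<open>t \<notin> {a..b}\<close> by fastforce
    then show ?thesis
    proof cases
      case 1
      then show ?thesis using ftc[of t a] z[of t a] by (simp add: \<phi>_def has_integral_iff)
    next
      case 2
      then show ?thesis using ftc[of b t] z[of b t] ftc[of a b] mean ab by (simp add: \<phi>_def has_integral_iff)
    qed
  qed
  have "test_function \<phi>"
    unfolding test_function_def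
  proof
    show "\<phi> C1_differentiable_on UNIV"
      unfolding C1_differentiable_on_def using D\<phi> c\<psi> by blast
    have "{t. \<phi> t \<noteq> 0} \<subseteq> {a..b}" using \<phi>0 by blast
    then have "closure {t. \<phi> t \<noteq> 0} \<subseteq> {a..b}" by (simp add: closure_minimal)
    then show "closure {t. \<phi> t \<noteq> 0} \<subseteq> {0<..<1}" using ab by auto
  qed
  then have "integral {0..1} (\<lambda>t. \<psi> t * w t) = 0"
    using orth[of \<phi>] by (simp add: deriv\<phi>)
  also have "integral {0..1} (\<lambda>t. \<psi> t * w t) = integral {0..1} (\<lambda>t. \<psi> t * W t)"
    by (intro integral_cong) (simp add: WW)
  also have "\<dots> = integral {a..b} (\<lambda>t. \<psi> t * W t)"
  proof (rule integral_spike_set)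
    have inn: "a < x \<and> x < b" if "\<psi> x \<noteq> 0" for x using \<psi>0[of x] that by auto
    have e: "{x \<in> {0..1} - {a..b}. \<psi> x * W x \<noteq> 0} = {}" "{x \<in> {a..b} - {0..1}. \<psi> x * W x \<noteq> 0} = {}"
      using ab by (auto dest!: inn)
    show "negligible {x \<in> {0..1} - {a..b}. \<psi> x * W x \<noteq> 0}" "negligible {x \<in> {a..b} - {0..1}. \<psi> x * W x \<noteq> 0}"
      unfolding e by simp_all
  qed
  finally have "integral {a..b} (\<lambda>t. \<psi> t * W t - c * \<psi> t) = 0"
    using mean Henstock_Kurzweil_Integration.integral_diff[OF io io, of "\<lambda>t. \<psi> t * W t" "\<lambda>t. c * \<psi> t"
        a b] continuous_on_mult[OF c\<psi> cW] continuous_on_mult_left[OF c\<psi>, of c]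
    by simp
  moreover have "(\<lambda>t. \<psi> t * W t - c * \<psi> t) = (\<lambda>t. k t * (W t - c)\<^sup>2)"
    by (auto simp: \<psi>_def power2_eq_square algebra_simps)
  moreover have ck2: "continuous_on UNIV (\<lambda>t. k t * (W t - c)\<^sup>2)"
    by (intro continuous_intros ck cW)
  ultimately have i0: "((\<lambda>t. k t * (W t - c)\<^sup>2) has_integral 0) (cbox a b)"
    using io[OF ck2, of a b] by (simp add: has_integral_iff)
  have "w t = c" if t: "t \<in> {a<..<b}" for t
  proof -
    have "k t * (W t - c)\<^sup>2 = 0"
      by (rule has_integral_0_cbox_imp_0[of a b "\<lambda>t. k t * (W t - c)\<^sup>2" t])
        (use i0 continuous_on_subset[OF ck2] kge ab t in auto)
    then show ?thesis using kpos[OF t] WW[of t] t ab by auto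
  qed
  then show ?thesis by blast
qed

lemma du_Bois_Reymond:
  fixes w :: "real \<Rightarrow> 'a::euclidean_space"
  assumes w: "continuous_on {0..1} w"
    and orth: "\<And>\<phi>. test_function \<phi> \<Longrightarrow> integral {0..1} (\<lambda>t. deriv \<phi> t *\<^sub>R w t) = 0"
    and t: "t \<in> {0..1}"
  shows "w t = w 0"
proof -
  have comp: "w t \<bullet> i = w 0 \<bullet> i" if i: "i \<in> Basis" for i
  proof -
    have c: "continuous_on {0..1} (\<lambda>t. w t \<bullet> i)" by (intro continuous_intros w)
    have o: "integral {0..1} (\<lambda>t. deriv \<phi> t * (w t \<bullet> i)) = 0" if tf: "test_function \<phi>" for \<phi>
    proof -
      have "(\<lambda>t. deriv \<phi> t *\<^sub>R w t) integrable_on {0..1}"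
        by (intro integrable_continuous_interval continuous_intros w test_functionD[OF tf])
      from integral_component_eq[OF this, of i] orth[OF tf] show ?thesis by simp
    qed
    have mid: "w s \<bullet> i = w (1/2) \<bullet> i" if s: "s \<in> {0<..<1}" for s
    proof -
      have "\<exists>c. \<forall>t\<in>{min s (1/2) / 2<..<(1 + max s (1/2)) / 2}. w t \<bullet> i = c"
        by (rule real_du_Bois_Reymond_interior[OF c o]) (use s in auto)
      then obtain c where "\<forall>t\<in>{min s (1/2) / 2<..<(1 + max s (1/2)) / 2}. w t \<bullet> i = c" by blast
      moreover have "s \<in> {min s (1/2) / 2<..<(1 + max s (1/2)) / 2}" 
         "1/2 \<in> {min s (1/2) / 2<..<(1 + max s (1/2)) / 2}" using s by auto
      ultimately have "w s \<bullet> i = c" "w (1/2) \<bullet> i = c" by blast+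
      then show ?thesis by simp
    qed
    have "w s \<bullet> i = w (1/2) \<bullet> i" if "s \<in> {0..1}" for s
    proof (rule continuous_constant_on_closure[of "{0<..<1}" "\<lambda>t. w t \<bullet> i"])
      show "continuous_on (closure {0<..<1}) (\<lambda>t. w t \<bullet> i)" "s \<in> closure {0<..<1}"
        using c that by simp_all
    qed (rule mid)
    from this[OF t] this[of 0] show ?thesis by simp
  qed
  then show ?thesis by (simp add: euclidean_eq_iff[of "w t"])
qed

text \<open>
  The difference of \<open>u\<close> and the indefinite integral of \<open>g\<close> has weak derivative zero.
\<close>
lemma weak_imp_primitive_I:
  fixes u :: "real \<Rightarrow> 'a::euclidean_space"
  assumes u: "continuous_on {0..1} u" and wd: "has_weak_derivative_I u g"
  shows "primitive_I u g"
proof -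
  have g: "L2_on g 0 1" using wd by (simp add: has_weak_derivative_I_def L2_I_iff_L2_on)
  define G where "G t = integral {0..t} g" for t
  have G: "primitive_I G g" using g by (simp add: primitive_I_def G_def)
  note cG = primitive_I_continuous[OF G]
  have const: "u t - G t = u 0 - G 0" if "t \<in> {0..1}" for t
  proof (rule du_Bois_Reymond[OF _ _ that])
    show "continuous_on {0..1} (\<lambda>t. u t - G t)" by (intro continuous_intros u cG)
    fix \<phi> assume tf: "test_function \<phi>"
    have "integral {0..1} (\<lambda>t. deriv \<phi> t *\<^sub>R u t) = integral {0..1} (\<lambda>t. deriv \<phi> t *\<^sub>R G t)"
    proof -
      have "(LINT t|lebesgue_on {0..1}. deriv \<phi> t *\<^sub>R u t) = - (LINT t|lebesgue_on {0..1}. \<phi> t *\<^sub>R g t)"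
        using wd tf by (simp only: has_weak_derivative_I_def)
      moreover have "(LINT t|lebesgue_on {0..1}. deriv \<phi> t *\<^sub>R G t) = - (LINT t|lebesgue_on {0..1}. \<phi> t *\<^sub>R g t)"
        using primitive_I_imp_weak[OF G] tf by (simp only: has_weak_derivative_I_def)
      ultimately show ?thesis
        by (simp only: weak_derivative_integrals[OF tf u g] weak_derivative_integrals[OF tf cG g])
    qed
    moreover have "integral {0..1} (\<lambda>t. deriv \<phi> t *\<^sub>R (u t - G t)) =
        integral {0..1} (\<lambda>t. deriv \<phi> t *\<^sub>R u t) - integral {0..1} (\<lambda>t. deriv \<phi> t *\<^sub>R G t)"
      unfolding scaleR_diff_right
      by (intro Henstock_Kurzweil_Integration.integral_diff integrable_continuous_interval continuous_intros
          u cG test_functionD[OF tf])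
    ultimately show "integral {0..1} (\<lambda>t. deriv \<phi> t *\<^sub>R (u t - G t)) = 0" by simp
  qed
  have "G t = u t - u 0" if "t \<in> {0..1}" for t
  proof -
    have "G 0 = 0" by (simp add: G_def)
    then show ?thesis using const[OF that] by (simp add: algebra_simps)
  qed
  then show ?thesis using g by (simp add: primitive_I_def G_def)
qed

lemma H1_I_iff: "u \<in> H1_I \<longleftrightarrow> u \<in> extensional {0..1} \<and> (\<exists>g. primitive_I u g)"
proof
  assume "u \<in> H1_I"
  then show "u \<in> extensional {0..1} \<and> (\<exists>g. primitive_I u g)"
    unfolding H1_I_def by (auto dest: weak_imp_primitive_I)
next
  assume "u \<in> extensional {0..1} \<and> (\<exists>g. primitive_I u g)"
  then obtain g where "u \<in> extensional {0..1}" "primitive_I u g" by blast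
  then show "u \<in> H1_I"
    unfolding H1_I_def using primitive_I_imp_weak[of u g] primitive_I_continuous[of u g] by blast
qed

lemma primitive_I_integral:
  assumes ug: "primitive_I u g" and ab: "0 \<le> a" "a \<le> b" "b \<le> 1"
  shows "integral {a..b} g = u b - u a"
proof -
  have "L2_on g 0 b"
    by (rule L2_on_subinterval[of g 0 1]) (use ug ab in \<open>auto simp: primitive_I_def\<close>)
  then have "integral {0..a} g + integral {a..b} g = integral {0..b} g"
    using ab by (intro Henstock_Kurzweil_Integration.integral_combine) (auto simp: L2_on_def)
  then have "integral {a..b} g = integral {0..b} g - integral {0..a} g"
    by (metis add_diff_cancel_left')
  also have "integral {0..b} g = u b - u 0"
    using ug ab by (simp add: primitive_I_def)
  also have "integral {0..a} g = u a - u 0"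
    using ug ab by (simp add: primitive_I_def)
  finally show ?thesis by simp
qed

text \<open>
  The energy refers to some weak derivative; any two have the same integrals over all subintervals
  and hence agree almost everywhere.
\<close>
lemma energy_eq_integral:
  fixes u :: "real \<Rightarrow> 'a::euclidean_space"
  assumes ug: "primitive_I u g"
  shows "energy u = integral {0..1} (\<lambda>t. (norm (g t))\<^sup>2)"
proof -
  define h where "h = weak_derivative_I u"
  have "has_weak_derivative_I u h"
    unfolding h_def weak_derivative_I_def using primitive_I_imp_weak[OF ug] by (rule someI[of "has_weak_derivative_I u"])
  then have uh: "primitive_I u h"
    using weak_imp_primitive_I[OF primitive_I_continuous[OF ug]] by blast
  have s: "L2_on g 0 1" "L2_on h 0 1" using ug uh by (auto simp: primitive_I_def)
  have "((\<lambda>t. norm (g t - h t)) has_integral 0) {0..1}"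
  proof (rule has_integral_norm_zero_if_integrals_zero)
    show "(\<lambda>t. g t - h t) integrable_on {0..1}"
      using s by (auto simp: L2_on_def intro: integrable_diff)
    fix c d :: real assume cd: "0 \<le> c" "c \<le> d" "d \<le> 1"
    have "g integrable_on {c..d}" "h integrable_on {c..d}"
      using L2_on_subinterval[OF s(1), of c d] L2_on_subinterval[OF s(2), of c d] cd
      by (auto simp: L2_on_def)
    then show "integral {c..d} (\<lambda>t. g t - h t) = 0"
      using cd primitive_I_integral[OF ug cd] primitive_I_integral[OF uh cd]
      by (simp add: Henstock_Kurzweil_Integration.integral_diff)
  qed
  from integral_zero_imp_AE_zero[OF this] obtain N where N: "negligible N" 
     "\<And>t. t \<in> {0..1} - N \<Longrightarrow> norm (g t - h t) = 0" by auto
  have "energy u = integral {0..1} (\<lambda>t. (norm (h t))\<^sup>2)"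
    unfolding energy_def h_def[symmetric]
    using s(2) by (intro lebesgue_integral_eq_integral) (auto simp: L2_I_iff_L2_on[symmetric] L2_I_def)
  also have "\<dots> = integral {0..1} (\<lambda>t. (norm (g t))\<^sup>2)"
    by (rule integral_spike[OF N(1)]) (use N(2) in auto)
  finally show ?thesis .
qed

section \<open>Comparison curves for minimizers\<close>
lemma energy_nonneg: "0 \<le> energy u"
  unfolding energy_def by (intro Bochner_Integration.integral_nonneg) auto

lemma is_minimizer_iff:
  "is_minimizer \<Omega> p q u \<longleftrightarrow>
     u \<in> admissible \<Omega> p q \<and> (\<forall>v\<in>admissible \<Omega> p q. energy u \<le> energy v)"
proof -
  have bdd: "bdd_below (energy ` admissible \<Omega> p q)"
    using energy_nonneg by (auto intro!: bdd_belowI2)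
  show ?thesis
  proof
    assume "is_minimizer \<Omega> p q u"
    then show "u \<in> admissible \<Omega> p q \<and> (\<forall>v\<in>admissible \<Omega> p q. energy u \<le> energy v)"
      using cINF_lower[OF bdd] by (simp add: is_minimizer_def)
  next
    assume u: "u \<in> admissible \<Omega> p q \<and> (\<forall>v\<in>admissible \<Omega> p q. energy u \<le> energy v)"
    then have "energy u \<le> (INF v\<in>admissible \<Omega> p q. energy v)"
      by (intro cINF_greatest) auto
    moreover have "(INF v\<in>admissible \<Omega> p q. energy v) \<le> energy u"
      using u by (intro cINF_lower bdd) auto
    ultimately show "is_minimizer \<Omega> p q u"
      using u by (simp add: is_minimizer_def)
  qed
qed

lemma admissible_iff:
  "u \<in> admissible \<Omega> p q \<longleftrightarrow> u \<in> extensional {0..1} \<and> (\<exists>g. primitive_I u g) \<and>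
     u 0 = p \<and> u 1 = q \<and> (\<forall>t\<in>{0..1}. u t \<notin> \<Omega>)"
  by (auto simp: admissible_def H1_I_iff)

text \<open>
  As \<open>h\<close> has integral zero, its indefinite integral extends by zero to a Sobolev function on the
  unit interval; adding it to \<open>u\<close> gives a competitor whose energy differs from that of \<open>u\<close> only
  on \<open>[a,b]\<close>.
\<close>
lemma minimizer_variation:
  fixes u :: "real \<Rightarrow> 'a::euclidean_space"
  assumes min: "is_minimizer \<Omega> p q u" and ug: "primitive_I u g"
    and ab: "0 \<le> a" "a \<le> b" "b \<le> 1" and h: "L2_on h a b" and h0: "integral {a..b} h = 0"
    and out: "\<And>t. t \<in> {a..b} \<Longrightarrow> u t + integral {a..t} h \<notin> \<Omega>"
  shows "integral {a..b} (\<lambda>t. (norm (g t))\<^sup>2) \<le> integral {a..b} (\<lambda>t. (norm (g t + h t))\<^sup>2)"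
proof -
  have u: "u \<in> admissible \<Omega> p q" and le: "\<And>v. v \<in> admissible \<Omega> p q \<Longrightarrow> energy u \<le> energy v"
    using min by (auto simp: is_minimizer_iff)
  have g: "L2_on g 0 1" using ug by (simp add: primitive_I_def)
  define h' where "h' t = (if t \<in> {a..b} then h t else 0)" for t
  have Int: "{a..b} \<inter> {0..1} = {a..b}" using ab by auto
  have sq_h': "(norm (h' t))\<^sup>2 = (if t \<in> {a..b} then (norm (h t))\<^sup>2 else 0)" for t
    by (simp add: h'_def)
  have h': "L2_on h' 0 1"
    using h unfolding L2_on_def sq_h' unfolding h'_def integrable_restrict_Int Int by simp
  have gh': "L2_on (\<lambda>t. g t + h' t) 0 1" by (rule L2_on_add[OF g h'])
  define \<Phi> where "\<Phi> t = integral {0..t} h'" for t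
  have \<Phi>: "\<Phi> t = integral ({0..t} \<inter> {a..b}) h" for t
    unfolding \<Phi>_def h'_def by (subst integral_restrict_Int) (simp add: Int_commute)
  have \<Phi>_in: "\<Phi> t = integral {a..t} h" if "t \<in> {a..b}" for t
  proof -
    have "{0..t} \<inter> {a..b} = {a..t}" using that ab by auto
    then show ?thesis by (simp only: \<Phi>)
  qed
  have \<Phi>_out: "\<Phi> t = 0" if "t \<notin> {a..b}" for t
  proof -
    have "{0..t} \<inter> {a..b} = {} \<or> {0..t} \<inter> {a..b} = {a..b}" using that ab by auto
    then show ?thesis unfolding \<Phi> using h0 by (elim disjE) (simp_all only: integral_empty)
  qed
  have \<Phi>0: "\<Phi> 0 = 0" by (simp add: \<Phi>_def)
  have \<Phi>1: "\<Phi> 1 = 0" using \<Phi>_out[of 1] \<Phi>_in[of 1] h0 ab by (cases "b = 1") auto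
  define v where "v t = (if t \<in> {0..1} then u t + \<Phi> t else undefined)" for t
  have vg: "primitive_I v (\<lambda>t. g t + h' t)"
    unfolding primitive_I_def
  proof (intro conjI ballI gh')
    fix t :: real assume t: "t \<in> {0..1}"
    have "L2_on g 0 t" "L2_on h' 0 t"
      using L2_on_subinterval[OF g, of 0 t] L2_on_subinterval[OF h', of 0 t] t by auto
    then have "integral {0..t} (\<lambda>t. g t + h' t) = integral {0..t} g + integral {0..t} h'"
      by (intro Henstock_Kurzweil_Integration.integral_add) (auto simp: L2_on_def)
    also have "integral {0..t} g = u t - u 0" using ug t by (simp add: primitive_I_def)
    finally show "integral {0..t} (\<lambda>t. g t + h' t) = v t - v 0"
      using t \<Phi>0 by (simp add: v_def \<Phi>_def)
  qed
  have "v \<in> admissible \<Omega> p q"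
    unfolding admissible_iff
  proof (intro conjI exI ballI)
    show "primitive_I v (\<lambda>t. g t + h' t)" by (rule vg)
    show "v t \<notin> \<Omega>" if "t \<in> {0..1}" for t
      using that out[of t] \<Phi>_in[of t] \<Phi>_out[of t] u
      by (cases "t \<in> {a..b}") (auto simp: v_def admissible_iff)
  qed (use u \<Phi>0 \<Phi>1 in \<open>auto simp: v_def admissible_iff extensional_def\<close>)
  then have "energy u \<le> energy v" by (rule le)
  then have "0 \<le> integral {0..1} (\<lambda>t. (norm (g t + h' t))\<^sup>2) - integral {0..1} (\<lambda>t. (norm (g t))\<^sup>2)"
    by (simp add: energy_eq_integral[OF ug] energy_eq_integral[OF vg])
  also have "\<dots> = integral {0..1} (\<lambda>t. (norm (g t + h' t))\<^sup>2 - (norm (g t))\<^sup>2)"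
    using g gh' by (intro Henstock_Kurzweil_Integration.integral_diff[symmetric]) (auto simp: L2_on_def)
  also have "\<dots> = integral {0..1} (\<lambda>t. if t \<in> {a..b} then (norm (g t + h t))\<^sup>2 - (norm (g t))\<^sup>2 else 0)"
    by (rule integral_cong) (simp add: h'_def)
  also have "\<dots> = integral {a..b} (\<lambda>t. (norm (g t + h t))\<^sup>2 - (norm (g t))\<^sup>2)"
    unfolding integral_restrict_Int Int by (simp add: Int Int_commute)
  also have "\<dots> = integral {a..b} (\<lambda>t. (norm (g t + h t))\<^sup>2) - integral {a..b} (\<lambda>t. (norm (g t))\<^sup>2)"
  proof (rule Henstock_Kurzweil_Integration.integral_diff)
    have gab: "L2_on g a b" using L2_on_subinterval[OF g] ab by simp
    show "(\<lambda>t. (norm (g t))\<^sup>2) integrable_on {a..b}" using gab by (simp add: L2_on_def)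
    show "(\<lambda>t. (norm (g t + h t))\<^sup>2) integrable_on {a..b}"
      using L2_on_add[OF gab h] by (simp add: L2_on_def)
  qed
  finally show ?thesis by simp
qed

text \<open>
  Here \<open>P\<close> is an orthogonal projection, and the competitor replaces the \<open>P\<close>-component of \<open>u\<close> on
  \<open>[a,b]\<close> by its chord. By Pythagoras this lowers the energy by the squared \<open>L\<^sup>2\<close>-distance between
  the \<open>P\<close>-component of the derivative and its mean, so that distance is zero. The two cases that
  matter are the identity and the projection onto a line.
\<close>
lemma minimizer_straighten:
  fixes u :: "real \<Rightarrow> 'a::euclidean_space"
  assumes min: "is_minimizer \<Omega> p q u"
    and ab: "0 \<le> a" "a < b" "b \<le> 1"
    and P: "linear P" "\<And>x y. P x \<bullet> y = P x \<bullet> P y"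
  defines "c \<equiv> P (u b - u a) /\<^sub>R (b - a)"
  assumes out: "\<And>t. t \<in> {a..b} \<Longrightarrow> u t - P (u t - u a) + (t - a) *\<^sub>R c \<notin> \<Omega>"
    and t: "t \<in> {a..b}"
  shows "P (u t - u a) = (t - a) *\<^sub>R c"
proof -
  obtain g where ug: "primitive_I u g"
    using min by (auto simp: is_minimizer_iff admissible_iff)
  have blP: "bounded_linear P" using P(1) by (simp add: linear_conv_bounded_linear)
  have "L2_on g 0 1" using ug by (simp add: primitive_I_def)
  then have gab: "L2_on g a b" using L2_on_subinterval[of g 0 1 a b] ab by simp
  have sPg: "L2_on (\<lambda>t. P (g t)) a b" by (rule L2_on_linear[OF blP gab])
  define h where "h t = c - P (g t)" for t
  have h: "L2_on h a b" unfolding h_def by (intro L2_on_diff L2_on_const sPg)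
  have cP: "P (u b - u a) = (b - a) *\<^sub>R c" using ab by (simp add: c_def)
  have hint: "integral {a..t} h = (t - a) *\<^sub>R c - P (u t - u a)" if t: "t \<in> {a..b}" for t
  proof -
    have "g integrable_on {a..t}" using L2_on_subinterval[OF gab, of a t] t by (simp add: L2_on_def)
    moreover have "integral {a..t} g = u t - u a"
      using primitive_I_integral[OF ug, of a t] t ab by auto
    ultimately have "(g has_integral (u t - u a)) {a..t}" by (simp add: has_integral_iff)
    from has_integral_linear[OF this blP]
    have 1: "((\<lambda>t. P (g t)) has_integral P (u t - u a)) {a..t}"
      by (simp add: o_def)
    have "((\<lambda>_. c) has_integral (t - a) *\<^sub>R c) {a..t}"
      using has_integral_const_real[of c a t] t by simp
    from has_integral_diff[OF this 1] show ?thesis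
      unfolding h_def by (rule integral_unique)
  qed
  have "integral {a..b} h = 0" using hint[of b] ab cP by simp
  moreover have "u t + integral {a..t} h \<notin> \<Omega>" if "t \<in> {a..b}" for t
    unfolding hint[OF that] using out[OF that] by (simp add: algebra_simps)
  ultimately have le: "integral {a..b} (\<lambda>t. (norm (g t))\<^sup>2) \<le> integral {a..b} (\<lambda>t. (norm (g t + h t))\<^sup>2)"
    using ab h by (intro minimizer_variation[OF min ug]) auto
  have cc: "P c = c"
  proof -
    have "P (P x) = P x" for x
    proof -
      have "P (P x) \<bullet> y = P x \<bullet> y" for y
        using P(2)[of "P x" y] P(2)[of x y] P(2)[of y "P x"] by (simp add: inner_commute)
      then show ?thesis using vector_eq_rdot[of "P (P x)" "P x"] by simp
    qed
    then show ?thesis by (simp add: c_def linear_scale[OF P(1)])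
  qed
  have pyth: "(norm (g t + h t))\<^sup>2 = (norm (g t))\<^sup>2 - (norm (h t))\<^sup>2 + 2 * (h t \<bullet> c)" for t
  proof -
    have "g t \<bullet> P (g t) = P (g t) \<bullet> P (g t)" "g t \<bullet> c = P (g t) \<bullet> c"
      using P(2)[of "g t" "g t"] P(2)[of c "g t"] cc by (auto simp: inner_commute)
    then show ?thesis
      by (simp add: h_def power2_norm_eq_inner inner_simps inner_commute algebra_simps)
  qed
  have i1: "(\<lambda>t. (norm (g t))\<^sup>2) integrable_on {a..b}" "(\<lambda>t. (norm (h t))\<^sup>2) integrable_on {a..b}"
    using gab h by (auto simp: L2_on_def)
  have "(h has_integral 0) {a..b}"
    using h \<open>integral {a..b} h = 0\<close> by (simp add: L2_on_def has_integral_iff)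
  then have "((\<lambda>t. h t \<bullet> c) has_integral 0) {a..b}"
    using has_integral_linear[OF _ bounded_linear_inner_left[of c], of h 0] by (simp add: o_def)
  then have "((\<lambda>t. (norm (g t))\<^sup>2 - (norm (h t))\<^sup>2 + 2 * (h t \<bullet> c)) has_integral
      (integral {a..b} (\<lambda>t. (norm (g t))\<^sup>2) - integral {a..b} (\<lambda>t. (norm (h t))\<^sup>2) + 2 * 0)) {a..b}"
    by (intro has_integral_add has_integral_diff has_integral_mult_right integrable_integral i1)
  then have "integral {a..b} (\<lambda>t. (norm (g t + h t))\<^sup>2)
      = integral {a..b} (\<lambda>t. (norm (g t))\<^sup>2) - integral {a..b} (\<lambda>t. (norm (h t))\<^sup>2)"
    unfolding pyth by (simp add: integral_unique)
  then have "integral {a..b} (\<lambda>t. (norm (h t))\<^sup>2) \<le> 0" using le by simp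
  moreover have "integral {a..b} (\<lambda>t. (norm (h t))\<^sup>2) \<ge> 0"
    by (intro Henstock_Kurzweil_Integration.integral_nonneg i1) simp
  ultimately have "((\<lambda>t. (norm (h t))\<^sup>2) has_integral 0) {a..b}"
    using i1 by (simp add: has_integral_iff)
  from integral_zero_imp_AE_zero[OF this] obtain N where N: "negligible N"
    "\<And>t. t \<in> {a..b} - N \<Longrightarrow> (norm (h t))\<^sup>2 = 0" by auto
  have "integral {a..t} h = integral {a..t} (\<lambda>_. 0)"
    by (rule integral_spike[OF N(1)]) (use N(2) t in auto)
  then show ?thesis using hint[OF t] by simp
qed

lemma minimizer_affine:
  fixes u :: "real \<Rightarrow> 'a::euclidean_space"
  assumes min: "is_minimizer \<Omega> p q u"
    and ab: "0 \<le> a" "a < b" "b \<le> 1"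
    and out: "closed_segment (u a) (u b) \<inter> \<Omega> = {}"
    and t: "t \<in> {a..b}"
  shows "u t = u a + ((t - a) / (b - a)) *\<^sub>R (u b - u a)"
proof -
  have "u t - u a = (t - a) *\<^sub>R ((u b - u a) /\<^sub>R (b - a))"
  proof (rule minimizer_straighten[OF min ab, of "\<lambda>x. x"])
    fix s assume s: "s \<in> {a..b}"
    have "u a + ((s - a) / (b - a)) *\<^sub>R (u b - u a) \<in> closed_segment (u a) (u b)"
      unfolding in_segment using s ab
      by (intro exI[of _ "(s - a) / (b - a)"]) (auto simp: algebra_simps)
    moreover have "u s - (u s - u a) + (s - a) *\<^sub>R ((u b - u a) /\<^sub>R (b - a)) 
        = u a + ((s - a) / (b - a)) *\<^sub>R (u b - u a)" by (simp add: divide_inverse)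
    ultimately show "u s - (u s - u a) + (s - a) *\<^sub>R ((u b - u a) /\<^sub>R (b - a)) \<notin> \<Omega>"
      using out by (metis disjoint_iff)
  qed (use t in \<open>auto simp: linear_iff\<close>)
  then show ?thesis by (simp add: divide_inverse algebra_simps)
qed

text \<open>
  Cutting out one whole excursion below the chord avoids truncating at the chord, which would need a
  chain rule for the positive part of a Sobolev function.
\<close>
lemma negative_excursion:
  fixes d :: "real \<Rightarrow> real"
  assumes d: "continuous_on {x..y} d" "d x = 0" "d y = 0" and m: "x < m" "m < y" "d m < 0"
  obtains a b where "x \<le> a" "a < m" "m < b" "b \<le> y" "d a = 0" "d b = 0"
    "\<forall>t\<in>{a..b}. d t \<le> 0"
proof -
  define A where "A = {t \<in> {x..m}. d t = 0}"
  define B where "B = {t \<in> {m..y}. d t = 0}"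
  have cA: "continuous_on {x..m} d" and cB: "continuous_on {m..y} d"
    using m by (auto intro!: continuous_on_subset[OF d(1)])
  have "closed A" "closed B"
    unfolding A_def B_def
    using continuous_closed_preimage_constant[OF cA, of 0] continuous_closed_preimage_constant[OF cB, of 0] by simp_all
  moreover have "bounded A" "bounded B"
  proof -
    have "A \<subseteq> {x..y}" "B \<subseteq> {x..y}" using m by (auto simp: A_def B_def)
    then show "bounded A" "bounded B" by (auto intro: bounded_subset[OF bounded_closed_interval])
  qed
  ultimately have "compact A" "compact B" by (auto simp: compact_eq_bounded_closed)
  moreover have "x \<in> A" "y \<in> B" using d m by (auto simp: A_def B_def)
  ultimately obtain a b where a: "a \<in> A" "\<And>t. t \<in> A \<Longrightarrow> t \<le> a" and b: "b \<in> B" "\<And>t. t \<in> B \<Longrightarrow> b \<le> t"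
    using compact_attains_sup[of A] compact_attains_inf[of B] by (metis empty_iff)
  have neg: "d t \<le> 0" if t: "t \<in> {a..b}" for t
  proof (rule ccontr)
    assume pos: "\<not> d t \<le> 0"
    have ct: "continuous_on {t..m} d" "continuous_on {m..t} d"
      using t a b by (auto intro!: continuous_on_subset[OF d(1)] simp: A_def B_def)
    show False
    proof (cases "t \<le> m")
      case True
      then obtain s where "t \<le> s" "s \<le> m" "d s = 0"
        using IVT2'[of d m 0 t] ct pos m by force
      then have "s \<in> A" using t a by (auto simp: A_def)
      then have "s = t" using a(2) t \<open>t \<le> s\<close> by fastforce
      then show False using pos \<open>d s = 0\<close> by simp
    next
      case False
      then obtain s where "m \<le> s" "s \<le> t" "d s = 0"
        using IVT'[of d m 0 t] ct pos m by force
      then have "s \<in> B" using t b by (auto simp: B_def)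
      then have "s = t" using b(2) t \<open>s \<le> t\<close> by fastforce
      then show False using pos \<open>d s = 0\<close> by simp
    qed
  qed
  have "a \<noteq> m" "b \<noteq> m" using a b m by (auto simp: A_def B_def)
  with a(1) b(1) neg show ?thesis by (intro that[of a b]) (auto simp: A_def B_def)
qed

text \<open>
  If the component of \<open>u\<close> along \<open>e\<close> dipped below one of its chords, lifting an excursion to the
  chord would straighten it; each point then moves by a nonnegative multiple of \<open>e\<close>, of length at
  most the diameter bound \<open>K\<close>, so that the competitor stays outside the obstacle.
\<close>
lemma minimizer_concave:
  fixes u :: "real \<Rightarrow> 'a::euclidean_space"
  assumes min: "is_minimizer \<Omega> p q u"
    and st: "0 \<le> s" "t \<le> 1"
    and osc: "\<And>\<sigma> \<tau>. \<sigma> \<in> {s..t} \<Longrightarrow> \<tau> \<in> {s..t} \<Longrightarrow> norm (u \<sigma> - u \<tau>) \<le> K"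
    and push: "\<And>\<tau> h. \<tau> \<in> {s..t} \<Longrightarrow> h \<ge> 0 \<Longrightarrow> norm (h *\<^sub>R e) \<le> K \<Longrightarrow> u \<tau> + h *\<^sub>R e \<notin> \<Omega>"
  shows "concave_on {s..t} (\<lambda>\<tau>. u \<tau> \<bullet> e)"
proof (cases "e = 0")
  case True
  then show ?thesis by (simp add: concave_on_const)
next
  case False
  then have e: "e \<bullet> e > 0" by simp
  obtain g where ug: "primitive_I u g"
    using min by (auto simp: is_minimizer_iff admissible_iff)
  note cont = primitive_I_continuous[OF ug]
  show ?thesis
  proof (rule concave_on_linorderI)
    fix \<mu> x y :: real
    assume \<mu>: "\<mu> > 0" "\<mu> < 1" and xy: "x \<in> {s..t}" "y \<in> {s..t}" "x < y"
    define m where "m = (1 - \<mu>) *\<^sub>R x + \<mu> *\<^sub>R y"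
    define k where "k = (u y \<bullet> e - u x \<bullet> e) / (y - x)"
    define d where "d \<tau> = u \<tau> \<bullet> e - (u x \<bullet> e + (\<tau> - x) * k)" for \<tau>
    have mx: "m - x = \<mu> * (y - x)" by (simp add: m_def algebra_simps)
    have ym: "y - m = (1 - \<mu>) * (y - x)" by (simp add: m_def algebra_simps)
    have m: "x < m" "m < y"
    proof -
      have "0 < m - x" "0 < y - m" unfolding mx ym using \<mu> xy by simp_all
      then show "x < m" "m < y" by simp_all
    qed
    have "d m \<ge> 0"
    proof (rule ccontr)
      assume "\<not> d m \<ge> 0"
      then have "d m < 0" by simp
      have cd: "continuous_on {x..y} d"
        unfolding d_def by (intro continuous_intros continuous_on_subset[OF cont]) (use xy st in auto)
      have d0: "d x = 0" "d y = 0" using xy by (auto simp: d_def k_def)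
      obtain a b where ab: "x \<le> a" "a < m" "m < b" "b \<le> y" "d a = 0" "d b = 0"
        and neg: "\<forall>\<tau>\<in>{a..b}. d \<tau> \<le> 0"
        by (rule negative_excursion[OF cd d0 m \<open>d m < 0\<close>])
      define P where "P z = ((z \<bullet> e) / (e \<bullet> e)) *\<^sub>R e" for z
      have P: "linear P" "\<And>z w. P z \<bullet> w = P z \<bullet> P w"
        using False by (auto simp: P_def linear_iff inner_add_left add_divide_distrib scaleR_add_left)
          (simp add: inner_commute)
      have uab: "u b \<bullet> e - u a \<bullet> e = (b - a) * k"
        using ab by (simp add: d_def algebra_simps)
      have c: "P (u b - u a) /\<^sub>R (b - a) = (k / (e \<bullet> e)) *\<^sub>R e"
        using ab uab by (simp add: P_def inner_diff_left)
      have "P (u m - u a) = (m - a) *\<^sub>R (P (u b - u a) /\<^sub>R (b - a))"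
      proof (rule minimizer_straighten[OF min _ _ _ P])
        fix \<tau> assume \<tau>: "\<tau> \<in> {a..b}"
        have in_st: "\<tau> \<in> {s..t}" "a \<in> {s..t}" "b \<in> {s..t}" using \<tau> ab xy by auto
        define h where "h = - d \<tau> / (e \<bullet> e)"
        have "d \<tau> \<le> 0" using neg \<tau> by blast
        then have "h \<ge> 0" using e by (simp add: h_def divide_nonpos_nonneg)
        have bd: "(u z - u \<tau>) \<bullet> e \<le> K * norm e" if "z \<in> {s..t}" for z
        proof -
          have "(u z - u \<tau>) \<bullet> e \<le> norm (u z - u \<tau>) * norm e" by (rule norm_cauchy_schwarz)
          also have "\<dots> \<le> K * norm e" using osc[OF that in_st(1)] by (intro mult_right_mono) auto
          finally show ?thesis .
        qed
        have "- d \<tau> \<le> K * norm e"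
        proof (cases "k \<ge> 0")
          case True
          have "- d \<tau> = (u b - u \<tau>) \<bullet> e - (b - \<tau>) * k"
            using ab by (simp add: d_def inner_diff_left algebra_simps)
          moreover have "(b - \<tau>) * k \<ge> 0" using True \<tau> by simp
          ultimately show ?thesis using bd[OF in_st(3)] by linarith
        next
          case False
          have "- d \<tau> = (u a - u \<tau>) \<bullet> e + (\<tau> - a) * k"
            using ab by (simp add: d_def inner_diff_left algebra_simps)
          moreover have "(\<tau> - a) * k \<le> 0" using False \<tau> by (simp add: mult_nonneg_nonpos)
          ultimately show ?thesis using bd[OF in_st(2)] by linarith
        qed
        then have "norm (h *\<^sub>R e) \<le> K"
          using False e \<open>h \<ge> 0\<close> unfolding h_def
          by (simp add: power2_norm_eq_inner[symmetric] power2_eq_square field_simps)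
        then have "u \<tau> + h *\<^sub>R e \<notin> \<Omega>" using push in_st \<open>h \<ge> 0\<close> by blast
        moreover have "u \<tau> - P (u \<tau> - u a) + (\<tau> - a) *\<^sub>R (P (u b - u a) /\<^sub>R (b - a)) = u \<tau> + h *\<^sub>R e"
        proof -
          have "- ((u \<tau> - u a) \<bullet> e / (e \<bullet> e)) + (\<tau> - a) * (k / (e \<bullet> e)) = h"
          proof -
            have "- ((u \<tau> - u a) \<bullet> e) + (\<tau> - a) * k = - d \<tau>"
              using ab by (simp add: d_def inner_diff_left algebra_simps)
            then show ?thesis
              unfolding h_def by (metis add_divide_distrib minus_divide_left times_divide_eq_right)
          qed
          then have "h *\<^sub>R e = - P (u \<tau> - u a) + (\<tau> - a) *\<^sub>R ((k / (e \<bullet> e)) *\<^sub>R e)"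
            unfolding P_def by (metis scaleR_add_left scaleR_minus_left scaleR_scaleR)
          then show ?thesis unfolding c by simp
        qed
        ultimately show "u \<tau> - P (u \<tau> - u a) + (\<tau> - a) *\<^sub>R (P (u b - u a) /\<^sub>R (b - a)) \<notin> \<Omega>"
          by (simp only: not_False_eq_True)
      qed (use ab st xy in auto)
      then have "(u m - u a) \<bullet> e / (e \<bullet> e) = (m - a) * k / (e \<bullet> e)"
        using False unfolding c by (simp add: P_def)
      then have "(u m - u a) \<bullet> e = (m - a) * k" using e by simp
      then have "d m = 0" using ab by (simp add: d_def inner_diff_left algebra_simps)
      then show False using \<open>d m < 0\<close> by simp
    qed
    moreover have "(y - x) * k = u y \<bullet> e - u x \<bullet> e" using xy by (simp add: k_def)
    ultimately have "u x \<bullet> e + \<mu> * (u y \<bullet> e - u x \<bullet> e) \<le> u m \<bullet> e"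
      unfolding d_def mx by (simp add: mult.assoc)
    then show "(1 - \<mu>) * (u x \<bullet> e) + \<mu> * (u y \<bullet> e) \<le> u ((1 - \<mu>) *\<^sub>R x + \<mu> *\<^sub>R y) \<bullet> e"
      unfolding m_def[symmetric] by (simp add: algebra_simps)
  qed simp
qed

section \<open>Boundary charts\<close>

text \<open>
  Boundedness is included because bounded Lipschitz functions, unlike Lipschitz functions, are closed
  under products.
\<close>
definition lip_bounded :: "'a::metric_space set \<Rightarrow> ('a \<Rightarrow> 'b::real_normed_vector) \<Rightarrow> bool" where
  "lip_bounded S f \<longleftrightarrow> (\<exists>K\<ge>0. \<forall>y\<in>S. norm (f y) \<le> K \<and> (\<forall>z\<in>S. norm (f y - f z) \<le> K * dist y z))"

lemma lip_boundedI:
  assumes "\<And>y. y \<in> S \<Longrightarrow> norm (f y) \<le> B" "\<And>y z. y \<in> S \<Longrightarrow> z \<in> S \<Longrightarrow> norm (f y - f z) \<le> L * dist y z"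
  shows "lip_bounded S f"
  unfolding lip_bounded_def
proof (intro exI[of _ "max 0 (max B L)"] conjI ballI)
  fix y z assume yz: "y \<in> S" "z \<in> S"
  have "norm (f y - f z) \<le> L * dist y z" using assms yz by blast
  also have "\<dots> \<le> max 0 (max B L) * dist y z" by (intro mult_right_mono) auto
  finally show "norm (f y - f z) \<le> max 0 (max B L) * dist y z" .
  show "norm (f y) \<le> max 0 (max B L)" using assms(1)[OF yz(1)] by simp
qed simp

lemma lip_bounded_const: "lip_bounded S (\<lambda>_. c)"
  by (rule lip_boundedI[where B = "norm c" and L = 0]) auto

lemma lip_bounded_add:
  assumes "lip_bounded S f" "lip_bounded S g"
  shows "lip_bounded S (\<lambda>x. f x + g x)"
proof -
  obtain K where K: "\<And>y. y \<in> S \<Longrightarrow> norm (f y) \<le> K"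
    "\<And>y z. y \<in> S \<Longrightarrow> z \<in> S \<Longrightarrow> norm (f y - f z) \<le> K * dist y z"
    using assms(1) unfolding lip_bounded_def by blast
  obtain M where M: "\<And>y. y \<in> S \<Longrightarrow> norm (g y) \<le> M"
    "\<And>y z. y \<in> S \<Longrightarrow> z \<in> S \<Longrightarrow> norm (g y - g z) \<le> M * dist y z"
    using assms(2) unfolding lip_bounded_def by blast
  show ?thesis
  proof (rule lip_boundedI[where B = "K + M" and L = "K + M"])
    show "norm (f y + g y) \<le> K + M" if "y \<in> S" for y
      using norm_triangle_mono[OF K(1) M(1)] that by blast
    fix y z assume yz: "y \<in> S" "z \<in> S"
    have "norm ((f y - f z) + (g y - g z)) \<le> K * dist y z + M * dist y z"
      using norm_triangle_mono[OF K(2) M(2)] yz by blast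
    then show "norm (f y + g y - (f z + g z)) \<le> (K + M) * dist y z"
      by (simp add: algebra_simps)
  qed
qed

lemma lip_bounded_scaleR:
  fixes f :: "_ \<Rightarrow> real"
  assumes "lip_bounded S f" "lip_bounded S g"
  shows "lip_bounded S (\<lambda>x. f x *\<^sub>R g x)"
proof -
  obtain K where K: "K \<ge> 0" "\<And>y. y \<in> S \<Longrightarrow> norm (f y) \<le> K"
    "\<And>y z. y \<in> S \<Longrightarrow> z \<in> S \<Longrightarrow> norm (f y - f z) \<le> K * dist y z"
    using assms(1) unfolding lip_bounded_def by blast
  obtain M where M: "M \<ge> 0" "\<And>y. y \<in> S \<Longrightarrow> norm (g y) \<le> M"
    "\<And>y z. y \<in> S \<Longrightarrow> z \<in> S \<Longrightarrow> norm (g y - g z) \<le> M * dist y z"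
    using assms(2) unfolding lip_bounded_def by blast
  show ?thesis
  proof (rule lip_boundedI[where B = "K * M" and L = "2 * K * M"])
    show "norm (f y *\<^sub>R g y) \<le> K * M" if "y \<in> S" for y
      using K(2)[OF that] M(2)[OF that] K(1) unfolding norm_scaleR real_norm_def by (intro mult_mono) auto
    fix y z assume yz: "y \<in> S" "z \<in> S"
    have "norm (f y *\<^sub>R g y - f z *\<^sub>R g z) = norm (f y *\<^sub>R (g y - g z) + (f y - f z) *\<^sub>R g z)"
      by (simp add: algebra_simps)
    also have "\<dots> \<le> norm (f y) * norm (g y - g z) + norm (f y - f z) * norm (g z)"
      by (rule order_trans[OF norm_triangle_ineq]) simp
    also have "\<dots> \<le> K * (M * dist y z) + K * dist y z * M"
      using K M yz by (intro add_mono mult_mono) auto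
    finally show "norm (f y *\<^sub>R g y - f z *\<^sub>R g z) \<le> 2 * K * M * dist y z"
      by (simp add: algebra_simps)
  qed
qed

lemma lip_bounded_mult:
  fixes f g :: "_ \<Rightarrow> real"
  assumes "lip_bounded S f" "lip_bounded S g"
  shows "lip_bounded S (\<lambda>x. f x * g x)"
  using lip_bounded_scaleR[OF assms] by simp

lemma lip_bounded_sum:
  assumes "\<And>i. i \<in> I \<Longrightarrow> lip_bounded S (f i)"
  shows "lip_bounded S (\<lambda>x. \<Sum>i\<in>I. f i x)"
  using assms by (induction I rule: infinite_finite_induct) (auto intro!: lip_bounded_const lip_bounded_add)

lemma lip_bounded_inverse:
  fixes f :: "_ \<Rightarrow> real"
  assumes "lip_bounded S f" and c: "c > 0" and le: "\<And>x. x \<in> S \<Longrightarrow> c \<le> f x"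
  shows "lip_bounded S (\<lambda>x. inverse (f x))"
proof -
  obtain K where K: "\<And>y z. y \<in> S \<Longrightarrow> z \<in> S \<Longrightarrow> norm (f y - f z) \<le> K * dist y z"
    using assms(1) unfolding lip_bounded_def by blast
  have pos: "f y > 0" if "y \<in> S" for y using c le[OF that] by simp
  have inv: "inverse (f y) \<le> inverse c" if "y \<in> S" for y
    using c le[OF that] by (simp add: le_imp_inverse_le)
  show ?thesis
  proof (rule lip_boundedI[where B = "inverse c" and L = "inverse c * inverse c * K"])
    show "norm (inverse (f y)) \<le> inverse c" if "y \<in> S" for y
      using pos[OF that] inv[OF that] by simp
    fix y z assume yz: "y \<in> S" "z \<in> S"
    have "norm (inverse (f y) - inverse (f z)) = inverse (f y) * inverse (f z) * norm (f y - f z)"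
      using pos[OF yz(1)] pos[OF yz(2)]
      by (simp add: inverse_diff_inverse abs_mult abs_minus_commute)
    also have "\<dots> \<le> inverse c * inverse c * (K * dist y z)"
      using inv[OF yz(1)] inv[OF yz(2)] pos[OF yz(1)] pos[OF yz(2)] c K[OF yz] 
      by (intro mult_mono) auto
    finally show "norm (inverse (f y) - inverse (f z)) \<le> inverse c * inverse c * K * dist y z"
      by (simp add: mult.assoc)
  qed
qed

lemma lip_bounded_fst:
  assumes "lip_bounded S f"
  shows "lip_bounded (S \<times> T) (\<lambda>z. f (fst z))"
proof -
  obtain K where K: "K \<ge> 0" "\<And>y. y \<in> S \<Longrightarrow> norm (f y) \<le> K"
    "\<And>y z. y \<in> S \<Longrightarrow> z \<in> S \<Longrightarrow> norm (f y - f z) \<le> K * dist y z"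
    using assms unfolding lip_bounded_def by blast
  show ?thesis
  proof (rule lip_boundedI[where B = K and L = K])
    fix y z assume yz: "y \<in> S \<times> T" "z \<in> S \<times> T"
    have "norm (f (fst y) - f (fst z)) \<le> K * dist (fst y) (fst z)" using K(3) yz by auto
    also have "\<dots> \<le> K * dist y z" using K(1) dist_fst_le by (rule mult_left_mono[rotated])
    finally show "norm (f (fst y) - f (fst z)) \<le> K * dist y z" .
  qed (use K in auto)
qed

lemma lip_bounded_snd_inner:
  fixes i :: "'a::euclidean_space"
  shows "lip_bounded (T \<times> cball 0 V) (\<lambda>z. snd z \<bullet> i)"
proof (rule lip_boundedI[where B = "V * norm i" and L = "norm i"])
  fix y assume "y \<in> T \<times> cball (0::'a) V"
  then have "norm (snd y) \<le> V" by auto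
  then show "norm (snd y \<bullet> i) \<le> V * norm i"
    using Cauchy_Schwarz_ineq2[of "snd y" i] mult_right_mono[of "norm (snd y)" V "norm i"] by simp
next
  fix y z :: "'b \<times> 'a"
  have "norm (snd y \<bullet> i - snd z \<bullet> i) = \<bar>(snd y - snd z) \<bullet> i\<bar>" by (simp add: inner_diff_left)
  also have "\<dots> \<le> dist (snd y) (snd z) * norm i"
    using Cauchy_Schwarz_ineq2 by (metis dist_norm)
  also have "\<dots> \<le> dist y z * norm i" by (intro mult_right_mono dist_snd_le) simp
  finally show "norm (snd y \<bullet> i - snd z \<bullet> i) \<le> norm i * dist y z" by (simp add: mult.commute)
qed

text \<open>
  The partial derivatives are bounded on the compact ball, which bounds the operator norm of the
  derivative there.
\<close>
lemma Ck_on_1_imp_lip_bounded: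
  fixes f :: "'a::euclidean_space \<Rightarrow> 'b::euclidean_space"
  assumes f: "Ck_on (Suc 0) f U" and sub: "cball x r \<subseteq> U"
  shows "lip_bounded (cball x r) f"
proof -
  have diff: "f differentiable at y" if "y \<in> cball x r" for y
    using f sub that by auto
  then have der: "(f has_derivative frechet_derivative f (at y)) (at y)" if "y \<in> cball x r" for y
    using that by (simp add: frechet_derivative_works)
  have "\<exists>M. \<forall>y\<in>cball x r. norm (frechet_derivative f (at y) i) \<le> M" for i
  proof -
    have "continuous_on (cball x r) (\<lambda>y. frechet_derivative f (at y) i)"
      using f sub by (auto intro: continuous_on_subset)
    then have "bounded ((\<lambda>y. frechet_derivative f (at y) i) ` cball x r)"
      by (intro compact_imp_bounded compact_continuous_image compact_cball)
    then show ?thesis by (auto simp: bounded_iff)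
  qed
  then obtain M where M: "\<And>i y. y \<in> cball x r \<Longrightarrow> norm (frechet_derivative f (at y) i) \<le> M i"
    by metis
  have on: "onorm (frechet_derivative f (at y)) \<le> (\<Sum>i\<in>Basis. M i)" if y: "y \<in> cball x r" for y
  proof (rule onorm_le)
    fix h
    have lin: "linear (frechet_derivative f (at y))"
      using der[OF y] has_derivative_linear by blast
    have "frechet_derivative f (at y) h = frechet_derivative f (at y) (\<Sum>i\<in>Basis. (h \<bullet> i) *\<^sub>R i)"
      by (simp add: euclidean_representation)
    also have "\<dots> = (\<Sum>i\<in>Basis. (h \<bullet> i) *\<^sub>R frechet_derivative f (at y) i)"
      by (simp add: linear_sum[OF lin] linear_scale[OF lin])
    also have "norm \<dots> \<le> (\<Sum>i\<in>Basis. norm h * M i)"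
    proof (rule sum_norm_le)
      fix i :: 'a assume i: "i \<in> Basis"
      show "norm ((h \<bullet> i) *\<^sub>R frechet_derivative f (at y) i) \<le> norm h * M i"
        using M[OF y, of i] Basis_le_norm[OF i, of h] unfolding norm_scaleR by (intro mult_mono) auto
    qed
    finally show "norm (frechet_derivative f (at y) h) \<le> (\<Sum>i\<in>Basis. M i) * norm h"
      by (simp add: sum_distrib_left mult.commute)
  qed
  have "continuous_on (cball x r) f"
    using diff by (intro continuous_at_imp_continuous_on ballI differentiable_imp_continuous_within)
  then have "bounded (f ` cball x r)"
    by (intro compact_imp_bounded compact_continuous_image compact_cball)
  then obtain B where B: "\<And>y. y \<in> cball x r \<Longrightarrow> norm (f y) \<le> B" unfolding bounded_iff by blast
  show ?thesis
  proof (rule lip_boundedI[OF B])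
    fix y z assume yz: "y \<in> cball x r" "z \<in> cball x r"
    have "norm (f y - f z) \<le> (\<Sum>i\<in>Basis. M i) * norm (y - z)"
      by (rule differentiable_bound[OF convex_cball has_derivative_at_withinI[OF der] on yz])
    then show "norm (f y - f z) \<le> (\<Sum>i\<in>Basis. M i) * dist y z" by (simp add: dist_norm)
  qed
qed

text \<open>
  The geodesic equation of a level set of a function with gradient \<open>G\<close> and Hessian \<open>DG\<close> is
  \<open>u'' = accel G DG u u'\<close>: the acceleration is normal, and differentiating \<open>G u \<bullet> u' = 0\<close>
  determines its length.
\<close>
definition accel :: "('a::euclidean_space \<Rightarrow> 'a) \<Rightarrow> ('a \<Rightarrow> 'a \<Rightarrow> 'a) \<Rightarrow> 'a \<Rightarrow> 'a \<Rightarrow> 'a" where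
  "accel G DG y v = (- (v \<bullet> DG y v) * inverse (G y \<bullet> G y)) *\<^sub>R G y"

definition boundary_chart ::
  "'a::euclidean_space set \<Rightarrow> 'a \<Rightarrow> real \<Rightarrow> ('a \<Rightarrow> real) \<Rightarrow> ('a \<Rightarrow> 'a) \<Rightarrow> ('a \<Rightarrow> 'a \<Rightarrow> 'a) \<Rightarrow> bool" where
  "boundary_chart \<Omega> x r \<rho> G DG \<longleftrightarrow> r > 0 \<and>
     (\<forall>y\<in>cball x r. (\<rho> has_derivative (\<lambda>h. G y \<bullet> h)) (at y)) \<and>
     (\<forall>y\<in>cball x r. (G has_derivative DG y) (at y)) \<and>
     (\<forall>y\<in>cball x r. y \<in> \<Omega> \<longleftrightarrow> \<rho> y < 0) \<and>
     (\<forall>y\<in>cball x r. y \<in> frontier \<Omega> \<longleftrightarrow> \<rho> y = 0) \<and>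
     (\<exists>c>0. \<forall>y\<in>cball x r. c \<le> norm (G y)) \<and>
     lip_bounded (cball x r) G \<and>
     (\<forall>V. lip_bounded (cball x r \<times> cball 0 V) (\<lambda>z. accel G DG (fst z) (snd z)))"

text \<open>
  Three derivatives of the defining function are used: the acceleration involves the first two, and
  the third makes it Lipschitz.
\<close>
lemma smooth_boundary_chart:
  fixes \<Omega> :: "'a::euclidean_space set"
  assumes sb: "smooth_boundary \<Omega>" and x: "x \<in> frontier \<Omega>"
  obtains r \<rho> G DG where "boundary_chart \<Omega> x r \<rho> G DG"
proof -
  obtain U and \<rho> :: "'a \<Rightarrow> real" where
    "open U \<and> x \<in> U \<and> smooth_on \<rho> U \<and>
        (\<forall>y\<in>U. frechet_derivative \<rho> (at y) \<noteq> (\<lambda>_. 0)) \<and>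
        \<Omega> \<inter> U = {y\<in>U. \<rho> y < 0} \<and> frontier \<Omega> \<inter> U = {y\<in>U. \<rho> y = 0}"
    using bspec[OF sb[unfolded smooth_boundary_def] x] by (elim exE) (rule that)
  then have U: "open U" "x \<in> U" and sm: "smooth_on \<rho> U"
    and nz: "\<And>y. y \<in> U \<Longrightarrow> frechet_derivative \<rho> (at y) \<noteq> (\<lambda>_. 0)"
    and inside: "\<Omega> \<inter> U = {y\<in>U. \<rho> y < 0}" and fr: "frontier \<Omega> \<inter> U = {y\<in>U. \<rho> y = 0}"
    by blast+
  obtain r where r: "r > 0" "cball x r \<subseteq> U" using U open_contains_cball by blast
  define D where "D v y = frechet_derivative \<rho> (at y) v" for v y
  define D2 where "D2 v w y = frechet_derivative (D v) (at y) w" for v w y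
  have C3: "Ck_on (Suc (Suc (Suc 0))) \<rho> U" using sm unfolding smooth_on_def by blast
  have C2: "Ck_on (Suc (Suc 0)) (D v) U" for v
    using C3 Ck_on.simps(2)[of "Suc (Suc 0)" \<rho> U] unfolding D_def by blast
  have C1: "Ck_on (Suc 0) (D2 v w) U" for v w
    using C2[of v] Ck_on.simps(2)[of "Suc 0" "D v" U] unfolding D2_def by blast
  have diff\<rho>: "\<rho> differentiable at y" if "y \<in> U" for y
    using C3 Ck_on.simps(2)[of "Suc (Suc 0)" \<rho> U] that by blast
  have diffD: "D v differentiable at y" if "y \<in> U" for y v
    using C2[of v] Ck_on.simps(2)[of "Suc 0" "D v" U] that by blast
  have diffD2: "D2 v w differentiable at y" if "y \<in> U" for y v w
    using C1[of v w] Ck_on.simps(2)[of 0 "D2 v w" U] that by blast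
  have C1': "Ck_on (Suc 0) (D v) U" for v
    unfolding Ck_on.simps D2_def[symmetric]
    using diffD diffD2 by (auto intro!: continuous_at_imp_continuous_on differentiable_imp_continuous_within)
  define G where "G y = (\<Sum>i\<in>Basis. D i y *\<^sub>R i)" for y
  define DG where "DG y w = (\<Sum>i\<in>Basis. D2 i w y *\<^sub>R i)" for y w
  have d\<rho>: "(\<rho> has_derivative (\<lambda>v. D v y)) (at y)" if "y \<in> U" for y
    unfolding D_def by (rule frechet_derivative_works[THEN iffD1, OF diff\<rho>[OF that]])
  have dD: "(D v has_derivative (\<lambda>w. D2 v w y)) (at y)" if "y \<in> U" for y v
    unfolding D2_def by (rule frechet_derivative_works[THEN iffD1, OF diffD[OF that]])
  have DG_inner: "D v y = G y \<bullet> v" if "y \<in> U" for y v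
  proof -
    have lin: "linear (\<lambda>v. D v y)" using d\<rho>[OF that] has_derivative_linear by blast
    have "D v y = D (\<Sum>i\<in>Basis. (v \<bullet> i) *\<^sub>R i) y" by (simp add: euclidean_representation)
    also have "\<dots> = (\<Sum>i\<in>Basis. (v \<bullet> i) * D i y)"
      using linear_sum[OF lin, of "\<lambda>i. (v \<bullet> i) *\<^sub>R i" Basis] linear_scale[OF lin] by simp
    finally show ?thesis by (simp add: G_def inner_sum_left inner_commute[of v] mult.commute)
  qed
  have D2_sum: "D2 i w y = (\<Sum>j\<in>Basis. (w \<bullet> j) * D2 i j y)" if "y \<in> U" for y i w
  proof -
    have lin: "linear (\<lambda>w. D2 i w y)" using dD[OF that] has_derivative_linear by blast
    have "D2 i w y = D2 i (\<Sum>j\<in>Basis. (w \<bullet> j) *\<^sub>R j) y" by (simp add: euclidean_representation)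
    also have "\<dots> = (\<Sum>j\<in>Basis. (w \<bullet> j) * D2 i j y)"
      using linear_sum[OF lin, of "\<lambda>j. (w \<bullet> j) *\<^sub>R j" Basis] linear_scale[OF lin] by simp
    finally show ?thesis .
  qed
  have lD: "lip_bounded (cball x r) (D v)" for v by (rule Ck_on_1_imp_lip_bounded[OF C1' r(2)])
  have lD2: "lip_bounded (cball x r) (D2 v w)" for v w by (rule Ck_on_1_imp_lip_bounded[OF C1 r(2)])
  have lG: "lip_bounded (cball x r) G"
    unfolding G_def by (intro lip_bounded_sum lip_bounded_scaleR lip_bounded_const lD)
  have dG: "(G has_derivative DG y) (at y)" if "y \<in> U" for y
    unfolding G_def DG_def 
    by (intro has_derivative_sum has_derivative_scaleR_left dD[OF that])
  have G0: "G y \<noteq> 0" if "y \<in> U" for y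
  proof
    assume "G y = 0"
    then have "frechet_derivative \<rho> (at y) = (\<lambda>_. 0)"
      using DG_inner[OF that] by (simp add: D_def fun_eq_iff)
    then show False using nz[OF that] by simp
  qed
  have cG: "continuous_on (cball x r) (\<lambda>y. norm (G y))"
    using dG r(2) by (intro continuous_on_norm continuous_at_imp_continuous_on ballI)
      (meson has_derivative_continuous subset_iff)
  obtain y0 where y0: "y0 \<in> cball x r" "\<And>y. y \<in> cball x r \<Longrightarrow> norm (G y0) \<le> norm (G y)"
    using continuous_attains_inf[OF compact_cball _ cG] r(1) by (metis centre_in_cball empty_iff less_imp_le)
  define c where "c = norm (G y0)"
  have c: "c > 0" using G0 y0(1) r(2) by (auto simp: c_def)
  have cle: "c \<le> norm (G y)" if "y \<in> cball x r" for y using y0(2)[OF that] by (simp add: c_def)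
  have lacc: "lip_bounded (cball x r \<times> cball 0 V) (\<lambda>z. accel G DG (fst z) (snd z))" for V
  proof -
    let ?S = "cball x r \<times> cball (0::'a) V"
    have l1: "lip_bounded ?S (\<lambda>z. G (fst z))" by (rule lip_bounded_fst[OF lG])
    have l2: "lip_bounded (cball x r) (\<lambda>y. inverse (G y \<bullet> G y))"
    proof (rule lip_bounded_inverse)
      have "lip_bounded (cball x r) (\<lambda>y. \<Sum>i\<in>Basis. D i y * D i y)"
        by (intro lip_bounded_sum lip_bounded_mult lD)
      moreover have "(\<lambda>y. \<Sum>i\<in>Basis. D i y * D i y) = (\<lambda>y. G y \<bullet> G y)"
      proof
        fix y
        have "G y \<bullet> i = D i y" if "i \<in> Basis" for i
          using that by (simp add: G_def inner_sum_left_Basis)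
        then show "(\<Sum>i\<in>Basis. D i y * D i y) = G y \<bullet> G y"
          by (subst euclidean_inner) (rule sum.cong, simp_all)
      qed
      ultimately show "lip_bounded (cball x r) (\<lambda>y. G y \<bullet> G y)" by simp
      show "c * c > 0" using c by simp
      show "c * c \<le> G y \<bullet> G y" if "y \<in> cball x r" for y
        unfolding power2_norm_eq_inner[symmetric] power2_eq_square
        using cle[OF that] c by (intro mult_mono) auto
    qed
    have l3: "lip_bounded ?S (\<lambda>z. \<Sum>i\<in>Basis. (snd z \<bullet> i) * (\<Sum>j\<in>Basis. (snd z \<bullet> j) * D2 i j (fst z)))"
      by (intro lip_bounded_sum lip_bounded_mult lip_bounded_snd_inner lip_bounded_fst[OF lD2])
    have "lip_bounded ?S (\<lambda>z. (- 1 * (\<Sum>i\<in>Basis. (snd z \<bullet> i) * (\<Sum>j\<in>Basis. (snd z \<bullet> j) * D2 i j (fst z)))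
       * inverse (G (fst z) \<bullet> G (fst z))) *\<^sub>R G (fst z))"
      by (intro lip_bounded_scaleR lip_bounded_mult lip_bounded_const l3 l1 lip_bounded_fst[OF l2])
    moreover have "accel G DG (fst z) (snd z) = 
       (- 1 * (\<Sum>i\<in>Basis. (snd z \<bullet> i) * (\<Sum>j\<in>Basis. (snd z \<bullet> j) * D2 i j (fst z)))
       * inverse (G (fst z) \<bullet> G (fst z))) *\<^sub>R G (fst z)" if "z \<in> ?S" for z
    proof -
      have "fst z \<in> U" using that r(2) by auto
      then have "snd z \<bullet> DG (fst z) (snd z) = (\<Sum>i\<in>Basis. (snd z \<bullet> i) * (\<Sum>j\<in>Basis. (snd z \<bullet> j) * D2 i j (fst z)))"
        by (simp add: DG_def inner_sum_right D2_sum[symmetric] mult.commute)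
      then show ?thesis by (simp add: accel_def)
    qed
    ultimately show ?thesis unfolding lip_bounded_def by (smt (verit))
  qed
  have "boundary_chart \<Omega> x r \<rho> G DG"
    unfolding boundary_chart_def
  proof (intro conjI ballI allI r(1) lG lacc)
    fix y assume "y \<in> cball x r"
    then have y: "y \<in> U" using r(2) by auto
    show "(\<rho> has_derivative (\<lambda>h. G y \<bullet> h)) (at y)" using d\<rho>[OF y] by (simp add: DG_inner[OF y])
    show "(G has_derivative DG y) (at y)" by (rule dG[OF y])
    show "y \<in> \<Omega> \<longleftrightarrow> \<rho> y < 0" using inside y by blast
    show "y \<in> frontier \<Omega> \<longleftrightarrow> \<rho> y = 0" using fr y by blast
  next
    show "\<exists>c>0. \<forall>y\<in>cball x r. c \<le> norm (G y)" using c cle by blast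
  qed
  then show ?thesis by (rule that)
qed

section \<open>One-sided derivatives of concave functions\<close>
lemma concave_slopes:
  fixes f :: "real \<Rightarrow> real"
  assumes f: "concave_on I f" and "x \<in> I" "y \<in> I" "x < t" "t < y"
  shows "(f y - f t) / (y - t) \<le> (f y - f x) / (y - x)"
    and "(f y - f x) / (y - x) \<le> (f t - f x) / (t - x)"
proof -
  have c: "convex_on I (\<lambda>x. - f x)" using f by (simp add: concave_on_def)
  have 1: "(- f x - - f t) / (x - t) = - ((f t - f x) / (t - x))" 
    "(- f x - - f y) / (x - y) = - ((f y - f x) / (y - x))"
    "(- f t - - f y) / (t - y) = - ((f y - f t) / (y - t))"
    using assms by (auto simp: field_simps)
  show "(f y - f t) / (y - t) \<le> (f y - f x) / (y - x)" "(f y - f x) / (y - x) \<le> (f t - f x) / (t - x)"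
    using convex_on_slope_le[OF c assms(2-5)] unfolding 1 by simp_all
qed

lemma concave_right_derivative:
  fixes f :: "real \<Rightarrow> real"
  assumes f: "concave_on {s..t} f" and \<tau>: "s < \<tau>" "\<tau> < t"
  obtains D where "(f has_real_derivative D) (at_right \<tau>)"
proof -
  define q where "q y = (f y - f \<tau>) / (y - \<tau>)" for y
  define M where "M = (f \<tau> - f s) / (\<tau> - s)"
  have le: "q y \<le> M" if "y \<in> {\<tau><..t}" for y
    using concave_slopes[OF f, of s y \<tau>] that \<tau> unfolding q_def M_def by fastforce
  have bdd: "bdd_above (q ` {\<tau><..t})" by (rule bdd_aboveI2[OF le])
  have ne: "q ` {\<tau><..t} \<noteq> {}" using \<tau> by auto
  define D where "D = Sup (q ` {\<tau><..t})"
  have "(q \<longlongrightarrow> D) (at_right \<tau>)"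
  proof (rule order_tendstoI)
    fix a assume "a < D"
    then obtain y0 where y0: "\<tau> < y0" "y0 \<le> t" "a < q y0"
      unfolding D_def less_cSup_iff[OF ne bdd] by auto
    have "a < q y" if "\<tau> < y" "y < y0" for y
      using concave_slopes(2)[OF f, of \<tau> y0 y] that y0 \<tau> unfolding q_def by fastforce
    then show "\<forall>\<^sub>F y in at_right \<tau>. a < q y"
      unfolding eventually_at_right_field using y0(1) by blast
  next
    fix a assume a: "D < a"
    have "q y < a" if "\<tau> < y" "y < t" for y
      using cSup_upper[OF _ bdd, of "q y"] that a unfolding D_def[symmetric] by force
    then show "\<forall>\<^sub>F y in at_right \<tau>. q y < a"
      unfolding eventually_at_right_field using \<tau>(2) by blast
  qed
  then have "(f has_real_derivative D) (at_right \<tau>)"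
    unfolding has_field_derivative_iff q_def .
  then show ?thesis by (rule that)
qed

lemma concave_left_derivative:
  fixes f :: "real \<Rightarrow> real"
  assumes f: "concave_on {s..t} f" and \<tau>: "s < \<tau>" "\<tau> < t"
  obtains D where "(f has_real_derivative D) (at_left \<tau>)"
proof -
  define q where "q y = (f y - f \<tau>) / (y - \<tau>)" for y
  have q': "q y = (f \<tau> - f y) / (\<tau> - y)" for y
    unfolding q_def by (metis minus_diff_eq minus_divide_divide)
  define M where "M = (f t - f \<tau>) / (t - \<tau>)"
  have le: "M \<le> q y" if "y \<in> {s..<\<tau>}" for y
    using concave_slopes[OF f, of y t \<tau>] that \<tau> unfolding q' M_def by fastforce
  have bdd: "bdd_below (q ` {s..<\<tau>})" by (rule bdd_belowI2[OF le])
  have ne: "q ` {s..<\<tau>} \<noteq> {}" using \<tau> by auto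
  define D where "D = Inf (q ` {s..<\<tau>})"
  have "(q \<longlongrightarrow> D) (at_left \<tau>)"
  proof (rule order_tendstoI)
    fix a assume "D < a"
    then obtain y0 where y0: "y0 < \<tau>" "s \<le> y0" "q y0 < a"
      unfolding D_def cInf_less_iff[OF ne bdd] by auto
    have "q y < a" if "y < \<tau>" "y0 < y" for y
      using concave_slopes(1)[OF f, of y0 \<tau> y] that y0 \<tau> unfolding q' by fastforce
    then show "\<forall>\<^sub>F y in at_left \<tau>. q y < a"
      unfolding eventually_at_left_field using y0(1) by blast
  next
    fix a assume a: "a < D"
    have "a < q y" if "y < \<tau>" "s < y" for y
      using cInf_lower[OF _ bdd, of "q y"] that a unfolding D_def[symmetric] by force
    then show "\<forall>\<^sub>F y in at_left \<tau>. a < q y"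
      unfolding eventually_at_left_field using \<tau>(1) by blast
  qed
  then have "(f has_real_derivative D) (at_left \<tau>)"
    unfolding has_field_derivative_iff q_def .
  then show ?thesis by (rule that)
qed

lemma concave_derivative_le_slope:
  fixes f :: "real \<Rightarrow> real"
  assumes f: "concave_on {a..b} f" "a < b" and D: "(f has_real_derivative D) (at_left b)"
  shows "D \<le> (f b - f a) / (b - a)"
proof (rule tendsto_upperbound)
  show "((\<lambda>y. (f y - f b) / (y - b)) \<longlongrightarrow> D) (at_left b)"
    using D by (simp add: has_field_derivative_iff)
  have "(f y - f b) / (y - b) \<le> (f b - f a) / (b - a)" if "a < y" "y < b" for y
    using concave_slopes(1)[OF f(1), of a b y] that
    by (metis atLeastAtMost_iff f(2) less_eq_real_def minus_diff_eq minus_divide_divide)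
  then show "\<forall>\<^sub>F y in at_left b. (f y - f b) / (y - b) \<le> (f b - f a) / (b - a)"
    unfolding eventually_at_left_field using f(2) by blast
qed simp

lemma concave_slope_le_derivative:
  fixes f :: "real \<Rightarrow> real"
  assumes f: "concave_on {a..b} f" "a < b" and D: "(f has_real_derivative D) (at_right a)"
  shows "(f b - f a) / (b - a) \<le> D"
proof (rule tendsto_lowerbound)
  show "((\<lambda>y. (f y - f a) / (y - a)) \<longlongrightarrow> D) (at_right a)"
    using D by (simp add: has_field_derivative_iff)
  have "(f b - f a) / (b - a) \<le> (f y - f a) / (y - a)" if "a < y" "y < b" for y
    using concave_slopes(2)[OF f(1), of a b y] that f(2) by simp
  then show "\<forall>\<^sub>F y in at_right a. (f b - f a) / (b - a) \<le> (f y - f a) / (y - a)"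
    unfolding eventually_at_right_field using f(2) by blast
qed simp

lemma concave_derivatives_antimono:
  fixes f :: "real \<Rightarrow> real"
  assumes f: "concave_on {a..b} f" "a \<le> b"
    and "(f has_real_derivative D) (at a)" "(f has_real_derivative D') (at b)"
  shows "D' \<le> D"
proof (cases "a = b")
  case True
  then show ?thesis using assms DERIV_unique by blast
next
  case False
  then have "a < b" using f by simp
  have "(f has_real_derivative D) (at_right a)" "(f has_real_derivative D') (at_left b)"
    using assms has_field_derivative_at_within by blast+
  then show ?thesis
    using concave_derivative_le_slope[OF f(1) \<open>a < b\<close>] concave_slope_le_derivative[OF f(1) \<open>a < b\<close>]
    by fastforce
qed

lemma concave_right_le_left_derivative:
  fixes f :: "real \<Rightarrow> real"
  assumes f: "concave_on {s..t} f" and \<tau>: "s < \<tau>" "\<tau> < t"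
    and Dr: "(f has_real_derivative Dr) (at_right \<tau>)" and Dl: "(f has_real_derivative Dl) (at_left \<tau>)"
  shows "Dr \<le> Dl"
proof -
  have *: "(f z - f \<tau>) / (z - \<tau>) \<le> (f y - f \<tau>) / (y - \<tau>)"
    if "s < y" "y < \<tau>" "\<tau> < z" "z < t" for y z
  proof -
    have "(f z - f \<tau>) / (z - \<tau>) \<le> (f \<tau> - f y) / (\<tau> - y)"
      using concave_slopes[OF f, of y z \<tau>] that by simp
    also have "\<dots> = (f y - f \<tau>) / (y - \<tau>)" by (metis minus_diff_eq minus_divide_divide)
    finally show ?thesis .
  qed
  have 1: "Dr \<le> (f y - f \<tau>) / (y - \<tau>)" if y: "s < y" "y < \<tau>" for y
  proof (rule tendsto_upperbound)
    show "((\<lambda>z. (f z - f \<tau>) / (z - \<tau>)) \<longlongrightarrow> Dr) (at_right \<tau>)"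
      using Dr by (simp add: has_field_derivative_iff)
    show "\<forall>\<^sub>F z in at_right \<tau>. (f z - f \<tau>) / (z - \<tau>) \<le> (f y - f \<tau>) / (y - \<tau>)"
      unfolding eventually_at_right_field using *[OF y] \<tau>(2) by blast
  qed simp
  show ?thesis
  proof (rule tendsto_lowerbound)
    show "((\<lambda>z. (f z - f \<tau>) / (z - \<tau>)) \<longlongrightarrow> Dl) (at_left \<tau>)"
      using Dl by (simp add: has_field_derivative_iff)
    show "\<forall>\<^sub>F y in at_left \<tau>. Dr \<le> (f y - f \<tau>) / (y - \<tau>)"
      unfolding eventually_at_left_field using 1 \<tau>(1) by blast
  qed simp
qed

section \<open>Minimizers are differentiable\<close>

text \<open>The defining function does not decrease along a direction that has nonnegative product with its gradient.\<close>
lemma boundary_chart_push: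
  assumes bc: "boundary_chart \<Omega> x r \<rho> G DG"
    and C: "convex C" "C \<subseteq> cball x r" "y \<in> C" "y + h *\<^sub>R e \<in> C"
    and h: "h \<ge> 0" and e: "\<And>z. z \<in> C \<Longrightarrow> e \<bullet> G z \<ge> 0" and y: "y \<notin> \<Omega>"
  shows "y + h *\<^sub>R e \<notin> \<Omega>"
proof -
  have in_C: "y + s *\<^sub>R e \<in> C" if "0 \<le> s" "s \<le> h" for s
  proof (cases "h = 0")
    case True
    then show ?thesis using that C by simp
  next
    case False
    then have "y + s *\<^sub>R e = (1 - s / h) *\<^sub>R y + (s / h) *\<^sub>R (y + h *\<^sub>R e)"
      by (simp add: algebra_simps)
    also have "\<dots> \<in> C"
      using C that False h by (intro convexD) (auto simp: divide_simps)
    finally show ?thesis .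
  qed
  have der: "((\<lambda>s. \<rho> (y + s *\<^sub>R e)) has_real_derivative (e \<bullet> G (y + s *\<^sub>R e))) (at s)"
    if s: "0 \<le> s" "s \<le> h" for s
  proof -
    have "y + s *\<^sub>R e \<in> cball x r" using in_C[OF s] C(2) by blast
    then have "(\<rho> has_derivative (\<lambda>h. G (y + s *\<^sub>R e) \<bullet> h)) (at (y + s *\<^sub>R e))"
      using bc unfolding boundary_chart_def by blast
    moreover have "((\<lambda>s. y + s *\<^sub>R e) has_derivative (\<lambda>h. h *\<^sub>R e)) (at s)"
      by (auto intro!: derivative_eq_intros)
    ultimately have "((\<lambda>s. \<rho> (y + s *\<^sub>R e)) has_derivative (\<lambda>h. G (y + s *\<^sub>R e) \<bullet> (h *\<^sub>R e))) (at s)"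
      by (rule has_derivative_compose[rotated])
    then show ?thesis
      by (simp add: has_field_derivative_def inner_commute mult_commute_abs)
  qed
  have "\<rho> (y + 0 *\<^sub>R e) \<le> \<rho> (y + h *\<^sub>R e)"
    by (rule DERIV_nonneg_imp_nondecreasing[OF h]) (use der e in_C in blast)
  moreover have "\<rho> y \<ge> 0" using bc y C unfolding boundary_chart_def by (meson not_less subsetD)
  ultimately show ?thesis
    using bc C unfolding boundary_chart_def by (smt (verit) scaleR_zero_left add_0_right subsetD)
qed

lemma minimizer_continuous:
  assumes "is_minimizer \<Omega> p q u"
  shows "continuous_on {0..1} u"
  using assms primitive_I_continuous by (auto simp: is_minimizer_iff admissible_iff)

lemma minimizer_outside:
  assumes "is_minimizer \<Omega> p q u" "t \<in> {0..1}"
  shows "u t \<notin> \<Omega>"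
  using assms by (auto simp: is_minimizer_iff admissible_iff)

lemma continuous_interior_nbhd:
  fixes u :: "real \<Rightarrow> 'a::metric_space"
  assumes u: "continuous_on {0..1} u" and \<tau>: "0 < \<tau>" "\<tau> < 1" and R: "R > 0"
  obtains \<delta> where "\<delta> > 0" "0 < \<tau> - \<delta>" "\<tau> + \<delta> < 1" "\<And>t. t \<in> {\<tau> - \<delta>..\<tau> + \<delta>} \<Longrightarrow> u t \<in> ball (u \<tau>) R"
proof -
  obtain d where d: "d > 0" "\<And>t. t \<in> {0..1} \<Longrightarrow> dist t \<tau> < d \<Longrightarrow> dist (u t) (u \<tau>) < R"
    using u \<tau> R unfolding continuous_on_iff by (metis atLeastAtMost_iff less_imp_le)
  define \<delta> where "\<delta> = min (d / 2) (min (\<tau> / 2) ((1 - \<tau>) / 2))"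
  have "\<delta> > 0" "2 * \<delta> \<le> d" "2 * \<delta> \<le> \<tau>" "2 * \<delta> \<le> 1 - \<tau>"
    using d(1) \<tau> unfolding \<delta>_def by (auto simp: min_def)
  then have \<delta>: "\<delta> > 0" "\<delta> < d" "\<delta> < \<tau>" "\<delta> < 1 - \<tau>" by argo+
  show ?thesis
  proof (rule that[of \<delta>])
    fix t assume "t \<in> {\<tau> - \<delta>..\<tau> + \<delta>}"
    then have "t \<in> {0..1}" "dist t \<tau> < d" using \<delta> by (auto simp: dist_real_def)
    then show "u t \<in> ball (u \<tau>) R" using d(2)[of t] by (simp add: dist_commute)
  qed (use \<delta> in auto)
qed

lemma minimizer_straight_off_obstacle:
  fixes u :: "real \<Rightarrow> 'a::euclidean_space"
  assumes min: "is_minimizer \<Omega> p q u" and \<tau>: "0 < \<tau>" "\<tau> < 1" and off: "u \<tau> \<notin> closure \<Omega>"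
  obtains \<delta> w where "\<delta> > 0" "0 < \<tau> - \<delta>" "\<tau> + \<delta> < 1"
    "\<And>t. t \<in> {\<tau> - \<delta><..<\<tau> + \<delta>} \<Longrightarrow> (u has_vector_derivative w) (at t)"
proof -
  have "open (- closure \<Omega>)" by (simp add: open_Compl)
  then obtain R where R: "R > 0" "ball (u \<tau>) R \<subseteq> - closure \<Omega>"
    using off by (meson ComplI open_contains_ball)
  obtain \<delta> where \<delta>: "\<delta> > 0" "0 < \<tau> - \<delta>" "\<tau> + \<delta> < 1"
    and near: "\<And>t. t \<in> {\<tau> - \<delta>..\<tau> + \<delta>} \<Longrightarrow> u t \<in> ball (u \<tau>) R"
    using continuous_interior_nbhd[OF minimizer_continuous[OF min] \<tau> R(1)] by metis
  define a b where "a = \<tau> - \<delta>" and "b = \<tau> + \<delta>"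
  have ab: "0 \<le> a" "a < b" "b \<le> 1" using \<delta> by (auto simp: a_def b_def)
  have "closed_segment (u a) (u b) \<subseteq> ball (u \<tau>) R"
    using near[of a] near[of b] \<delta> by (intro closed_segment_subset convex_ball) (auto simp: a_def b_def)
  then have "closed_segment (u a) (u b) \<inter> \<Omega> = {}" 
    using R(2) closure_subset[of \<Omega>] by blast
  note aff = minimizer_affine[OF min ab this]
  define w where "w = (u b - u a) /\<^sub>R (b - a)"
  have "(u has_vector_derivative w) (at t)" if t: "t \<in> {\<tau> - \<delta><..<\<tau> + \<delta>}" for t
  proof (rule has_vector_derivative_transform_within_open)
    show "((\<lambda>t. u a + (t - a) *\<^sub>R w) has_vector_derivative w) (at t)"
      by (auto intro!: derivative_eq_intros)
    show "u a + (s - a) *\<^sub>R w = u s" if "s \<in> {\<tau> - \<delta><..<\<tau> + \<delta>}" for s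
    proof -
      have "s \<in> {a..b}" using that by (simp add: a_def b_def)
      then show ?thesis unfolding aff[OF \<open>s \<in> {a..b}\<close>] w_def by (simp only: divide_inverse scaleR_scaleR)
    qed
  qed (use t in auto)
  then show ?thesis by (rule that[OF \<delta>])
qed

lemma boundary_chartD:
  assumes "boundary_chart \<Omega> x r \<rho> G DG"
  shows "r > 0"
    and "y \<in> cball x r \<Longrightarrow> (\<rho> has_derivative (\<lambda>h. G y \<bullet> h)) (at y)"
    and "y \<in> cball x r \<Longrightarrow> (G has_derivative DG y) (at y)"
    and "y \<in> cball x r \<Longrightarrow> y \<in> \<Omega> \<longleftrightarrow> \<rho> y < 0"
    and "y \<in> cball x r \<Longrightarrow> y \<in> frontier \<Omega> \<longleftrightarrow> \<rho> y = 0"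
    and "y \<in> cball x r \<Longrightarrow> G y \<noteq> 0"
    and "lip_bounded (cball x r) G"
    and "lip_bounded (cball x r \<times> cball 0 V) (\<lambda>z. accel G DG (fst z) (snd z))"
proof -
  show "y \<in> cball x r \<Longrightarrow> G y \<noteq> 0"
  proof -
    assume y: "y \<in> cball x r"
    obtain c where "c > 0" "c \<le> norm (G y)"
      using assms y unfolding boundary_chart_def by blast
    then show "G y \<noteq> 0" by auto
  qed
qed (use assms in \<open>unfold boundary_chart_def, blast+\<close>)

text \<open>
  By continuity of \<open>G\<close>, every direction in a cone around \<open>G (u \<tau>)\<close> has nonnegative product with \<open>G\<close>
  in a whole ball around \<open>u \<tau>\<close>. On a short time interval neither the curve nor the pushed curve
  leaves this ball.
\<close>
lemma minimizer_cone_concave: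
  fixes u :: "real \<Rightarrow> 'a::euclidean_space"
  assumes min: "is_minimizer \<Omega> p q u" and \<tau>: "0 < \<tau>" "\<tau> < 1"
    and bc: "boundary_chart \<Omega> (u \<tau>) r \<rho> G DG"
  obtains \<delta> \<epsilon> where "\<delta> > 0" "\<epsilon> > 0" "0 < \<tau> - \<delta>" "\<tau> + \<delta> < 1"
    "\<And>f. norm f \<le> 1 \<Longrightarrow> concave_on {\<tau> - \<delta>..\<tau> + \<delta>} (\<lambda>t. u t \<bullet> (G (u \<tau>) + \<epsilon> *\<^sub>R f))"
proof -
  define x g where "x = u \<tau>" and "g = G x"
  have r: "r > 0" using boundary_chartD(1)[OF bc] .
  have xin: "x \<in> cball x r" using r by simp
  have g: "norm g > 0" using boundary_chartD(6)[OF bc] xin by (simp add: g_def x_def)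
  have "isCont G x"
    using boundary_chartD(3)[OF bc] xin has_derivative_continuous unfolding x_def by blast
  then obtain R0 where R0: "R0 > 0" "\<And>z. dist z x < R0 \<Longrightarrow> dist (G z) (G x) < norm g / 3"
    unfolding continuous_at_eps_delta using g by (metis divide_pos_pos zero_less_numeral)
  define R where "R = min R0 r"
  have R: "R > 0" "R \<le> R0" "R \<le> r" using R0 r by (auto simp: R_def)
  \<comment> \<open>the curve stays within \<open>R / 4\<close> of \<open>x\<close> and pushes have length at most \<open>R / 2\<close>\<close>
  obtain \<delta> where \<delta>: "\<delta> > 0" "0 < \<tau> - \<delta>" "\<tau> + \<delta> < 1"
    and near: "\<And>t. t \<in> {\<tau> - \<delta>..\<tau> + \<delta>} \<Longrightarrow> u t \<in> ball (u \<tau>) (R / 4)"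
    using continuous_interior_nbhd[OF minimizer_continuous[OF min] \<tau>, of "R / 4"] R by auto
  have "concave_on {\<tau> - \<delta>..\<tau> + \<delta>} (\<lambda>t. u t \<bullet> (g + (norm g / 2) *\<^sub>R f))" if f: "norm f \<le> 1" for f
  proof (rule minimizer_concave[OF min, where K = "R / 2"])
    show "0 \<le> \<tau> - \<delta>" "\<tau> + \<delta> \<le> 1" using \<delta> by auto
    fix \<sigma> \<tau>' assume "\<sigma> \<in> {\<tau> - \<delta>..\<tau> + \<delta>}" "\<tau>' \<in> {\<tau> - \<delta>..\<tau> + \<delta>}"
    then have "dist (u \<tau>) (u \<sigma>) < R / 4" "dist (u \<tau>) (u \<tau>') < R / 4"
      using near by (simp_all only: mem_ball)
    then show "norm (u \<sigma> - u \<tau>') \<le> R / 2"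
      using dist_triangle3[of "u \<sigma>" "u \<tau>'" "u \<tau>"] unfolding dist_norm by linarith
  next
    fix \<sigma> h assume \<sigma>: "\<sigma> \<in> {\<tau> - \<delta>..\<tau> + \<delta>}" and h: "(0::real) \<le> h"
      and he: "norm (h *\<^sub>R (g + (norm g / 2) *\<^sub>R f)) \<le> R / 2"
    define e where "e = g + (norm g / 2) *\<^sub>R f"
    have pos: "e \<bullet> G z \<ge> 0" if z: "z \<in> ball x R" for z
    proof -
      have "norm (G z - g) \<le> norm g / 3"
        using R0(2)[of z] z R by (simp add: g_def dist_norm[symmetric] dist_commute)
      moreover have "norm e \<le> norm g + norm g / 2"
        using norm_triangle_ineq[of g "(norm g / 2) *\<^sub>R f"] f mult_left_mono[OF f, of "norm g / 2"]
        by (simp add: e_def)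
      ultimately have "norm e * norm (G z - g) \<le> (norm g + norm g / 2) * (norm g / 3)"
        by (intro mult_mono) auto
      then have 1: "\<bar>e \<bullet> (G z - g)\<bar> \<le> norm g * norm g / 2"
        using Cauchy_Schwarz_ineq2[of e "G z - g"] by (simp add: algebra_simps)
      have "\<bar>f \<bullet> g\<bar> \<le> norm g"
        using Cauchy_Schwarz_ineq2[of f g] mult_right_mono[OF f, of "norm g"] by simp
      then have "\<bar>(norm g / 2) * (f \<bullet> g)\<bar> \<le> (norm g / 2) * norm g"
        unfolding abs_mult by (intro mult_mono) auto
      moreover have "e \<bullet> g = norm g * norm g + (norm g / 2) * (f \<bullet> g)"
        by (simp add: e_def inner_add_left power2_norm_eq_inner[symmetric] power2_eq_square)
      ultimately have "e \<bullet> g \<ge> norm g * norm g / 2" by (simp add: abs_le_iff)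
      moreover have "e \<bullet> G z = e \<bullet> g + e \<bullet> (G z - g)" by (simp add: inner_diff_right)
      ultimately show ?thesis using 1 by linarith
    qed
    have "u \<sigma> + h *\<^sub>R e \<notin> \<Omega>"
    proof (rule boundary_chart_push[OF bc, of "ball x R"])
      show "ball x R \<subseteq> cball (u \<tau>) r" using R by (auto simp: x_def)
      have n: "norm (u \<sigma> - x) < R / 4" using near[OF \<sigma>] by (simp add: x_def dist_norm norm_minus_commute)
      then show "u \<sigma> \<in> ball x R" using R by (simp add: dist_norm norm_minus_commute)
      have "norm (u \<sigma> + h *\<^sub>R e - x) \<le> norm (u \<sigma> - x) + norm (h *\<^sub>R e)"
        using norm_triangle_ineq[of "u \<sigma> - x" "h *\<^sub>R e"] by (simp add: algebra_simps)
      also have "\<dots> < R" using n he R by (simp add: e_def)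
      finally show "u \<sigma> + h *\<^sub>R e \<in> ball x R" by (simp add: dist_norm norm_minus_commute)
      show "u \<sigma> \<notin> \<Omega>" using \<sigma> \<delta> by (intro minimizer_outside[OF min]) auto
    qed (use pos h in auto)
    then show "u \<sigma> + h *\<^sub>R (g + (norm g / 2) *\<^sub>R f) \<notin> \<Omega>" by (simp add: e_def)
  qed
  then show ?thesis
    using \<delta> g by (intro that[of \<delta> "norm g / 2"]) (auto simp: g_def x_def)
qed

text \<open>Every coordinate is a difference of two components along directions of the cone.\<close>
lemma one_sided_vector_derivative:
  fixes u :: "real \<Rightarrow> 'a::euclidean_space"
  assumes "\<epsilon> > (0::real)"
    and "\<And>f. norm f \<le> 1 \<Longrightarrow> \<exists>D. ((\<lambda>t. u t \<bullet> (g + \<epsilon> *\<^sub>R f)) has_real_derivative D) (at \<tau> within S)"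
  obtains D where "(u has_vector_derivative D) (at \<tau> within S)"
proof -
  have "\<exists>d. ((\<lambda>t. u t \<bullet> i) has_real_derivative d) (at \<tau> within S)" if i: "i \<in> Basis" for i
  proof -
    obtain d1 d2 where d: "((\<lambda>t. u t \<bullet> (g + \<epsilon> *\<^sub>R i)) has_real_derivative d1) (at \<tau> within S)"
      "((\<lambda>t. u t \<bullet> (g + \<epsilon> *\<^sub>R (- i))) has_real_derivative d2) (at \<tau> within S)"
      using assms(2)[of i] assms(2)[of "- i"] i by (auto simp: norm_Basis)
    have "((\<lambda>t. (u t \<bullet> (g + \<epsilon> *\<^sub>R i) - u t \<bullet> (g + \<epsilon> *\<^sub>R (- i))) / (2 * \<epsilon>)) has_real_derivative (d1 - d2) / (2 * \<epsilon>)) (at \<tau> within S)"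
      by (intro DERIV_cdivide DERIV_diff d)
    moreover have "(\<lambda>t. (u t \<bullet> (g + \<epsilon> *\<^sub>R i) - u t \<bullet> (g + \<epsilon> *\<^sub>R (- i))) / (2 * \<epsilon>)) = (\<lambda>t. u t \<bullet> i)"
      using assms(1) by (auto simp: inner_add_right inner_diff_right field_simps)
    ultimately show ?thesis by auto
  qed
  then obtain d where d: "\<And>i. i \<in> Basis \<Longrightarrow> ((\<lambda>t. u t \<bullet> i) has_real_derivative d i) (at \<tau> within S)"
    by metis
  define D where "D = (\<Sum>i\<in>Basis. d i *\<^sub>R i)"
  have "(u has_vector_derivative D) (at \<tau> within S)"
    unfolding has_vector_derivative_def
  proof (subst has_derivative_componentwise_within, intro ballI)
    fix i :: 'a assume i: "i \<in> Basis"
    have "D \<bullet> i = d i" using i by (simp add: D_def)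
    then show "((\<lambda>t. u t \<bullet> i) has_derivative (\<lambda>h. (h *\<^sub>R D) \<bullet> i)) (at \<tau> within S)"
      using d[OF i] by (simp add: has_field_derivative_def mult_commute_abs)
  qed
  then show ?thesis by (rule that)
qed

lemma has_vector_derivative_inner:
  fixes u :: "real \<Rightarrow> 'a::euclidean_space"
  assumes "(u has_vector_derivative D) (at t within S)"
  shows "((\<lambda>t. u t \<bullet> e) has_real_derivative D \<bullet> e) (at t within S)"
  using bounded_linear.has_vector_derivative[OF bounded_linear_inner_left[of e] assms]
  by (simp add: has_real_derivative_iff_has_vector_derivative)

lemma boundary_chart_along_curve:
  fixes u :: "real \<Rightarrow> 'a::euclidean_space"
  assumes bc: "boundary_chart \<Omega> x r \<rho> G DG" and t: "u t \<in> cball x r"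
    and D: "(u has_vector_derivative D) (at t within S)"
  shows "((\<lambda>t. \<rho> (u t)) has_real_derivative G (u t) \<bullet> D) (at t within S)"
proof -
  have "((\<lambda>t. \<rho> (u t)) has_derivative (\<lambda>h. G (u t) \<bullet> (h *\<^sub>R D))) (at t within S)"
    using D boundary_chartD(2)[OF bc t] unfolding has_vector_derivative_def
    by (rule has_derivative_compose)
  then show ?thesis by (simp add: has_field_derivative_def mult_commute_abs)
qed

text \<open>
  Let \<open>J\<close> be the jump of the one-sided derivatives at a contact time. Concavity makes \<open>J \<bullet> e \<le> 0\<close>
  for all \<open>e\<close> in a cone around the gradient \<open>g\<close> of the defining function. That function is
  nonnegative along the curve and vanishes at the contact, so it does not decrease afterwards and
  does not increase before, which gives \<open>J \<bullet> g \<ge> 0\<close>. Choosing \<open>e\<close> tilted from \<open>g\<close> towards \<open>J\<close>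
  leaves only \<open>J = 0\<close>.
\<close>
lemma minimizer_differentiable:
  fixes u :: "real \<Rightarrow> 'a::euclidean_space"
  assumes min: "is_minimizer \<Omega> p q u" and sb: "smooth_boundary \<Omega>" and op: "open \<Omega>"
    and \<tau>: "0 < \<tau>" "\<tau> < 1"
  shows "(u has_vector_derivative vector_derivative u (at \<tau>)) (at \<tau>)"
proof -
  have "\<exists>v. (u has_vector_derivative v) (at \<tau>)"
  proof (cases "u \<tau> \<in> closure \<Omega>")
    case False
    obtain \<delta> w where "\<delta> > 0" "\<And>t. t \<in> {\<tau> - \<delta><..<\<tau> + \<delta>} \<Longrightarrow> (u has_vector_derivative w) (at t)"
      using minimizer_straight_off_obstacle[OF min \<tau> False] by metis
    then have "(u has_vector_derivative w) (at \<tau>)" by simp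
    then show ?thesis by blast
  next
    case True
    have "u \<tau> \<notin> \<Omega>" using minimizer_outside[OF min, of \<tau>] \<tau> by simp
    then have fr: "u \<tau> \<in> frontier \<Omega>" using True op by (simp add: frontier_def interior_open)
    obtain r \<rho> G DG where bc: "boundary_chart \<Omega> (u \<tau>) r \<rho> G DG"
      using smooth_boundary_chart[OF sb fr] by metis
    note bcD = boundary_chartD[OF bc]
    define g where "g = G (u \<tau>)"
    obtain \<delta> \<epsilon> where \<delta>: "\<delta> > 0" "\<epsilon> > 0" "0 < \<tau> - \<delta>" "\<tau> + \<delta> < 1"
      and cc: "\<And>f. norm f \<le> 1 \<Longrightarrow> concave_on {\<tau> - \<delta>..\<tau> + \<delta>} (\<lambda>t. u t \<bullet> (g + \<epsilon> *\<^sub>R f))"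
      using minimizer_cone_concave[OF min \<tau> bc] unfolding g_def by metis
    have lt: "\<tau> - \<delta> < \<tau>" "\<tau> < \<tau> + \<delta>" using \<delta> by auto
    obtain Dr where Dr: "(u has_vector_derivative Dr) (at_right \<tau>)"
      using one_sided_vector_derivative[of \<epsilon> u g \<tau> "{\<tau><..}"] concave_right_derivative[OF cc lt] \<delta> by metis
    obtain Dl where Dl: "(u has_vector_derivative Dl) (at_left \<tau>)"
      using one_sided_vector_derivative[of \<epsilon> u g \<tau> "{..<\<tau>}"] concave_left_derivative[OF cc lt] \<delta> by metis
    define J where "J = Dr - Dl"
    have J1: "J \<bullet> (g + \<epsilon> *\<^sub>R f) \<le> 0" if f: "norm f \<le> 1" for f
      using concave_right_le_left_derivative[OF cc[OF f] lt has_vector_derivative_inner[OF Dr]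
          has_vector_derivative_inner[OF Dl]]
      by (simp add: J_def inner_diff_left)
    have xin: "u \<tau> \<in> cball (u \<tau>) r" using bcD(1) by simp
    have \<rho>0: "\<rho> (u \<tau>) = 0" using bcD(5)[OF xin] fr by simp
    obtain \<delta>' where \<delta>': "\<delta>' > 0" "0 < \<tau> - \<delta>'" "\<tau> + \<delta>' < 1"
      and near: "\<And>t. t \<in> {\<tau> - \<delta>'..\<tau> + \<delta>'} \<Longrightarrow> u t \<in> ball (u \<tau>) r"
      using continuous_interior_nbhd[OF minimizer_continuous[OF min] \<tau> bcD(1)] by metis
    have \<rho>: "\<rho> (u t) \<ge> 0" if t: "t \<in> {\<tau> - \<delta>'..\<tau> + \<delta>'}" for t
    proof -
      have "u t \<in> cball (u \<tau>) r" using near[OF t] by simp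
      moreover have "u t \<notin> \<Omega>" using t \<delta>' by (intro minimizer_outside[OF min]) auto
      ultimately show ?thesis using bcD(4) by force
    qed
    have Jr: "g \<bullet> Dr \<ge> 0"
    proof (rule tendsto_lowerbound)
      show "((\<lambda>y. (\<rho> (u y) - \<rho> (u \<tau>)) / (y - \<tau>)) \<longlongrightarrow> g \<bullet> Dr) (at_right \<tau>)"
        using boundary_chart_along_curve[OF bc xin Dr] by (simp add: has_field_derivative_iff g_def)
      have "0 \<le> (\<rho> (u y) - \<rho> (u \<tau>)) / (y - \<tau>)" if "\<tau> < y" "y < \<tau> + \<delta>'" for y
        using \<rho>[of y] that \<rho>0 \<delta>' by simp
      then show "\<forall>\<^sub>F y in at_right \<tau>. 0 \<le> (\<rho> (u y) - \<rho> (u \<tau>)) / (y - \<tau>)"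
        unfolding eventually_at_right_field using \<delta>'(1) by (metis less_add_same_cancel1)
    qed simp
    have Jl: "g \<bullet> Dl \<le> 0"
    proof (rule tendsto_upperbound)
      show "((\<lambda>y. (\<rho> (u y) - \<rho> (u \<tau>)) / (y - \<tau>)) \<longlongrightarrow> g \<bullet> Dl) (at_left \<tau>)"
        using boundary_chart_along_curve[OF bc xin Dl] by (simp add: has_field_derivative_iff g_def)
      have "(\<rho> (u y) - \<rho> (u \<tau>)) / (y - \<tau>) \<le> 0" if "\<tau> - \<delta>' < y" "y < \<tau>" for y
        using \<rho>[of y] that \<rho>0 \<delta>' by (simp add: divide_nonneg_neg)
      then show "\<forall>\<^sub>F y in at_left \<tau>. (\<rho> (u y) - \<rho> (u \<tau>)) / (y - \<tau>) \<le> 0"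
        unfolding eventually_at_left_field using \<delta>'(1) by (metis diff_less_eq less_add_same_cancel1)
    qed simp
    have "J = 0"
    proof (rule ccontr)
      assume "J \<noteq> 0"
      have "J \<bullet> (g + \<epsilon> *\<^sub>R (J /\<^sub>R norm J)) \<le> 0" using \<open>J \<noteq> 0\<close> by (intro J1) simp
      moreover have "J \<bullet> (J /\<^sub>R norm J) = norm J"
        using \<open>J \<noteq> 0\<close> by (simp add: power2_norm_eq_inner[symmetric] power2_eq_square)
      ultimately have "J \<bullet> g + \<epsilon> * norm J \<le> 0"
        by (simp only: inner_add_right inner_scaleR_right[of J \<epsilon>])
      moreover have "J \<bullet> g \<ge> 0" unfolding J_def inner_diff_left using Jr Jl by (simp add: inner_commute)
      moreover have "\<epsilon> * norm J > 0" using \<delta> \<open>J \<noteq> 0\<close> by simp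
      ultimately show False by linarith
    qed
    then have eq: "Dl = Dr" by (simp add: J_def)
    have "(u has_vector_derivative Dr) (at \<tau>)"
      using Dr Dl unfolding eq has_vector_derivative_def has_derivative_at_within
      by (auto intro: filterlim_split_at)
    then show ?thesis by blast
  qed
  then show ?thesis by (metis vector_derivative_at)
qed

abbreviation velocity :: "(real \<Rightarrow> 'a::euclidean_space) \<Rightarrow> real \<Rightarrow> 'a" where
  "velocity u t \<equiv> vector_derivative u (at t)"

section \<open>The geodesic equation on the boundary\<close>
lemma has_vector_derivative_iff_quotient:
  fixes f :: "real \<Rightarrow> 'a::euclidean_space"
  shows "(f has_vector_derivative D) (at x within S) \<longleftrightarrow>
    ((\<lambda>y. (f y - f x) /\<^sub>R (y - x)) \<longlongrightarrow> D) (at x within S)"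
proof -
  have "(f has_vector_derivative D) (at x within S) \<longleftrightarrow>
      (\<forall>i\<in>Basis. ((\<lambda>y. f y \<bullet> i) has_real_derivative D \<bullet> i) (at x within S))"
    unfolding has_vector_derivative_def has_field_derivative_def
    by (subst has_derivative_componentwise_within) (simp add: mult_commute_abs)
  also have "\<dots> \<longleftrightarrow> (\<forall>i\<in>Basis. ((\<lambda>y. ((f y - f x) /\<^sub>R (y - x)) \<bullet> i) \<longlongrightarrow> D \<bullet> i) (at x within S))"
    by (simp add: has_field_derivative_iff inner_diff_left divide_inverse mult.commute)
  also have "\<dots> \<longleftrightarrow> ((\<lambda>y. (f y - f x) /\<^sub>R (y - x)) \<longlongrightarrow> D) (at x within S)"
    by (rule tendsto_componentwise_iff[symmetric])
  finally show ?thesis .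
qed

text \<open>
  Along each direction of the cone the velocity component is monotone, hence bounded by its values at
  the ends of the interval.
\<close>
lemma minimizer_velocity_bounded:
  fixes u :: "real \<Rightarrow> 'a::euclidean_space"
  assumes min: "is_minimizer \<Omega> p q u" and sb: "smooth_boundary \<Omega>" and op: "open \<Omega>"
    and \<tau>: "0 < \<tau>" "\<tau> < 1" and bc: "boundary_chart \<Omega> (u \<tau>) r \<rho> G DG"
  obtains \<delta> V where "\<delta> > 0" "0 < \<tau> - \<delta>" "\<tau> + \<delta> < 1"
    "\<And>t. t \<in> {\<tau> - \<delta>..\<tau> + \<delta>} \<Longrightarrow> norm (velocity u t) \<le> V"
proof -
  define g where "g = G (u \<tau>)"
  obtain \<delta> \<epsilon> where \<delta>: "\<delta> > 0" "\<epsilon> > 0" "0 < \<tau> - \<delta>" "\<tau> + \<delta> < 1"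
    and cc: "\<And>f. norm f \<le> 1 \<Longrightarrow> concave_on {\<tau> - \<delta>..\<tau> + \<delta>} (\<lambda>t. u t \<bullet> (g + \<epsilon> *\<^sub>R f))"
    using minimizer_cone_concave[OF min \<tau> bc] unfolding g_def by metis
  have D: "((\<lambda>t. u t \<bullet> e) has_real_derivative velocity u t \<bullet> e) (at t)" if "t \<in> {\<tau> - \<delta>..\<tau> + \<delta>}" for t e
    using minimizer_differentiable[OF min sb op, of t] that \<delta> by (intro has_vector_derivative_inner) auto
  have mono: "velocity u b \<bullet> (g + \<epsilon> *\<^sub>R f) \<le> velocity u a \<bullet> (g + \<epsilon> *\<^sub>R f)"
    if f: "norm f \<le> 1" and ab: "\<tau> - \<delta> \<le> a" "a \<le> b" "b \<le> \<tau> + \<delta>" for f a b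
  proof (rule concave_derivatives_antimono[OF _ ab(2)])
    show "concave_on {a..b} (\<lambda>t. u t \<bullet> (g + \<epsilon> *\<^sub>R f))"
      using cc[OF f] ab unfolding concave_on_def by (auto intro: convex_on_subset)
  qed (use D ab in auto)
  define B where "B e = \<bar>velocity u (\<tau> - \<delta>) \<bullet> e\<bar> + \<bar>velocity u (\<tau> + \<delta>) \<bullet> e\<bar>" for e
  have bd: "\<bar>velocity u t \<bullet> (g + \<epsilon> *\<^sub>R f)\<bar> \<le> B (g + \<epsilon> *\<^sub>R f)"
    if f: "norm f \<le> 1" and t: "t \<in> {\<tau> - \<delta>..\<tau> + \<delta>}" for f t
    using mono[OF f, of "\<tau> - \<delta>" t] mono[OF f, of t "\<tau> + \<delta>"] t \<delta> unfolding B_def by auto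
  define M where "M i = (B (g + \<epsilon> *\<^sub>R i) + B (g + \<epsilon> *\<^sub>R (- i))) / (2 * \<epsilon>)" for i
  have "norm (velocity u t) \<le> (\<Sum>i\<in>Basis. M i)" if t: "t \<in> {\<tau> - \<delta>..\<tau> + \<delta>}" for t
  proof -
    have comp: "\<bar>velocity u t \<bullet> i\<bar> \<le> M i" if i: "i \<in> Basis" for i
    proof -
      have "2 * \<epsilon> * (velocity u t \<bullet> i) = velocity u t \<bullet> (g + \<epsilon> *\<^sub>R i) - velocity u t \<bullet> (g + \<epsilon> *\<^sub>R (- i))"
        by (simp add: inner_add_right inner_diff_right)
      then have "2 * \<epsilon> * \<bar>velocity u t \<bullet> i\<bar> \<le> B (g + \<epsilon> *\<^sub>R i) + B (g + \<epsilon> *\<^sub>R (- i))"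
        using bd[of i t] bd[of "- i" t] i t \<delta> by (simp add: abs_mult[symmetric] abs_if split: if_splits)
      then show ?thesis using \<delta> by (simp add: M_def field_simps)
    qed
    have "norm (velocity u t) \<le> (\<Sum>i\<in>Basis. \<bar>velocity u t \<bullet> i\<bar>)" by (rule norm_le_l1)
    also have "\<dots> \<le> (\<Sum>i\<in>Basis. M i)" by (intro sum_mono comp)
    finally show ?thesis .
  qed
  then show ?thesis by (rule that[OF \<delta>(1,3,4)])
qed

text \<open>The defining function attains a minimum along the curve at a contact time.\<close>
lemma minimizer_tangent_on_contact:
  fixes u :: "real \<Rightarrow> 'a::euclidean_space"
  assumes min: "is_minimizer \<Omega> p q u" and sb: "smooth_boundary \<Omega>" and op: "open \<Omega>"
    and t: "0 < t" "t < 1" and bc: "boundary_chart \<Omega> x r \<rho> G DG"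
    and ut: "u t \<in> ball x r" "u t \<in> frontier \<Omega>"
  shows "velocity u t \<bullet> G (u t) = 0"
proof -
  note bcD = boundary_chartD[OF bc]
  have R: "r - dist x (u t) > 0" using ut by simp
  obtain \<delta> where \<delta>: "\<delta> > 0" "0 < t - \<delta>" "t + \<delta> < 1"
    and near: "\<And>s. s \<in> {t - \<delta>..t + \<delta>} \<Longrightarrow> u s \<in> ball (u t) (r - dist x (u t))"
    using continuous_interior_nbhd[OF minimizer_continuous[OF min] t R] by metis
  have utc: "u t \<in> cball x r" using ut by simp
  have D: "((\<lambda>s. \<rho> (u s)) has_real_derivative G (u t) \<bullet> velocity u t) (at t)"
    by (rule boundary_chart_along_curve[OF bc utc minimizer_differentiable[OF min sb op t]])
  have "\<rho> (u t) \<le> \<rho> (u s)" if s: "\<bar>t - s\<bar> < \<delta>" for s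
  proof -
    have s': "s \<in> {t - \<delta>..t + \<delta>}" using s by auto
    have "dist x (u s) \<le> dist x (u t) + dist (u t) (u s)" by (rule dist_triangle)
    then have "u s \<in> cball x r" using near[OF s'] by simp
    moreover have "u s \<notin> \<Omega>" using s' \<delta> by (intro minimizer_outside[OF min]) auto
    ultimately have "\<rho> (u s) \<ge> 0" using bcD(4) by force
    moreover have "\<rho> (u t) = 0" using bcD(5)[OF utc] ut by simp
    ultimately show ?thesis by simp
  qed
  then have "G (u t) \<bullet> velocity u t = 0" using DERIV_local_min[OF D \<delta>(1)] by blast
  then show ?thesis by (simp add: inner_commute)
qed

lemma minimizer_lipschitz:
  fixes u :: "real \<Rightarrow> 'a::euclidean_space"
  assumes min: "is_minimizer \<Omega> p q u" and sb: "smooth_boundary \<Omega>" and op: "open \<Omega>"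
    and ab: "0 < a" "b < 1" and V: "\<And>t. t \<in> {a..b} \<Longrightarrow> norm (velocity u t) \<le> V"
    and st: "s \<in> {a..b}" "t \<in> {a..b}"
  shows "norm (u s - u t) \<le> V * \<bar>s - t\<bar>"
proof -
  have "norm (u s - u t) \<le> V * norm (s - t)"
  proof (rule differentiable_bound[where S = "{a..b}" and f = u and f' = "\<lambda>t h. h *\<^sub>R velocity u t"])
    show "(u has_derivative (\<lambda>h. h *\<^sub>R velocity u t)) (at t within {a..b})" if "t \<in> {a..b}" for t
      using minimizer_differentiable[OF min sb op, of t] that ab
      unfolding has_vector_derivative_def by (auto intro: has_derivative_at_withinI)
    show "onorm (\<lambda>h. h *\<^sub>R velocity u t) \<le> V" if "t \<in> {a..b}" for t
    proof (rule onorm_le)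
      show "norm (h *\<^sub>R velocity u t) \<le> V * norm h" for h :: real
        using mult_right_mono[OF V[OF that], of "\<bar>h\<bar>"] by (simp add: mult.commute)
    qed
  qed (use st in auto)
  then show ?thesis by simp
qed

text \<open>
  On a short interval \<open>[a,b]\<close> the curve stays in a ball of radius proportional to \<open>b - a\<close>, in which the
  gradient deviates from \<open>g\<close> by at most a multiple of \<open>b - a\<close>. So \<open>\<kappa> g + f\<close> is a direction of
  admissible pushes for every unit vector \<open>f\<close> orthogonal to \<open>g\<close>, with \<open>\<kappa>\<close> of order \<open>b - a\<close>.
  The velocity component along it decreases; for \<open>f\<close> in the direction of the tangential part of the
  increment \<open>D\<close> this bounds that part by \<open>\<kappa>\<close> times the normal part.
\<close>
lemma velocity_change_nearly_normal:
  fixes u :: "real \<Rightarrow> 'a::euclidean_space"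
  assumes min: "is_minimizer \<Omega> p q u" and sb: "smooth_boundary \<Omega>" and op: "open \<Omega>"
    and bc: "boundary_chart \<Omega> x r \<rho> G DG" and ab: "0 < a" "a < b" "b < 1"
    and s: "s \<in> {a..b}" and near: "dist x (u s) < r / 2"
    and W: "W > 0" "\<And>t. t \<in> {a..b} \<Longrightarrow> norm (velocity u t) \<le> W"
    and K: "K \<ge> 0" "\<And>y. y \<in> cball x r \<Longrightarrow> norm (G y) \<le> K"
      "\<And>y z. y \<in> cball x r \<Longrightarrow> z \<in> cball x r \<Longrightarrow> norm (G y - G z) \<le> K * dist y z"
    and c: "c > 0" "\<And>y. y \<in> cball x r \<Longrightarrow> c \<le> norm (G y)"
    and small: "\<kappa> = 6 * K * W * (b - a) / c\<^sup>2" "\<kappa> * K \<le> 1" "3 * W * (b - a) \<le> r / 2"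
  defines "g \<equiv> G (u s)" and "D \<equiv> velocity u b - velocity u a"
  shows "norm (D - ((D \<bullet> g) / (g \<bullet> g)) *\<^sub>R g) \<le> \<kappa> * \<bar>D \<bullet> g\<bar>"
proof -
  \<comment> \<open>the curve and the push each move at most \<open>W * (b - a)\<close>; the factor 3 keeps the open ball strict\<close>
  define R where "R = 3 * W * (b - a)"
  have R: "R > 0" "R \<le> r / 2" using W ab small by (auto simp: R_def)
  have \<kappa>0: "\<kappa> \<ge> 0" using K W ab c unfolding small(1) by simp
  have us: "u s \<in> cball x r" using near boundary_chartD(1)[OF bc] by simp
  have "0 < norm g" using c(1) c(2)[OF us] unfolding g_def by (rule order_less_le_trans)
  then have g0: "g \<bullet> g > 0" by simp
  have ballR: "ball (u s) R \<subseteq> cball x r"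
  proof
    fix z assume "z \<in> ball (u s) R"
    then show "z \<in> cball x r" using dist_triangle[of x z "u s"] near R by simp
  qed
  have decr: "D \<bullet> (\<kappa> *\<^sub>R g + f) \<le> 0" if f: "norm f = 1" "f \<bullet> g = 0" for f
  proof -
    define e where "e = \<kappa> *\<^sub>R g + f"
    have pos: "e \<bullet> G z \<ge> 0" if z: "z \<in> ball (u s) R" for z
    proof -
      have zc: "z \<in> cball x r" using z ballR by blast
      have ne: "norm e \<le> 2"
      proof -
        have "norm e \<le> \<kappa> * norm g + 1"
          using norm_triangle_ineq[of "\<kappa> *\<^sub>R g" f] f \<kappa>0 by (simp add: e_def)
        also have "\<kappa> * norm g \<le> \<kappa> * K" using K(2)[OF us] \<kappa>0 by (simp add: g_def mult_left_mono)
        finally show ?thesis using small by simp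
      qed
      have "norm (G z - g) \<le> K * dist z (u s)" unfolding g_def by (rule K(3)[OF zc us])
      also have "\<dots> \<le> K * R" using z K(1) by (intro mult_left_mono) (auto simp: dist_commute)
      finally have "norm e * norm (G z - g) \<le> 2 * (K * R)"
        using ne K(1) R by (intro mult_mono) auto
      then have "\<bar>e \<bullet> (G z - g)\<bar> \<le> 2 * (K * R)" using Cauchy_Schwarz_ineq2[of e "G z - g"] by linarith
      moreover have "e \<bullet> g = \<kappa> * (norm g)\<^sup>2"
        using f by (simp add: e_def inner_add_left power2_norm_eq_inner)
      moreover have "\<kappa> * c\<^sup>2 \<le> \<kappa> * (norm g)\<^sup>2"
        using c(2)[OF us] c(1) \<kappa>0 by (intro mult_left_mono power_mono) (auto simp: g_def)
      moreover have "\<kappa> * c\<^sup>2 = 2 * (K * R)" using c(1) by (simp add: small(1) R_def)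
      moreover have "e \<bullet> G z = e \<bullet> g + e \<bullet> (G z - g)" by (simp add: inner_diff_right)
      ultimately show ?thesis by linarith
    qed
    have lip: "norm (u \<sigma> - u \<tau>) \<le> W * (b - a)" if st: "\<sigma> \<in> {a..b}" "\<tau> \<in> {a..b}" for \<sigma> \<tau>
    proof -
      have "norm (u \<sigma> - u \<tau>) \<le> W * \<bar>\<sigma> - \<tau>\<bar>"
        using ab by (intro minimizer_lipschitz[OF min sb op _ _ W(2) st]) auto
      also have "\<dots> \<le> W * (b - a)" using st W(1) by (intro mult_left_mono) auto
      finally show ?thesis .
    qed
    have "concave_on {a..b} (\<lambda>t. u t \<bullet> e)"
    proof (rule minimizer_concave[OF min _ _ lip])
      fix \<sigma> h assume \<sigma>: "\<sigma> \<in> {a..b}" and h: "(0::real) \<le> h" and he: "norm (h *\<^sub>R e) \<le> W * (b - a)"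
      have pr: "W * (b - a) > 0" using W ab by simp
      show "u \<sigma> + h *\<^sub>R e \<notin> \<Omega>"
      proof (rule boundary_chart_push[OF bc convex_ball ballR _ _ h pos])
        have "dist (u s) (u \<sigma>) \<le> W * (b - a)" using lip[OF s \<sigma>] by (simp add: dist_norm)
        then show "u \<sigma> \<in> ball (u s) R" using pr by (simp add: R_def)
        have "norm (u s - (u \<sigma> + h *\<^sub>R e)) \<le> norm (u s - u \<sigma>) + norm (h *\<^sub>R e)"
          using norm_triangle_ineq4[of "u s - u \<sigma>" "h *\<^sub>R e"] by (simp add: algebra_simps)
        then have "norm (u s - (u \<sigma> + h *\<^sub>R e)) < R" using lip[OF s \<sigma>] he pr unfolding R_def by linarith
        then show "u \<sigma> + h *\<^sub>R e \<in> ball (u s) R" by (simp add: dist_norm)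
        show "u \<sigma> \<notin> \<Omega>" using \<sigma> ab by (intro minimizer_outside[OF min]) auto
      qed
    qed (use ab in auto)
    then have "velocity u b \<bullet> e \<le> velocity u a \<bullet> e"
    proof (rule concave_derivatives_antimono)
      show "((\<lambda>t. u t \<bullet> e) has_real_derivative velocity u a \<bullet> e) (at a)"
        using ab by (intro has_vector_derivative_inner minimizer_differentiable[OF min sb op]) auto
      show "((\<lambda>t. u t \<bullet> e) has_real_derivative velocity u b \<bullet> e) (at b)"
        using ab by (intro has_vector_derivative_inner minimizer_differentiable[OF min sb op]) auto
    qed (use ab in auto)
    then show ?thesis by (simp add: D_def e_def inner_diff_left)
  qed
  define P where "P = D - ((D \<bullet> g) / (g \<bullet> g)) *\<^sub>R g"
  have Pg: "P \<bullet> g = 0" using g0 by (simp add: P_def inner_diff_left)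
  have "norm P \<le> \<kappa> * \<bar>D \<bullet> g\<bar>"
  proof (cases "P = 0")
    case True
    then show ?thesis using \<kappa>0 by simp
  next
    case False
    have "D = P + ((D \<bullet> g) / (g \<bullet> g)) *\<^sub>R g" by (simp add: P_def)
    then have "D \<bullet> P = P \<bullet> P + ((D \<bullet> g) / (g \<bullet> g)) * (g \<bullet> P)"
      by (metis inner_add_left inner_scaleR_left)
    then have "D \<bullet> P = norm P * norm P"
      using Pg by (simp add: inner_commute[of g] power2_norm_eq_inner[symmetric] power2_eq_square)
    then have "D \<bullet> (P /\<^sub>R norm P) = norm P" using False by simp
    moreover have "D \<bullet> (\<kappa> *\<^sub>R g + P /\<^sub>R norm P) \<le> 0"
      using False Pg by (intro decr) auto
    ultimately have "norm P \<le> - (\<kappa> * (D \<bullet> g))" by (simp only: inner_add_right inner_scaleR_right[of D \<kappa>])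
    also have "\<dots> \<le> \<bar>\<kappa> * (D \<bullet> g)\<bar>" by simp
    also have "\<dots> = \<kappa> * \<bar>D \<bullet> g\<bar>" using \<kappa>0 by (simp add: abs_mult)
    finally show ?thesis .
  qed
  then show ?thesis by (simp add: P_def)
qed

text \<open>
  Split the difference quotient of the velocity at \<open>s\<close> into its parts tangential and normal to the
  boundary at \<open>u s\<close>. The tangential part tends to zero by \<open>velocity_change_nearly_normal\<close>. Since the
  velocity is tangent to the boundary at both times, the normal part is the product of the velocity
  with the difference quotient of the gradient along the curve, and it converges by the chain rule.
\<close>
lemma minimizer_acceleration_on_contact:
  fixes u :: "real \<Rightarrow> 'a::euclidean_space"
  assumes min: "is_minimizer \<Omega> p q u" and sb: "smooth_boundary \<Omega>" and op: "open \<Omega>"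
    and bc: "boundary_chart \<Omega> x r \<rho> G DG" and ab: "0 < \<alpha>" "\<alpha> < \<beta>" "\<beta> < 1"
    and contact: "\<And>t. t \<in> {\<alpha>..\<beta>} \<Longrightarrow> u t \<in> frontier \<Omega>"
    and near: "\<And>t. t \<in> {\<alpha>..\<beta>} \<Longrightarrow> dist x (u t) < r / 2"
    and V: "\<And>t. t \<in> {\<alpha>..\<beta>} \<Longrightarrow> norm (velocity u t) \<le> V"
    and s: "s \<in> {\<alpha>..\<beta>}"
  shows "(velocity u has_vector_derivative accel G DG (u s) (velocity u s)) (at s within {\<alpha>..\<beta>})"
proof -
  note bcD = boundary_chartD[OF bc]
  obtain K where K: "K \<ge> 0" "\<And>y. y \<in> cball x r \<Longrightarrow> norm (G y) \<le> K"
      "\<And>y z. y \<in> cball x r \<Longrightarrow> z \<in> cball x r \<Longrightarrow> norm (G y - G z) \<le> K * dist y z"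
    using bcD(7) unfolding lip_bounded_def by blast
  obtain c where c: "c > 0" "\<And>y. y \<in> cball x r \<Longrightarrow> c \<le> norm (G y)"
    using bc unfolding boundary_chart_def by blast
  define W where "W = \<bar>V\<bar> + 1"
  have W: "W > 0" "\<And>t. t \<in> {\<alpha>..\<beta>} \<Longrightarrow> norm (velocity u t) \<le> W"
    using V unfolding W_def by (simp, fastforce)
  have inr: "u t \<in> cball x r" if "t \<in> {\<alpha>..\<beta>}" for t using near[OF that] bcD(1) by simp
  have inb: "u t \<in> ball x r" if "t \<in> {\<alpha>..\<beta>}" for t using near[OF that] bcD(1) by simp
  define v where "v = velocity u"
  define g where "g = G (u s)"
  have gc: "c \<le> norm g" unfolding g_def by (rule c(2)[OF inr[OF s]])
  then have g0: "g \<noteq> 0" using c(1) by auto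
  have tan: "v t \<bullet> G (u t) = 0" if "t \<in> {\<alpha>..\<beta>}" for t
    unfolding v_def using that ab inb contact
    by (intro minimizer_tangent_on_contact[OF min sb op _ _ bc]) auto
  have lip: "norm (u t - u s) \<le> W * \<bar>t - s\<bar>" if "t \<in> {\<alpha>..\<beta>}" for t
    by (rule minimizer_lipschitz[OF min sb op ab(1,3) W(2) that s])
  \<comment> \<open>tangency at both times removes one factor from the normal component\<close>
  have normal: "(v t - v s) \<bullet> g = v t \<bullet> (g - G (u t))" if "t \<in> {\<alpha>..\<beta>}" for t
    using tan[OF that] tan[OF s] by (simp add: inner_diff_left inner_diff_right g_def)
  have normal_le: "\<bar>(v t - v s) \<bullet> g\<bar> \<le> W * (K * W) * \<bar>t - s\<bar>" if t: "t \<in> {\<alpha>..\<beta>}" for t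
  proof -
    have "norm (g - G (u t)) \<le> K * dist (u s) (u t)"
      unfolding g_def by (rule K(3)[OF inr[OF s] inr[OF t]])
    also have "\<dots> \<le> K * (W * \<bar>t - s\<bar>)"
      using lip[OF t] K(1) by (intro mult_left_mono) (auto simp: dist_norm norm_minus_commute)
    finally have 1: "norm (g - G (u t)) \<le> K * (W * \<bar>t - s\<bar>)" .
    have "\<bar>v t \<bullet> (g - G (u t))\<bar> \<le> norm (v t) * norm (g - G (u t))" by (rule Cauchy_Schwarz_ineq2)
    also have "\<dots> \<le> W * (K * (W * \<bar>t - s\<bar>))"
      using 1 W(2)[OF t] W(1) by (intro mult_mono) (auto simp: v_def)
    finally show ?thesis unfolding normal[OF t] by (simp add: mult.assoc)
  qed
  define C where "C = 6 * K * W / c\<^sup>2"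
  have C0: "C \<ge> 0" using K W c by (simp add: C_def)
  \<comment> \<open>below this distance both smallness conditions of \<open>velocity_change_nearly_normal\<close> hold\<close>
  define d where "d = min (1 / (C * K + 1)) (r / (6 * W))"
  have d: "d > 0" using C0 K(1) W(1) bcD(1) by (auto simp: d_def add_nonneg_pos)
  define T where "T t = (v t - v s) - (((v t - v s) \<bullet> g) / (g \<bullet> g)) *\<^sub>R g" for t
  have tangential: "norm (T t) \<le> C * \<bar>t - s\<bar> * \<bar>(v t - v s) \<bullet> g\<bar>"
    if t: "t \<in> {\<alpha>..\<beta>}" "t \<noteq> s" "dist t s < d" for t
  proof -
    define a b where "a = min s t" and "b = max s t"
    have sub: "{a..b} \<subseteq> {\<alpha>..\<beta>}" using s t by (auto simp: a_def b_def)
    have ab': "0 < a" "a < b" "b < 1" using s t ab by (auto simp: a_def b_def)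
    have ba: "b - a = \<bar>t - s\<bar>" by (auto simp: a_def b_def)
    have lt: "\<bar>t - s\<bar> < 1 / (C * K + 1)" "\<bar>t - s\<bar> < r / (6 * W)"
      using t by (auto simp: d_def dist_real_def)
    have "C * (b - a) * K \<le> 1"
    proof -
      have "\<bar>t - s\<bar> * (C * K + 1) < 1" using lt(1) C0 K(1) by (simp add: pos_less_divide_eq add_nonneg_pos)
      then show ?thesis unfolding ba by (simp add: algebra_simps)
    qed
    moreover have "3 * W * (b - a) \<le> r / 2"
      using lt(2) W(1) unfolding ba by (simp add: field_simps)
    ultimately have "norm ((v b - v a) - (((v b - v a) \<bullet> g) / (g \<bullet> g)) *\<^sub>R g) \<le> C * (b - a) * \<bar>(v b - v a) \<bullet> g\<bar>"
      unfolding v_def g_def using sub s t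
      by (intro velocity_change_nearly_normal[OF min sb op bc ab' _ near[OF s] W(1) W(2) K c])
        (auto simp: C_def a_def b_def)
    moreover have "v b - v a = v t - v s \<or> v b - v a = - (v t - v s)"
      by (auto simp: a_def b_def min_def max_def)
    ultimately show ?thesis
    proof (elim disjE)
      assume "v b - v a = - (v t - v s)" and *: "norm ((v b - v a) - (((v b - v a) \<bullet> g) / (g \<bullet> g)) *\<^sub>R g) \<le> C * (b - a) * \<bar>(v b - v a) \<bullet> g\<bar>"
      then have "(v b - v a) - (((v b - v a) \<bullet> g) / (g \<bullet> g)) *\<^sub>R g = - T t"
      proof -
        have "(- X) - (((- X) \<bullet> g) / (g \<bullet> g)) *\<^sub>R g = - (X - ((X \<bullet> g) / (g \<bullet> g)) *\<^sub>R g)" for X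
          by simp
        then show ?thesis unfolding T_def \<open>v b - v a = - (v t - v s)\<close> .
      qed
      moreover have "\<bar>(v b - v a) \<bullet> g\<bar> = \<bar>(v t - v s) \<bullet> g\<bar>"
        unfolding \<open>v b - v a = - (v t - v s)\<close> inner_minus_left abs_minus_cancel ..
      ultimately show ?thesis using * by (simp add: ba)
    qed (simp add: T_def ba)
  qed
  let ?F = "at s within {\<alpha>..\<beta>}"
  have ev: "eventually (\<lambda>t. t \<in> {\<alpha>..\<beta>} \<and> t \<noteq> s \<and> dist t s < d) ?F"
    unfolding eventually_at using d by (intro exI[of _ d]) auto
  have lim0: "((\<lambda>t. M * \<bar>t - s\<bar>) \<longlongrightarrow> 0) ?F" for M
    by (rule tendsto_eq_intros refl | simp)+
  have T_quot: "((\<lambda>t. T t /\<^sub>R (t - s)) \<longlongrightarrow> 0) ?F"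
  proof (rule Lim_null_comparison[OF _ lim0])
    show "\<forall>\<^sub>F t in ?F. norm (T t /\<^sub>R (t - s)) \<le> (C * (W * (K * W))) * \<bar>t - s\<bar>"
      using ev
    proof eventually_elim
      case (elim t)
      have "norm (T t) \<le> C * \<bar>t - s\<bar> * \<bar>(v t - v s) \<bullet> g\<bar>" using tangential elim by blast
      also have "\<dots> \<le> C * \<bar>t - s\<bar> * (W * (K * W) * \<bar>t - s\<bar>)"
        using normal_le[of t] elim C0 by (intro mult_left_mono) auto
      finally show ?case using elim by (simp add: field_simps)
    qed
  qed
  have v_cont: "(v \<longlongrightarrow> v s) ?F"
  proof -
    have "((\<lambda>t. v t - v s) \<longlongrightarrow> 0) ?F"
    proof (rule Lim_null_comparison)
      have nT: "norm (v t - v s) \<le> norm (T t) + \<bar>(v t - v s) \<bullet> g\<bar> / norm g" for t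
      proof -
        have "v t - v s = T t + (((v t - v s) \<bullet> g) / (g \<bullet> g)) *\<^sub>R g" by (simp add: T_def)
        then have "norm (v t - v s) \<le> norm (T t) + norm ((((v t - v s) \<bullet> g) / (g \<bullet> g)) *\<^sub>R g)"
          by (metis norm_triangle_ineq)
        also have "norm ((((v t - v s) \<bullet> g) / (g \<bullet> g)) *\<^sub>R g) = \<bar>(v t - v s) \<bullet> g\<bar> / norm g"
          using g0 by (simp add: power2_norm_eq_inner[symmetric] power2_eq_square)
        finally show ?thesis .
      qed
      show "\<forall>\<^sub>F t in ?F. norm (v t - v s) \<le> (C * d + 1 / norm g) * (W * (K * W)) * \<bar>t - s\<bar>"
        using ev
      proof eventually_elim
        case (elim t)
        have "norm (T t) \<le> C * \<bar>t - s\<bar> * \<bar>(v t - v s) \<bullet> g\<bar>" using tangential elim by blast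
        also have "\<dots> \<le> C * d * \<bar>(v t - v s) \<bullet> g\<bar>"
          using elim C0 by (intro mult_right_mono mult_left_mono) (auto simp: dist_real_def)
        finally have "norm (v t - v s) \<le> (C * d + 1 / norm g) * \<bar>(v t - v s) \<bullet> g\<bar>"
          using nT[of t] by (simp add: algebra_simps)
        also have "\<dots> \<le> (C * d + 1 / norm g) * (W * (K * W) * \<bar>t - s\<bar>)"
          using normal_le[of t] elim C0 d by (intro mult_left_mono) auto
        finally show ?case by (simp add: mult.assoc)
      qed
    qed (rule lim0)
    then show ?thesis by (simp add: LIM_zero_iff)
  qed
  have "((\<lambda>t. (G (u t) - g) /\<^sub>R (t - s)) \<longlongrightarrow> DG (u s) (v s)) ?F"
  proof -
    have "(u has_vector_derivative v s) ?F"
      unfolding v_def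
      by (rule has_vector_derivative_at_within[OF minimizer_differentiable[OF min sb op]])
        (use s ab in auto)
    then have "((\<lambda>t. G (u t)) has_derivative (\<lambda>h. DG (u s) (h *\<^sub>R v s))) ?F"
      using bcD(3)[OF inr[OF s]] unfolding has_vector_derivative_def by (rule has_derivative_compose)
    moreover have "linear (DG (u s))" using bcD(3)[OF inr[OF s]] has_derivative_linear by blast
    ultimately have "((\<lambda>t. G (u t)) has_vector_derivative DG (u s) (v s)) ?F"
      unfolding has_vector_derivative_def by (simp add: linear_scale)
    then show ?thesis unfolding has_vector_derivative_iff_quotient g_def .
  qed
  then have q: "((\<lambda>t. - (v t \<bullet> ((G (u t) - g) /\<^sub>R (t - s)))) \<longlongrightarrow> - (v s \<bullet> DG (u s) (v s))) ?F"
    by (intro tendsto_minus tendsto_inner v_cont)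
  have "((\<lambda>t. T t /\<^sub>R (t - s) + (- (v t \<bullet> ((G (u t) - g) /\<^sub>R (t - s))) / (g \<bullet> g)) *\<^sub>R g)
      \<longlongrightarrow> 0 + (- (v s \<bullet> DG (u s) (v s)) / (g \<bullet> g)) *\<^sub>R g) ?F"
    using g0 by (intro tendsto_add T_quot tendsto_scaleR tendsto_divide q tendsto_const) auto
  then have "((\<lambda>t. (v t - v s) /\<^sub>R (t - s)) \<longlongrightarrow> 0 + (- (v s \<bullet> DG (u s) (v s)) / (g \<bullet> g)) *\<^sub>R g) ?F"
  proof (rule Lim_transform_eventually)
    show "\<forall>\<^sub>F t in ?F. T t /\<^sub>R (t - s) + (- (v t \<bullet> ((G (u t) - g) /\<^sub>R (t - s))) / (g \<bullet> g)) *\<^sub>R g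
        = (v t - v s) /\<^sub>R (t - s)"
      using ev
    proof eventually_elim
      case (elim t)
      have "- (v t \<bullet> ((G (u t) - g) /\<^sub>R (t - s))) = ((v t - v s) \<bullet> g) / (t - s)"
      proof -
        have "v t \<bullet> (G (u t) - g) = - ((v t - v s) \<bullet> g)"
          using normal[of t] elim by (simp add: inner_diff_right)
        then show ?thesis unfolding inner_scaleR_right by (simp add: divide_inverse mult.commute)
      qed
      then show ?case by (simp add: T_def scaleR_diff_right divide_inverse mult.commute mult.left_commute)
    qed
  qed
  then show ?thesis
    unfolding has_vector_derivative_iff_quotient accel_def g_def
    by (simp add: divide_inverse v_def)
qed

section \<open>Minimizers do not branch\<close>

text \<open>
  The quantity \<open>h = |x|\<^sup>2 + |y|\<^sup>2\<close> satisfies \<open>h' \<ge> - C h\<close>, so \<open>h t * exp (C t)\<close> is nondecreasing; it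
  vanishes at \<open>T\<close>.
\<close>
lemma gronwall_backward:
  fixes x y z :: "real \<Rightarrow> 'a::real_inner"
  assumes cont: "continuous_on {\<alpha>..T} x" "continuous_on {\<alpha>..T} y"
    and dx: "\<And>t. \<alpha> < t \<Longrightarrow> t < T \<Longrightarrow> (x has_vector_derivative y t) (at t)"
    and dy: "\<And>t. \<alpha> < t \<Longrightarrow> t < T \<Longrightarrow> (y has_vector_derivative z t) (at t)"
    and le: "\<And>t. \<alpha> < t \<Longrightarrow> t < T \<Longrightarrow> norm (z t) \<le> K * (norm (x t) + norm (y t))"
    and K: "K \<ge> 0" and T0: "x T = 0" "y T = 0" and t: "t \<in> {\<alpha>..T}"
  shows "x t = 0"
proof -
  define C where "C = 1 + 3 * K"
  define h where "h t = x t \<bullet> x t + y t \<bullet> y t" for t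
  have "h t * exp (C * t) \<le> h T * exp (C * T)"
  proof (rule DERIV_nonneg_imp_increasing_open[of t T "\<lambda>t. h t * exp (C * t)"])
    fix s assume "t < s" "s < T"
    then have s: "\<alpha> < s" "s < T" using t by auto
    have "(h has_derivative (\<lambda>a. a * (2 * (x s \<bullet> y s) + 2 * (y s \<bullet> z s)))) (at s)"
      using dx[OF s] dy[OF s] unfolding h_def has_vector_derivative_def
      by (auto intro!: derivative_eq_intros simp: inner_commute algebra_simps)
    then have "(h has_real_derivative (2 * (x s \<bullet> y s) + 2 * (y s \<bullet> z s))) (at s)"
      by (simp add: has_field_derivative_def mult_commute_abs)
    then have D: "((\<lambda>t. h t * exp (C * t)) has_real_derivative
        (2 * (x s \<bullet> y s) + 2 * (y s \<bullet> z s) + C * h s) * exp (C * s)) (at s)"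
      by (auto intro!: derivative_eq_intros simp: algebra_simps)
    have hs: "h s = (norm (x s))\<^sup>2 + (norm (y s))\<^sup>2" by (simp add: h_def power2_norm_eq_inner)
    have xy: "2 * (norm (x s) * norm (y s)) \<le> h s"
      using zero_le_power2[of "norm (x s) - norm (y s)"] unfolding hs by (simp add: power2_eq_square algebra_simps)
    have "\<bar>x s \<bullet> y s\<bar> \<le> norm (x s) * norm (y s)" by (rule Cauchy_Schwarz_ineq2)
    then have 1: "- (2 * (x s \<bullet> y s)) \<le> h s" using xy by linarith
    have "\<bar>y s \<bullet> z s\<bar> \<le> norm (y s) * norm (z s)" by (rule Cauchy_Schwarz_ineq2)
    also have "\<dots> \<le> norm (y s) * (K * (norm (x s) + norm (y s)))"
      by (intro mult_left_mono le[OF s]) simp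
    finally have "2 * \<bar>y s \<bullet> z s\<bar> \<le> K * (2 * (norm (x s) * norm (y s)) + 2 * (norm (y s))\<^sup>2)"
      by (simp add: power2_eq_square algebra_simps)
    also have "\<dots> \<le> K * (h s + 2 * h s)"
      using xy K by (intro mult_left_mono add_mono) (auto simp: hs)
    finally have 2: "- (2 * (y s \<bullet> z s)) \<le> 3 * K * h s" by (simp add: abs_le_iff algebra_simps)
    have "0 \<le> 2 * (x s \<bullet> y s) + 2 * (y s \<bullet> z s) + C * h s"
      using 1 2 unfolding C_def by (simp add: algebra_simps)
    with D show "\<exists>y. ((\<lambda>t. h t * exp (C * t)) has_real_derivative y) (at s) \<and> 0 \<le> y" by fastforce
  next
    show "continuous_on {t..T} (\<lambda>t. h t * exp (C * t))"
      unfolding h_def using t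
      by (intro continuous_intros continuous_on_subset[OF cont(1)] continuous_on_subset[OF cont(2)]) auto
  qed (use t in auto)
  then have "h t \<le> 0" using T0 by (simp add: h_def mult_le_0_iff not_le[symmetric])
  moreover have "h t \<ge> x t \<bullet> x t" by (simp add: h_def)
  ultimately show ?thesis by (metis inner_ge_zero inner_eq_zero_iff order_antisym order_trans)
qed

lemma contact_curves_agree_backward:
  fixes u w :: "real \<Rightarrow> 'a::euclidean_space"
  assumes minu: "is_minimizer \<Omega> p q u" and minw: "is_minimizer \<Omega> p q w"
    and sb: "smooth_boundary \<Omega>" and op: "open \<Omega>" and T: "0 < T" "T < 1"
    and eq: "u T = w T" "velocity u T = velocity w T" and \<delta>: "\<delta> > 0"
    and cu: "\<And>t. t \<in> {T - \<delta>..T} \<Longrightarrow> u t \<in> frontier \<Omega>"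
    and cw: "\<And>t. t \<in> {T - \<delta>..T} \<Longrightarrow> w t \<in> frontier \<Omega>"
  obtains \<eta> where "\<eta> > 0" "\<eta> < T" "\<And>t. t \<in> {T - \<eta>..T} \<Longrightarrow> u t = w t"
proof -
  have fr: "u T \<in> frontier \<Omega>" using cu[of T] \<delta> by simp
  obtain r \<rho> G DG where bc: "boundary_chart \<Omega> (u T) r \<rho> G DG"
    using smooth_boundary_chart[OF sb fr] by metis
  have bcw: "boundary_chart \<Omega> (w T) r \<rho> G DG" using bc eq by simp
  have r: "r > 0" "r / 2 > 0" using boundary_chartD(1)[OF bc] by auto
  obtain d1 V1 where d1: "d1 > 0" "0 < T - d1" "T + d1 < 1"
    "\<And>t. t \<in> {T - d1..T + d1} \<Longrightarrow> norm (velocity u t) \<le> V1"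
    using minimizer_velocity_bounded[OF minu sb op T bc] by metis
  obtain d2 V2 where d2: "d2 > 0" "0 < T - d2" "T + d2 < 1"
    "\<And>t. t \<in> {T - d2..T + d2} \<Longrightarrow> norm (velocity w t) \<le> V2"
    using minimizer_velocity_bounded[OF minw sb op T bcw] by metis
  obtain d3 where d3: "d3 > 0" "\<And>t. t \<in> {T - d3..T + d3} \<Longrightarrow> u t \<in> ball (u T) (r / 2)"
    using continuous_interior_nbhd[OF minimizer_continuous[OF minu] T r(2)] by metis
  obtain d4 where d4: "d4 > 0" "\<And>t. t \<in> {T - d4..T + d4} \<Longrightarrow> w t \<in> ball (w T) (r / 2)"
    using continuous_interior_nbhd[OF minimizer_continuous[OF minw] T r(2)] by metis
  define \<eta> where "\<eta> = Min {\<delta>, d1, d2, d3, d4}"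
  have \<eta>: "\<eta> > 0" "\<eta> \<le> \<delta>" "\<eta> \<le> d1" "\<eta> \<le> d2" "\<eta> \<le> d3" "\<eta> \<le> d4"
    using \<delta> d1(1) d2(1) d3(1) d4(1) by (auto simp: \<eta>_def)
  define \<alpha> where "\<alpha> = T - \<eta>"
  have \<alpha>: "0 < \<alpha>" "\<alpha> < T" using \<eta> d1 by (auto simp: \<alpha>_def)
  define V where "V = max V1 V2"
  have in_u: "u t \<in> frontier \<Omega>" "dist (u T) (u t) < r / 2" "norm (velocity u t) \<le> V" if "t \<in> {\<alpha>..T}" for t
    using cu[of t] d3(2)[of t] d1(4)[of t] that \<eta> d1(1) d3(1) by (auto simp: \<alpha>_def V_def)
  have in_w: "w t \<in> frontier \<Omega>" "dist (u T) (w t) < r / 2" "norm (velocity w t) \<le> V" if "t \<in> {\<alpha>..T}" for t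
    using cw[of t] d4(2)[of t] d2(4)[of t] that \<eta> d2(1) d4(1) eq by (auto simp: \<alpha>_def V_def)
  have acc_u: "(velocity u has_vector_derivative accel G DG (u t) (velocity u t)) (at t within {\<alpha>..T})"
    if "t \<in> {\<alpha>..T}" for t
    by (rule minimizer_acceleration_on_contact[OF minu sb op bc \<alpha> T(2) in_u that])
  have acc_w: "(velocity w has_vector_derivative accel G DG (w t) (velocity w t)) (at t within {\<alpha>..T})"
    if "t \<in> {\<alpha>..T}" for t
    by (rule minimizer_acceleration_on_contact[OF minw sb op bc \<alpha> T(2) in_w that])
  have at_int: "at t within {\<alpha>..T} = at t" if "\<alpha> < t" "t < T" for t
    using that by (intro at_within_interior) simp
  have vel: "(u has_vector_derivative velocity u t) (at t)" "(w has_vector_derivative velocity w t) (at t)"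
    if "t \<in> {\<alpha>..T}" for t
    using minimizer_differentiable[OF minu sb op, of t] minimizer_differentiable[OF minw sb op, of t] that \<alpha> T by auto
  obtain K where K: "K \<ge> 0" "\<And>y z. y \<in> cball (u T) r \<times> cball 0 V \<Longrightarrow> z \<in> cball (u T) r \<times> cball 0 V \<Longrightarrow>
      norm (accel G DG (fst y) (snd y) - accel G DG (fst z) (snd z)) \<le> K * dist y z"
    using boundary_chartD(8)[OF bc, of V] unfolding lip_bounded_def by blast
  have eq_on: "u t - w t = 0" if t: "t \<in> {\<alpha>..T}" for t
  proof (rule gronwall_backward[where x = "\<lambda>t. u t - w t" and y = "\<lambda>t. velocity u t - velocity w t" and K = K
        and z = "\<lambda>t. accel G DG (u t) (velocity u t) - accel G DG (w t) (velocity w t)", OF _ _ _ _ _ K(1) _ _ t])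
    have "continuous_on {\<alpha>..T} u" "continuous_on {\<alpha>..T} w"
      using \<alpha> T by (auto intro!: continuous_on_subset[OF minimizer_continuous[OF minu]]
          continuous_on_subset[OF minimizer_continuous[OF minw]])
    then show "continuous_on {\<alpha>..T} (\<lambda>t. u t - w t)" by (intro continuous_intros)
    have "continuous_on {\<alpha>..T} (velocity u)" "continuous_on {\<alpha>..T} (velocity w)"
      unfolding continuous_on_eq_continuous_within
      using acc_u acc_w has_vector_derivative_continuous by blast+
    then show "continuous_on {\<alpha>..T} (\<lambda>t. velocity u t - velocity w t)" by (intro continuous_intros)
    fix t assume t: "\<alpha> < t" "t < T"
    then have t': "t \<in> {\<alpha>..T}" by simp
    show "((\<lambda>t. u t - w t) has_vector_derivative velocity u t - velocity w t) (at t)"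
      by (intro has_vector_derivative_diff vel[OF t'])
    show "((\<lambda>t. velocity u t - velocity w t) has_vector_derivative
        accel G DG (u t) (velocity u t) - accel G DG (w t) (velocity w t)) (at t)"
      using acc_u[OF t'] acc_w[OF t'] unfolding at_int[OF t] by (rule has_vector_derivative_diff)
    have "norm (accel G DG (u t) (velocity u t) - accel G DG (w t) (velocity w t))
        \<le> K * dist (u t, velocity u t) (w t, velocity w t)"
      using K(2)[of "(u t, velocity u t)" "(w t, velocity w t)"] in_u[OF t'] in_w[OF t'] r by simp
    also have "\<dots> \<le> K * (norm (u t - w t) + norm (velocity u t - velocity w t))"
      using K(1) sqrt_sum_squares_le_sum[of "dist (u t) (w t)" "dist (velocity u t) (velocity w t)"]
      by (intro mult_left_mono) (auto simp: dist_norm norm_Pair)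
    finally show "norm (accel G DG (u t) (velocity u t) - accel G DG (w t) (velocity w t))
        \<le> K * (norm (u t - w t) + norm (velocity u t - velocity w t))" .
  qed (use eq in auto)
  show ?thesis
  proof (rule that[of \<eta>])
    show "\<eta> < T" using \<alpha> by (simp add: \<alpha>_def)
    show "u t = w t" if "t \<in> {T - \<eta>..T}" for t using eq_on[of t] that by (simp add: \<alpha>_def)
  qed (rule \<eta>(1))
qed

text \<open>
  The segment between the end points may meet the obstacle, so the comparison with it is not
  available; but the velocity is locally constant.
\<close>
lemma minimizer_affine_off_obstacle:
  fixes u :: "real \<Rightarrow> 'a::euclidean_space"
  assumes min: "is_minimizer \<Omega> p q u" and ab: "0 \<le> a" "a < b" "b \<le> 1"
    and off: "\<And>t. a < t \<Longrightarrow> t < b \<Longrightarrow> u t \<notin> closure \<Omega>" and t: "t \<in> {a..b}"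
  shows "u t = u a + ((t - a) / (b - a)) *\<^sub>R (u b - u a)"
proof -
  have loc: "\<exists>\<delta>>0. \<exists>w. \<forall>s\<in>{\<tau> - \<delta><..<\<tau> + \<delta>}. (u has_vector_derivative w) (at s)" if "\<tau> \<in> {a<..<b}" for \<tau>
    using minimizer_straight_off_obstacle[OF min, of \<tau>] off[of \<tau>] that ab by (metis greaterThanLessThan_iff le_less_trans less_le_trans)
  have zero: "(velocity u has_vector_derivative 0) (at \<tau> within {a<..<b})"
    and diff: "(u has_vector_derivative velocity u \<tau>) (at \<tau> within {a<..<b})" if \<tau>: "\<tau> \<in> {a<..<b}" for \<tau>
  proof -
    obtain \<delta> w where \<delta>: "\<delta> > 0" and w: "\<And>s. s \<in> {\<tau> - \<delta><..<\<tau> + \<delta>} \<Longrightarrow> (u has_vector_derivative w) (at s)"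
      using loc[OF \<tau>] by blast
    have ve: "velocity u s = w" if "s \<in> {\<tau> - \<delta><..<\<tau> + \<delta>}" for s
      using w[OF that] by (rule vector_derivative_at)
    have "(velocity u has_vector_derivative 0) (at \<tau>)"
      by (rule has_vector_derivative_transform_within_open[where f = "\<lambda>_. w" and S = "{\<tau> - \<delta><..<\<tau> + \<delta>}"])
        (use ve \<delta> in auto)
    then show "(velocity u has_vector_derivative 0) (at \<tau> within {a<..<b})"
      by (rule has_vector_derivative_at_within)
    have "(u has_vector_derivative velocity u \<tau>) (at \<tau>)" using w[of \<tau>] ve[of \<tau>] \<delta> by simp
    then show "(u has_vector_derivative velocity u \<tau>) (at \<tau> within {a<..<b})"
      by (rule has_vector_derivative_at_within)
  qed
  obtain c where c: "\<And>\<tau>. \<tau> \<in> {a<..<b} \<Longrightarrow> velocity u \<tau> = c"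
    using has_vector_derivative_zero_constant[of "{a<..<b}" "velocity u"] zero by auto
  have "((\<lambda>\<tau>. u \<tau> - \<tau> *\<^sub>R c) has_vector_derivative 0) (at \<tau> within {a<..<b})" if \<tau>: "\<tau> \<in> {a<..<b}" for \<tau>
    using diff[OF \<tau>] unfolding c[OF \<tau>] by (auto intro!: derivative_eq_intros)
  then obtain k where k: "\<And>\<tau>. \<tau> \<in> {a<..<b} \<Longrightarrow> u \<tau> - \<tau> *\<^sub>R c = k"
    using has_vector_derivative_zero_constant[of "{a<..<b}" "\<lambda>\<tau>. u \<tau> - \<tau> *\<^sub>R c"] by auto
  have all: "u \<tau> - \<tau> *\<^sub>R c = k" if "\<tau> \<in> {a..b}" for \<tau>
  proof (rule continuous_constant_on_closure[of "{a<..<b}" "\<lambda>\<tau>. u \<tau> - \<tau> *\<^sub>R c"])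
    have "continuous_on {a..b} u"
      using ab by (intro continuous_on_subset[OF minimizer_continuous[OF min]]) auto
    then show "continuous_on (closure {a<..<b}) (\<lambda>\<tau>. u \<tau> - \<tau> *\<^sub>R c)"
      using ab by (auto intro!: continuous_intros)
    show "\<tau> \<in> closure {a<..<b}" using that ab by simp
  qed (rule k)
  have ua: "u a = k + a *\<^sub>R c" and ub: "u b = k + b *\<^sub>R c" and ut: "u t = k + t *\<^sub>R c"
    using all[of a] all[of b] all[OF t] ab by (simp_all add: algebra_simps)
  have "u b - u a = (b - a) *\<^sub>R c" by (simp add: ua ub algebra_simps)
  then have "((t - a) / (b - a)) *\<^sub>R (u b - u a) = (t - a) *\<^sub>R c" using ab by simp
  then show ?thesis by (simp add: ua ut algebra_simps)
qed

text \<open>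
  Otherwise \<open>t0\<close> lies strictly between two consecutive contact times, between which the curve is
  straight; by convexity this segment lies in the closed obstacle.
\<close>
lemma no_contact_before_free_time:
  fixes u :: "real \<Rightarrow> 'a::euclidean_space"
  assumes min: "is_minimizer \<Omega> p q u" and cv: "convex \<Omega>"
    and T: "T \<le> 1" "u T \<in> closure \<Omega>" and t0: "0 \<le> t0" "t0 < T" "u t0 \<notin> closure \<Omega>"
    and t: "t \<in> {0..t0}"
  shows "u t \<notin> closure \<Omega>"
proof
  assume ut: "u t \<in> closure \<Omega>"
  define A where "A = {\<tau> \<in> {t..t0}. u \<tau> \<in> closure \<Omega>}"
  define B where "B = {\<tau> \<in> {t0..T}. u \<tau> \<in> closure \<Omega>}"
  have cont: "continuous_on {t..t0} u" "continuous_on {t0..T} u"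
    using t t0 T by (auto intro!: continuous_on_subset[OF minimizer_continuous[OF min]])
  have "{t..t0} \<inter> u -` closure \<Omega> = A" "{t0..T} \<inter> u -` closure \<Omega> = B"
    by (auto simp: A_def B_def)
  then have "closed A" "closed B"
    using continuous_closed_preimage[OF cont(1), of "closure \<Omega>"]
      continuous_closed_preimage[OF cont(2), of "closure \<Omega>"] by simp_all
  moreover have "A \<subseteq> {t..t0}" "B \<subseteq> {t0..T}" by (auto simp: A_def B_def)
  then have "bounded A" "bounded B" by (auto intro: bounded_subset[OF bounded_closed_interval])
  ultimately have "compact A" "compact B" by (simp_all add: compact_eq_bounded_closed)
  moreover have "t \<in> A" "T \<in> B" using ut T t t0 by (auto simp: A_def B_def)
  ultimately obtain a b where a: "a \<in> A" "\<And>\<tau>. \<tau> \<in> A \<Longrightarrow> \<tau> \<le> a" and b: "b \<in> B" "\<And>\<tau>. \<tau> \<in> B \<Longrightarrow> b \<le> \<tau>"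
    using compact_attains_sup[of A] compact_attains_inf[of B] by (metis empty_iff)
  have ne: "a \<noteq> t0" "b \<noteq> t0" using a(1) b(1) t0 by (auto simp: A_def B_def)
  have ab: "0 \<le> a" "a < t0" "t0 < b" "b \<le> 1" using a(1) b(1) ne t T by (auto simp: A_def B_def)
  have off: "u \<tau> \<notin> closure \<Omega>" if "a < \<tau>" "\<tau> < b" for \<tau>
  proof
    assume "u \<tau> \<in> closure \<Omega>"
    then have "\<tau> \<in> A \<or> \<tau> \<in> B" using that a(1) b(1) by (auto simp: A_def B_def)
    then show False using a(2) b(2) that by fastforce
  qed
  have "u t0 = u a + ((t0 - a) / (b - a)) *\<^sub>R (u b - u a)"
    by (rule minimizer_affine_off_obstacle[OF min _ _ _ off]) (use ab in auto)
  also have "\<dots> = (1 - (t0 - a) / (b - a)) *\<^sub>R u a + ((t0 - a) / (b - a)) *\<^sub>R u b"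
    by (simp add: algebra_simps)
  also have "\<dots> \<in> closure \<Omega>"
    using a(1) b(1) ab by (intro convexD convex_closure cv) (auto simp: A_def B_def)
  finally show False using t0 by blast
qed

text \<open>The first curve is a segment up to \<open>T\<close>, which shows that the segment avoids the obstacle.\<close>
lemma straight_start_unique:
  fixes u w :: "real \<Rightarrow> 'a::euclidean_space"
  assumes minu: "is_minimizer \<Omega> p q u" and minw: "is_minimizer \<Omega> p q w"
    and T: "0 < T" "T \<le> 1" and off: "\<And>t. 0 \<le> t \<Longrightarrow> t < T \<Longrightarrow> u t \<notin> closure \<Omega>"
    and eq: "u T = w T" and t: "t \<in> {0..T}"
  shows "u t = w t"
proof -
  have aff: "u s = u 0 + ((s - 0) / (T - 0)) *\<^sub>R (u T - u 0)" if "s \<in> {0..T}" for s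
    using T off that by (intro minimizer_affine_off_obstacle[OF minu]) auto
  have "closed_segment (u 0) (u T) \<inter> \<Omega> = {}"
  proof (rule ccontr)
    assume "closed_segment (u 0) (u T) \<inter> \<Omega> \<noteq> {}"
    then obtain z l where z: "z \<in> \<Omega>" "z = (1 - l) *\<^sub>R u 0 + l *\<^sub>R u T" "0 \<le> l" "l \<le> 1"
      by (auto simp: closed_segment_def)
    have lT: "l * T \<in> {0..T}" using z T by (auto simp: mult_left_le_one_le)
    have "u (l * T) = u 0 + l *\<^sub>R (u T - u 0)" using aff[OF lT] T by simp
    also have "\<dots> = z" by (simp add: z(2) algebra_simps)
    finally have "u (l * T) = z" .
    moreover have "l * T \<in> {0..1}" using lT T unfolding atLeastAtMost_iff by linarith
    then have "u (l * T) \<notin> \<Omega>" by (rule minimizer_outside[OF minu])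
    ultimately show False using z by simp
  qed
  moreover have "w 0 = u 0" using minu minw by (simp add: is_minimizer_iff admissible_iff)
  ultimately have "w t = w 0 + ((t - 0) / (T - 0)) *\<^sub>R (w T - w 0)"
    using T t eq by (intro minimizer_affine[OF minw]) auto
  then show ?thesis using aff[OF t] eq \<open>w 0 = u 0\<close> by simp
qed

text \<open>
  Here \<open>T\<close> is the earliest time from which on the two curves agree. At a contact, each curve either
  touches the boundary throughout a short interval before \<open>T\<close> or is free on all of \<open>[0,T)\<close>.
\<close>
lemma minimizers_do_not_branch:
  fixes u w :: "real \<Rightarrow> 'a::euclidean_space"
  assumes minu: "is_minimizer \<Omega> p q u" and minw: "is_minimizer \<Omega> p q w"
    and sb: "smooth_boundary \<Omega>" and op: "open \<Omega>" and cv: "convex \<Omega>"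
    and s: "s < 1" and eq: "\<And>t. t \<in> {s..1} \<Longrightarrow> u t = w t" and t: "t \<in> {0..1}"
  shows "u t = w t"
proof -
  note cu = minimizer_continuous[OF minu] and cw = minimizer_continuous[OF minw]
  define Z where "Z = {\<tau> \<in> {0..1}. \<forall>r\<in>{\<tau>..1}. u r = w r}"
  define T where "T = Inf Z"
  have Zs: "max 0 s \<in> Z" using s eq by (auto simp: Z_def)
  have bdd: "bdd_below Z" by (auto simp: Z_def intro!: bdd_belowI[of _ 0])
  have T_le: "T \<le> \<tau>" if "\<tau> \<in> Z" for \<tau> unfolding T_def using that bdd by (rule cInf_lower)
  have T: "0 \<le> T" "T < 1"
  proof -
    show "0 \<le> T" unfolding T_def using Zs by (intro cInf_greatest) (auto simp: Z_def)
    show "T < 1" using T_le[OF Zs] s by simp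
  qed
  have after: "u r = w r" if r: "T < r" "r \<le> 1" for r
  proof -
    obtain \<tau> where "\<tau> \<in> Z" "\<tau> < r"
      using cInf_lessD[of Z r] r(1) Zs unfolding T_def by blast
    then show ?thesis using r by (auto simp: Z_def)
  qed
  have eqT: "u T = w T"
  proof -
    have "u T - w T = 0"
    proof (rule continuous_constant_on_closure[of "{T<..<1}" "\<lambda>r. u r - w r"])
      have "continuous_on {T..1} u" "continuous_on {T..1} w"
        using T by (auto intro!: continuous_on_subset[OF cu] continuous_on_subset[OF cw])
      then show "continuous_on (closure {T<..<1}) (\<lambda>r. u r - w r)"
        using T by (auto intro!: continuous_intros)
    qed (use T after in auto)
    then show ?thesis by simp
  qed
  then have on: "u r = w r" if "T \<le> r" "r \<le> 1" for r
    using after[of r] that by (cases "r = T") auto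
  have "T = 0"
  proof (rule ccontr)
    assume "T \<noteq> 0"
    then have T0: "0 < T" using T by simp
    have min_contra: False if "\<eta> > 0" "\<eta> \<le> T" "\<And>r. r \<in> {T - \<eta>..T} \<Longrightarrow> u r = w r" for \<eta>
    proof -
      have "T - \<eta> \<in> Z" unfolding Z_def using that T on by (auto, metis linear)
      then show False using T_le that by fastforce
    qed
    note du = minimizer_differentiable[OF minu sb op T0 T(2)] and dw = minimizer_differentiable[OF minw sb op T0 T(2)]
    have veq: "velocity u T = velocity w T"
    proof -
      have "at T within {T..1} \<noteq> bot" using T by (simp add: trivial_limit_within islimpt_Icc)
      moreover have "(u has_vector_derivative velocity u T) (at T within {T..1})"
        using du by (rule has_vector_derivative_at_within)
      moreover have "(u has_vector_derivative velocity w T) (at T within {T..1})"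
        by (rule has_vector_derivative_transform[where f = w])
          (use T on dw in \<open>auto intro: has_vector_derivative_at_within\<close>)
      ultimately show ?thesis by (rule vector_derivative_unique_within)
    qed
    show False
    proof (cases "u T \<in> closure \<Omega>")
      case False
      obtain d1 a where d1: "d1 > 0" "0 < T - d1" "\<And>r. r \<in> {T - d1<..<T + d1} \<Longrightarrow> (u has_vector_derivative a) (at r)"
        using minimizer_straight_off_obstacle[OF minu T0 T(2) False] by metis
      obtain d2 b where d2: "d2 > 0" "\<And>r. r \<in> {T - d2<..<T + d2} \<Longrightarrow> (w has_vector_derivative b) (at r)"
        using minimizer_straight_off_obstacle[OF minw T0 T(2)] False eqT by metis
      have "a = b" using d1(3)[of T] d2(2)[of T] d1(1) d2(1) veq by (simp add: vector_derivative_at)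
      define d where "d = min d1 d2"
      have d: "d > 0" "d \<le> d1" "d \<le> d2" using d1 d2 by (auto simp: d_def)
      have "((\<lambda>r. u r - w r) has_vector_derivative 0) (at r within {T - d<..<T + d})" if "r \<in> {T - d<..<T + d}" for r
      proof (rule has_vector_derivative_at_within)
        show "((\<lambda>r. u r - w r) has_vector_derivative 0) (at r)"
          using has_vector_derivative_diff[OF d1(3)[of r] d2(2)[of r]] that d \<open>a = b\<close> by auto
      qed
      then obtain k where k: "\<And>r. r \<in> {T - d<..<T + d} \<Longrightarrow> u r - w r = k"
        using has_vector_derivative_zero_constant[of "{T - d<..<T + d}" "\<lambda>r. u r - w r"] by auto
      have "k = 0" using k[of T] d eqT by simp
      show False
      proof (rule min_contra[of "d / 2"])
        show "u r = w r" if "r \<in> {T - d / 2..T}" for r using k[of r] that d \<open>k = 0\<close> by simp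
      qed (use d d1 in auto)
    next
      case True
      have frontier_iff: "x \<in> frontier \<Omega> \<longleftrightarrow> x \<in> closure \<Omega> \<and> x \<notin> \<Omega>" for x
        using op by (auto simp: frontier_def interior_open)
      have dichotomy: "(\<exists>\<delta>>0. \<delta> \<le> T \<and> (\<forall>r\<in>{T - \<delta>..T}. y r \<in> frontier \<Omega>)) \<or> (\<forall>r. 0 \<le> r \<and> r < T \<longrightarrow> y r \<notin> closure \<Omega>)"
        if miny: "is_minimizer \<Omega> p q y" and yT: "y T \<in> closure \<Omega>" for y
      proof (rule ccontr)
        assume neg: "\<not> ?thesis"
        then obtain r where r: "0 \<le> r" "r < T" "y r \<in> closure \<Omega>" by blast
        have "T - r > 0" "T - r \<le> T" using r by auto
        then have "\<not> (\<forall>r\<in>{T - (T - r)..T}. y r \<in> frontier \<Omega>)" using neg by blast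
        then obtain r' where r': "r' \<in> {r..T}" "y r' \<notin> frontier \<Omega>" by auto
        have "y r' \<notin> \<Omega>" using r' r T by (intro minimizer_outside[OF miny]) auto
        then have "y r' \<notin> closure \<Omega>" using r' frontier_iff by blast
        moreover from this have "r' < T" using r' yT by (cases "r' = T") auto
        ultimately show False
          using no_contact_before_free_time[OF miny cv _ yT, of r' r] r r' T by auto
      qed
      have wT: "w T \<in> closure \<Omega>" using True eqT by simp
      consider "\<forall>r. 0 \<le> r \<and> r < T \<longrightarrow> u r \<notin> closure \<Omega>" | "\<forall>r. 0 \<le> r \<and> r < T \<longrightarrow> w r \<notin> closure \<Omega>"
        | \<delta>1 \<delta>2 where "\<delta>1 > 0" "\<forall>r\<in>{T - \<delta>1..T}. u r \<in> frontier \<Omega>" "\<delta>2 > 0" "\<forall>r\<in>{T - \<delta>2..T}. w r \<in> frontier \<Omega>"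
        using dichotomy[OF minu True] dichotomy[OF minw wT] by blast
      then show False
      proof cases
        case 1
        then have "u r = w r" if "r \<in> {0..T}" for r
          using straight_start_unique[OF minu minw T0 _ _ eqT that] T by auto
        then show False using min_contra[of T] T0 by simp
      next
        case 2
        then have "w r = u r" if "r \<in> {0..T}" for r
          using straight_start_unique[OF minw minu T0 _ _ eqT[symmetric] that] T by auto
        then show False using min_contra[of T] T0 by simp
      next
        case 3
        obtain \<eta> where "\<eta> > 0" "\<eta> < T" "\<And>r. r \<in> {T - \<eta>..T} \<Longrightarrow> u r = w r"
          by (rule contact_curves_agree_backward[OF minu minw sb op T0 T(2) eqT veq, of "min \<delta>1 \<delta>2"])
            (use 3 in auto)
        then show False using min_contra[of \<eta>] by simp
      qed
    qed
  qed
  then show ?thesis using on t by simp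
qed

section \<open>Cutting and splicing\<close>
definition splice :: "real \<Rightarrow> (real \<Rightarrow> 'a) \<Rightarrow> (real \<Rightarrow> 'a) \<Rightarrow> real \<Rightarrow> 'a" where
  "splice s w u t = (if t \<in> {0..1} then if t \<le> s then w (t / s) else u t else undefined)"

definition initial_part :: "real \<Rightarrow> (real \<Rightarrow> 'a) \<Rightarrow> real \<Rightarrow> 'a" where
  "initial_part s u t = (if t \<in> {0..1} then u (s * t) else undefined)"

lemma has_integral_stretch_upto:
  fixes f :: "real \<Rightarrow> 'a::euclidean_space"
  assumes "f integrable_on {0..m * t}" "m > 0"
  shows "((\<lambda>\<tau>. f (m * \<tau>)) has_integral (integral {0..m * t} f /\<^sub>R m)) {0..t}"
  using has_integral_stretch_Icc[OF integrable_integral[OF assms(1)] assms(2)] assms(2) by simp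

lemma initial_part_energy:
  fixes u :: "real \<Rightarrow> 'a::euclidean_space"
  assumes ug: "primitive_I u g" and s: "0 < s" "s \<le> 1"
  shows "primitive_I (initial_part s u) (\<lambda>t. s *\<^sub>R g (s * t))"
    and "energy (initial_part s u) = s * integral {0..s} (\<lambda>t. (norm (g t))\<^sup>2)"
proof -
  have g: "L2_on g 0 1" using ug by (simp add: primitive_I_def)
  then have gs: "L2_on g 0 s" using L2_on_subinterval[of g 0 1 0 s] s by simp
  have "L2_on (\<lambda>t. g (s * t)) (0 / s) (s / s)" by (rule L2_on_stretch[OF gs s(1)])
  then have sq: "L2_on (\<lambda>t. s *\<^sub>R g (s * t)) 0 1"
    using L2_on_linear[OF bounded_linear_scaleR_right] s by simp
  have int: "integral {0..t} (\<lambda>t. s *\<^sub>R g (s * t)) = u (s * t) - u 0" if t: "t \<in> {0..1}" for t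
  proof -
    have st: "0 \<le> s * t" "s * t \<le> s" using t s mult_left_mono[of t 1 s] by auto
    then have st1: "s * t \<le> 1" using s by linarith
    have "g integrable_on {0..s * t}" using L2_on_subinterval[OF gs, of 0 "s * t"] st by (simp add: L2_on_def)
    then have "((\<lambda>\<tau>. s *\<^sub>R g (s * \<tau>)) has_integral s *\<^sub>R (integral {0..s * t} g /\<^sub>R s)) {0..t}"
      by (intro has_integral_cmul has_integral_stretch_upto s)
    then have "integral {0..t} (\<lambda>\<tau>. s *\<^sub>R g (s * \<tau>)) = s *\<^sub>R (integral {0..s * t} g /\<^sub>R s)"
      by (rule integral_unique)
    also have "\<dots> = u (s * t) - u 0"
      using primitive_I_integral[OF ug, of 0 "s * t"] st st1 s by simp
    finally show ?thesis .
  qed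
  show pr: "primitive_I (initial_part s u) (\<lambda>t. s *\<^sub>R g (s * t))"
    unfolding primitive_I_def using sq int by (simp add: initial_part_def)
  have "(\<lambda>t. (norm (g t))\<^sup>2) integrable_on {0..s * 1}" using gs by (simp add: L2_on_def)
  then have "((\<lambda>\<tau>. s\<^sup>2 * (norm (g (s * \<tau>)))\<^sup>2) has_integral s\<^sup>2 * (integral {0..s * 1} (\<lambda>t. (norm (g t))\<^sup>2) /\<^sub>R s)) {0..1}"
    by (intro has_integral_mult_right has_integral_stretch_upto s)
  then have "integral {0..1} (\<lambda>\<tau>. s\<^sup>2 * (norm (g (s * \<tau>)))\<^sup>2)
      = s\<^sup>2 * (integral {0..s * 1} (\<lambda>t. (norm (g t))\<^sup>2) /\<^sub>R s)"
    by (rule integral_unique)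
  also have "\<dots> = s * integral {0..s} (\<lambda>t. (norm (g t))\<^sup>2)"
    using s by (simp add: power2_eq_square[of s])
  finally show "energy (initial_part s u) = s * integral {0..s} (\<lambda>t. (norm (g t))\<^sup>2)"
    unfolding energy_eq_integral[OF pr] norm_scaleR power_mult_distrib power2_abs .
qed

lemma splice_energy:
  fixes u w :: "real \<Rightarrow> 'a::euclidean_space"
  assumes ug: "primitive_I u g" and wh: "primitive_I w h" and s: "0 < s" "s < 1" and glue: "w 1 = u s"
  defines "k \<equiv> \<lambda>t. if t \<le> s then (1 / s) *\<^sub>R h ((1 / s) * t) else g t"
  shows "primitive_I (splice s w u) k"
    and "energy (splice s w u) = energy w / s + integral {s..1} (\<lambda>t. (norm (g t))\<^sup>2)"
proof -
  have g: "L2_on g 0 1" and h: "L2_on h 0 1" using ug wh by (auto simp: primitive_I_def)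
  have gs: "L2_on g s 1" using L2_on_subinterval[OF g, of s 1] s by simp
  have s': "1 / s > 0" using s by simp
  have "L2_on (\<lambda>t. h ((1 / s) * t)) (0 / (1 / s)) (1 / (1 / s))" by (rule L2_on_stretch[OF h s'])
  then have "L2_on (\<lambda>t. (1 / s) *\<^sub>R h ((1 / s) * t)) 0 s"
    using L2_on_linear[OF bounded_linear_scaleR_right] s by simp
  then have k1: "L2_on k 0 s"
    by (rule L2_on_cong_interior) (simp add: k_def)
  have k2: "L2_on k s 1"
    by (rule L2_on_cong_interior[OF gs]) (simp add: k_def)
  have k: "L2_on k 0 1" using L2_on_combine[OF _ _ k1 k2] s by simp
  have int1: "integral {0..t} k = w (t / s) - w 0" if t: "0 \<le> t" "t \<le> s" for t
  proof -
    have "h integrable_on {0..1 / s * t}"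
      using L2_on_subinterval[OF h, of 0 "1 / s * t"] t s by (simp add: L2_on_def)
    then have "((\<lambda>\<tau>. (1 / s) *\<^sub>R h (1 / s * \<tau>)) has_integral (1 / s) *\<^sub>R (integral {0..1 / s * t} h /\<^sub>R (1 / s))) {0..t}"
      by (intro has_integral_cmul has_integral_stretch_upto s')
    then have "integral {0..t} (\<lambda>\<tau>. (1 / s) *\<^sub>R h (1 / s * \<tau>))
        = (1 / s) *\<^sub>R (integral {0..1 / s * t} h /\<^sub>R (1 / s))"
      by (rule integral_unique)
    also have "\<dots> = w (t / s) - w 0"
      using primitive_I_integral[OF wh, of 0 "t / s"] t s by simp
    finally have "integral {0..t} (\<lambda>\<tau>. (1 / s) *\<^sub>R h (1 / s * \<tau>)) = w (t / s) - w 0" .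
    moreover have "integral {0..t} k = integral {0..t} (\<lambda>\<tau>. (1 / s) *\<^sub>R h (1 / s * \<tau>))"
      by (rule integral_cong_interior) (use t in \<open>simp add: k_def\<close>)
    ultimately show ?thesis by simp
  qed
  have int2: "integral {0..t} k = u t - w 0" if t: "s \<le> t" "t \<le> 1" for t
  proof -
    have "integral {0..s} k + integral {s..t} k = integral {0..t} k"
      using L2_on_subinterval[OF k, of 0 t] s t
      by (intro Henstock_Kurzweil_Integration.integral_combine) (auto simp: L2_on_def)
    moreover have "integral {0..s} k = u s - w 0" using int1[of s] s glue by simp
    moreover have "integral {s..t} k = integral {s..t} g"
      by (rule integral_cong_interior) (simp add: k_def)
    moreover have "integral {s..t} g = u t - u s" using primitive_I_integral[OF ug, of s t] s t by simp
    ultimately show ?thesis by (metis add.commute diff_add_cancel add_diff_eq)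
  qed
  have sp0: "splice s w u 0 = w 0" using s by (simp add: splice_def)
  show pr: "primitive_I (splice s w u) k"
    unfolding primitive_I_def
  proof (intro conjI ballI k)
    fix t :: real assume t: "t \<in> {0..1}"
    show "integral {0..t} k = splice s w u t - splice s w u 0"
      using int1[of t] int2[of t] t unfolding sp0 by (cases "t \<le> s") (auto simp: splice_def)
  qed
  have "((\<lambda>\<tau>. (1 / s)\<^sup>2 * (norm (h (1 / s * \<tau>)))\<^sup>2) has_integral
      (1 / s)\<^sup>2 * (integral {0..1 / s * s} (\<lambda>t. (norm (h t))\<^sup>2) /\<^sub>R (1 / s))) {0..s}"
    using h s by (intro has_integral_mult_right has_integral_stretch_upto s') (simp add: L2_on_def)
  then have "integral {0..s} (\<lambda>\<tau>. (1 / s)\<^sup>2 * (norm (h (1 / s * \<tau>)))\<^sup>2)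
      = (1 / s)\<^sup>2 * (integral {0..1 / s * s} (\<lambda>t. (norm (h t))\<^sup>2) /\<^sub>R (1 / s))"
    by (rule integral_unique)
  also have "\<dots> = energy w / s"
    using s by (simp add: energy_eq_integral[OF wh] power2_eq_square[of "1 / s"])
  finally have "integral {0..s} (\<lambda>\<tau>. (1 / s)\<^sup>2 * (norm (h (1 / s * \<tau>)))\<^sup>2) = energy w / s" .
  moreover have "integral {0..s} (\<lambda>t. (norm (k t))\<^sup>2) = integral {0..s} (\<lambda>\<tau>. (1 / s)\<^sup>2 * (norm (h (1 / s * \<tau>)))\<^sup>2)"
    by (rule integral_cong_interior) (simp add: k_def power_mult_distrib power_divide)
  moreover have "integral {s..1} (\<lambda>t. (norm (k t))\<^sup>2) = integral {s..1} (\<lambda>t. (norm (g t))\<^sup>2)"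
    by (rule integral_cong_interior) (simp add: k_def)
  moreover have "integral {0..s} (\<lambda>t. (norm (k t))\<^sup>2) + integral {s..1} (\<lambda>t. (norm (k t))\<^sup>2) = integral {0..1} (\<lambda>t. (norm (k t))\<^sup>2)"
    using k s by (intro Henstock_Kurzweil_Integration.integral_combine) (auto simp: L2_on_def)
  ultimately show "energy (splice s w u) = energy w / s + integral {s..1} (\<lambda>t. (norm (g t))\<^sup>2)"
    by (simp add: energy_eq_integral[OF pr])
qed

text \<open>
  Stretching \<open>[0,s]\<close> to \<open>[0,1]\<close> multiplies the energy by the constant \<open>s\<close>, so minimizing up to \<open>u s\<close>
  and minimizing the spliced curve up to \<open>q\<close> are equivalent.
\<close>
lemma interior_point_of_minimizer_unique:
  fixes u :: "real \<Rightarrow> 'a::euclidean_space"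
  assumes min: "is_minimizer \<Omega> p q u" and sb: "smooth_boundary \<Omega>" and op: "open \<Omega>" and cv: "convex \<Omega>"
    and s: "0 < s" "s < 1" and off: "u s \<notin> closure \<Omega>"
  shows "u s \<in> unique_set \<Omega> p"
proof -
  obtain g where ug: "primitive_I u g" using min by (auto simp: is_minimizer_iff admissible_iff)
  have u: "u 0 = p" "u 1 = q" "\<And>t. t \<in> {0..1} \<Longrightarrow> u t \<notin> \<Omega>"
    and umin: "\<And>v. v \<in> admissible \<Omega> p q \<Longrightarrow> energy u \<le> energy v"
    using min by (auto simp: is_minimizer_iff admissible_iff)
  define E1 E2 where "E1 = integral {0..s} (\<lambda>t. (norm (g t))\<^sup>2)" and "E2 = integral {s..1} (\<lambda>t. (norm (g t))\<^sup>2)"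
  have Eu: "energy u = E1 + E2"
    unfolding energy_eq_integral[OF ug] E1_def E2_def using ug s
    by (intro Henstock_Kurzweil_Integration.integral_combine[symmetric]) (auto simp: primitive_I_def L2_on_def)
  have splice_adm: "splice s w u \<in> admissible \<Omega> p q" and splice_E: "energy (splice s w u) = energy w / s + E2"
    if w: "w \<in> admissible \<Omega> p (u s)" for w
  proof -
    obtain h where wh: "primitive_I w h" using w by (auto simp: admissible_iff)
    have w': "w 0 = p" "w 1 = u s" "\<And>t. t \<in> {0..1} \<Longrightarrow> w t \<notin> \<Omega>" using w by (auto simp: admissible_iff)
    show "energy (splice s w u) = energy w / s + E2"
      unfolding E2_def by (rule splice_energy(2)[OF ug wh s w'(2)])
    have "splice s w u t \<notin> \<Omega>" if "t \<in> {0..1}" for t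
      using that w'(3)[of "t / s"] u(3)[of t] s by (auto simp: splice_def)
    moreover have "splice s w u \<in> extensional {0..1}" by (auto simp: splice_def extensional_def)
    ultimately show "splice s w u \<in> admissible \<Omega> p q"
      unfolding admissible_iff using splice_energy(1)[OF ug wh s w'(2)] s w' u
      by (auto simp: splice_def)
  qed
  define r where "r = initial_part s u"
  have rE: "energy r = s * E1" unfolding r_def E1_def using initial_part_energy(2)[OF ug] s by simp
  have r_adm: "r \<in> admissible \<Omega> p (u s)"
  proof -
    have "s * t \<in> {0..1}" if "t \<in> {0..1}" for t
    proof -
      have "0 \<le> s * t" "s * t \<le> s" using that s mult_left_mono[of t 1 s] by auto
      then show ?thesis using s unfolding atLeastAtMost_iff by linarith
    qed
    then have "r t \<notin> \<Omega>" if "t \<in> {0..1}" for t using that u(3) by (simp add: r_def initial_part_def)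
    moreover have "r \<in> extensional {0..1}" by (auto simp: r_def initial_part_def extensional_def)
    moreover have "r 0 = p" "r 1 = u s" using u by (auto simp: r_def initial_part_def)
    ultimately show ?thesis
      unfolding admissible_iff using initial_part_energy(1)[OF ug, of s] s by (auto simp: r_def)
  qed
  have r_min: "is_minimizer \<Omega> p (u s) r"
    unfolding is_minimizer_iff
  proof (intro conjI ballI r_adm)
    fix v assume v: "v \<in> admissible \<Omega> p (u s)"
    have "E1 + E2 \<le> energy v / s + E2" using umin[OF splice_adm[OF v]] splice_E[OF v] Eu by simp
    then show "energy r \<le> energy v" using s by (simp add: rE field_simps)
  qed
  have "w = r" if w: "is_minimizer \<Omega> p (u s) w" for w
  proof -
    have w_adm: "w \<in> admissible \<Omega> p (u s)" and "energy w \<le> energy r"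
      using w r_adm by (auto simp: is_minimizer_iff)
    then have "energy (splice s w u) \<le> energy u"
      using s by (simp add: splice_E Eu rE field_simps)
    then have smin: "is_minimizer \<Omega> p q (splice s w u)"
      using splice_adm[OF w_adm] umin by (auto simp: is_minimizer_iff intro: order_trans)
    have w1: "w 1 = u s" "w \<in> extensional {0..1}" using w_adm by (auto simp: admissible_iff)
    have agree: "splice s w u t = u t" if "t \<in> {0..1}" for t
    proof (rule minimizers_do_not_branch[OF smin min sb op cv s(2) _ that])
      show "splice s w u t = u t" if "t \<in> {s..1}" for t
        using that w1 s by (cases "t = s") (auto simp: splice_def)
    qed
    have "w t = r t" for t
    proof (cases "t \<in> {0..1}")
      case True
      then have st: "0 \<le> s * t" "s * t \<le> s" using s mult_left_mono[of t 1 s] by auto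
      then have st1: "s * t \<in> {0..1}" using s unfolding atLeastAtMost_iff by linarith
      then have "splice s w u (s * t) = w t" using s st st1 by (simp add: splice_def)
      then show ?thesis using agree[OF st1] True by (simp add: r_def initial_part_def)
    next
      case False
      then show ?thesis using w1(2) by (auto simp: extensional_def r_def initial_part_def)
    qed
    then show ?thesis by auto
  qed
  then have "\<exists>!w. is_minimizer \<Omega> p (u s) w" using r_min by blast
  then show ?thesis using off by (simp add: unique_set_def)
qed

theorem theorem1p2:
  fixes \<Omega> :: "(real ^ 'n) set" and p :: "real ^ 'n"
  assumes "CARD('n) \<ge> 2"
    and "\<Omega> \<noteq> {}" and "open \<Omega>" and "connected \<Omega>" and "bounded \<Omega>" and "convex \<Omega>"
    and "smooth_boundary \<Omega>"
    and "p \<in> - closure \<Omega>"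
  shows "nonunique_set \<Omega> p \<subseteq> frontier (unique_set \<Omega> p) \<and>
         interior (nonunique_set \<Omega> p) = {}"
proof -
  have disj: "nonunique_set \<Omega> p \<inter> unique_set \<Omega> p = {}"
    by (auto simp: nonunique_set_def unique_set_def)
  have cl: "nonunique_set \<Omega> p \<subseteq> closure (unique_set \<Omega> p)"
  proof
    fix q assume "q \<in> nonunique_set \<Omega> p"
    then obtain u where q: "q \<in> - closure \<Omega>" and u: "is_minimizer \<Omega> p q u"
      by (auto simp: nonunique_set_def)
    have u1: "u 1 = q" using u by (simp add: is_minimizer_iff admissible_iff)
    show "q \<in> closure (unique_set \<Omega> p)"
      unfolding closure_approachable
    proof (intro allI impI)
      fix e :: real assume "e > 0"
      obtain d where d: "d > 0" "ball q d \<subseteq> - closure \<Omega>"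
        using q by (meson closed_closure open_Compl open_contains_ball)
      have "min d e > 0" using d \<open>e > 0\<close> by simp
      then obtain \<delta> where \<delta>: "\<delta> > 0" "\<And>t. t \<in> {0..1} \<Longrightarrow> dist t 1 < \<delta> \<Longrightarrow> dist (u t) (u 1) < min d e"
        using minimizer_continuous[OF u] unfolding continuous_on_iff by (metis atLeastAtMost_iff order_refl zero_le_one)
      define s where "s = max (1/2) (1 - \<delta> / 2)"
      have s: "0 < s" "s < 1" "dist s 1 < \<delta>" using \<delta>(1) by (auto simp: s_def dist_real_def max_def)
      have near: "dist (u s) q < min d e" using \<delta>(2)[of s] s u1 by simp
      then have "u s \<in> ball q d" by (simp add: dist_commute)
      then have "u s \<notin> closure \<Omega>" using d(2) by blast
      then have "u s \<in> unique_set \<Omega> p"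
        using assms s by (intro interior_point_of_minimizer_unique[OF u]) auto
      then show "\<exists>y\<in>unique_set \<Omega> p. dist y q < e" using near by auto
    qed
  qed
  have "nonunique_set \<Omega> p \<subseteq> frontier (unique_set \<Omega> p)"
    using cl disj interior_subset by (fastforce simp: frontier_def)
  moreover have "interior (nonunique_set \<Omega> p) = {}"
  proof -
    have "interior (nonunique_set \<Omega> p) \<inter> unique_set \<Omega> p = {}"
      using disj interior_subset by blast
    then have "interior (nonunique_set \<Omega> p) \<inter> closure (unique_set \<Omega> p) = {}"
      by (simp add: open_Int_closure_eq_empty)
    then show ?thesis using cl interior_subset by blast
  qed
  ultimately show ?thesis by blast
qed

end
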